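(* Let $\varphi$ be a random dynamical system with memoryless noise on the state space $X$ (setting described in the context), let $\rho$ be an ergodic probability measure of the Markov transition probabilities $(\varphi_x^t)$, and suppose that $\varphi$ is stable with respect to $\rho$. Then the following statements are equivalent: (i) there is a Borel set $R \subset X$ with $\rho(R)>0$ such that for each $p \in R$, the set $\mathfrak{C}_p$ contains a $\rho$-full-length rectangle; (ii) the set $\mathfrak{C}_{A_\rho}$ contains a $\rho$-full-length rectangle; (iii) $\varphi$ is $\rho$-almost everywhere stably synchronising; (iv) there is a $\rho$-full set $A \subset \mathrm{supp}\,\rho$ such that for any $x,y \in A$, $\mathbb{P}$-almost every $\omega \in \Omega$ has the property that for every open $U \subset X$ with $\rho(U)>0$ there exists $t \in \mathbb{T}^+$ such that $\varphi(t,\omega)x \in U$ and $\varphi(t,\omega)y \in U$.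
   Context: Setting. $\mathbb{T}$ is $\mathbb{Z}$ or $\mathbb{R}$, $\mathbb{T}^+ := \mathbb{T}\cap[0,\infty)$. $(\Omega,\mathcal{F})$ is a measurable space with sub-$\sigma$-algebras $(\mathcal{F}_s^{s+t})_{s\in\mathbb{T},t\in\mathbb{T}^+}$ such that $\mathcal{F}_{t_1}^{t_2}\subset\mathcal{F}_{t_0}^{t_3}$ whenever $t_0\le t_1\le t_2\le t_3$, and these generate $\mathcal{F}$. Write $\mathcal{F}_s^\infty:=\sigma(\mathcal{F}_s^{s+t}:t\in\mathbb{T}^+)$ and $\mathcal{F}_{-\infty}^t:=\sigma(\mathcal{F}_{t-s}^t:s\in\mathbb{T}^+)$. $(\theta^t)_{t\in\mathbb{T}}$ is a group of measurable maps $\Omega\to\Omega$ with $\theta^\tau\mathcal{F}_s^t=\mathcal{F}_{s-\tau}^{t-\tau}$. $\mathbb{P}$ is a probability measure on $(\Omega,\mathcal{F})$ with $\theta^t_*\mathbb{P}=\mathbb{P}$ for all $t$, and such that for each $t$, $\mathcal{F}_{-\infty}^t$ and $\mathcal{F}_t^\infty$ are $\mathbb{P}$-independent. $(X,d)$ is a separable metric space which is a Borel subset of its $d$-completion; $B_\delta(x)$ is the open $\delta$-ball and $\Delta_A:=\{(x,x):x\in A\}$. $\varphi=(\varphi(t,\omega))_{t\in\mathbb{T}^+,\omega\in\Omega}$ is a family of continuous maps $X\to X$ such that (a) $\omega\mapsto\varphi(t,\omega)x$ is $(\mathcal{F}_0^t,\mathcal{B}(X))$-measurable for each $t,x$; (b)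 $\varphi(0,\omega)=\mathrm{id}_X$; (c) $\varphi(s+t,\omega)=\varphi(t,\theta^s\omega)\circ\varphi(s,\omega)$; (d) if $t_n\downarrow t$ in $\mathbb{T}^+$ and $x_n\to x$ in $X$ then $\varphi(t_n,\omega)x_n\to\varphi(t,\omega)x$ for all $\omega$. The Markov transition probabilities are $\varphi_x^t(A):=\mathbb{P}(\omega:\varphi(t,\omega)x\in A)$; a probability measure $\rho$ on $X$ is stationary if $\rho(A)=\int\varphi_x^t(A)\,\rho(dx)$ for all $t,A$, and an ergodic probability measure of $(\varphi_x^t)$ is an ergodic stationary measure. Definitions. A set $A\subset X$ contracts under $\omega$ if $\mathrm{diam}(\varphi(t,\omega)A)\to0$ as $t\to\infty$. $x$ is asymptotically stable under $\omega$ if some neighbourhood of $x$ contracts under $\omega$. $\varphi$ is stable with respect to $\rho$ if $\mathbb{P}(\omega:\exists$ open $U$ with $U\cap\mathrm{supp}\,\rho\neq\emptyset$ that contracts under $\omega)>0$. An open set $U$ is $\sigma$-contracting under $\omega$ if $U=\bigcup_i U_i$ for an increasing sequence of open sets $U_i$ each contracting under $\omega$. $\varphi$ is $\rho$-almost everywhere stably synchronising if for $\mathbb{P}$-a.e. $\omega$ there is an open set $U$ with $\rho(U)=1$ that is $\sigma$-contracting under $\omega$. For $x,y,p\in X$, $(x,y)$ is contractible towards $p$ if for every $\varepsilon>0$, $\mathbb{P}(\omega:\exists t\in\mathbb{T}^+,\ \varphi(t,\omega)x,\varphi(t,\omega)y\in B_\varepsilon(p))>0$; $\mathfrak{C}_p\subset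 X\times X$ is the set of such pairs. For $A\subset X$, $(x,y)$ is contractible towards $A$ if for every neighbourhood $V$ of $\Delta_A$ in $X\times X$, $\mathbb{P}(\omega:\exists t\in\mathbb{T}^+,\ (\varphi(t,\omega)x,\varphi(t,\omega)y)\in V)>0$; $\mathfrak{C}_A$ is the set of such pairs. A point $x\in\mathrm{supp}\,\rho$ is $\rho$-transitive if for every open $U$ with $\rho(U)>0$, $\mathbb{P}(\omega:\exists t\in\mathbb{T}^+,\ \varphi(t,\omega)x\in U)>0$; $A_\rho$ is the set of $\rho$-transitive points. A $\rho$-full-length rectangle is a set $A_1\times A_2\subset X\times X$ with $A_1,A_2$ Borel, $\rho(A_1)>0$, $\rho(A_2)=1$. *)

theory Defs
  imports "HOL-Probability.Probability"
begin

text \<open>Time: the time set T is either the integers or the reals (both viewed inside real);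
  Tp is the nonnegative part.\<close>

definition Tpos :: "real set \<Rightarrow> real set" where
  "Tpos T = {t \<in> T. 0 \<le> t}"

text \<open>Positive probability of a (possibly non-measurable) event: it contains a measurable
  event of positive probability.  For measurable events this is just P(S) > 0.\<close>

definition pos_prob :: "'w measure \<Rightarrow> 'w set \<Rightarrow> bool" where
  "pos_prob M S \<longleftrightarrow> (\<exists>E\<in>sets M. E \<subseteq> S \<and> 0 < measure M E)"

definition F_future :: "real set \<Rightarrow> 'w measure \<Rightarrow> (real \<Rightarrow> real \<Rightarrow> 'w set set) \<Rightarrow> real \<Rightarrow> 'w set set" where
  "F_future T M F s = sigma_sets (space M) (\<Union>u\<in>{u\<in>T. s \<le> u}. F s u)"

definition F_past :: "real set \<Rightarrow> 'w measure \<Rightarrow> (real \<Rightarrow> real \<Rightarrow> 'w set set) \<Rightarrow> real \<Rightarrow> 'w set set" where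
  "F_past T M F t = sigma_sets (space M) (\<Union>s\<in>{s\<in>T. s \<le> t}. F s t)"

text \<open>The standing setting: a random dynamical system with memoryless noise.
  The state space X is a Borel subset of a complete metric space (type 'm); this encodes
  "separable metric space which is a Borel subset of its completion" (the completion of X
  being its closure in 'm).  F s u stands for the sub-sigma-algebra F_s^u (s \<le> u).\<close>

definition memoryless_RDS ::
  "real set \<Rightarrow> 'w measure \<Rightarrow> (real \<Rightarrow> real \<Rightarrow> 'w set set) \<Rightarrow> (real \<Rightarrow> 'w \<Rightarrow> 'w)
    \<Rightarrow> ('m::complete_space) set \<Rightarrow> (real \<Rightarrow> 'w \<Rightarrow> 'm \<Rightarrow> 'm) \<Rightarrow> bool" where
  "memoryless_RDS T M F \<theta> X \<phi> \<longleftrightarrow>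
     (T = \<int> \<or> T = UNIV) \<and>
     prob_space M \<and>
     \<comment> \<open>sub-sigma-algebras, monotone in the interval, generating F\<close>
     (\<forall>s\<in>T. \<forall>u\<in>T. s \<le> u \<longrightarrow> sigma_algebra (space M) (F s u) \<and> F s u \<subseteq> sets M) \<and>
     (\<forall>t0\<in>T. \<forall>t1\<in>T. \<forall>t2\<in>T. \<forall>t3\<in>T. t0 \<le> t1 \<and> t1 \<le> t2 \<and> t2 \<le> t3 \<longrightarrow> F t1 t2 \<subseteq> F t0 t3) \<and>
     sets M = sigma_sets (space M) (\<Union>{F s u |s u. s \<in> T \<and> u \<in> T \<and> s \<le> u}) \<and>
     \<comment> \<open>group of measurable, measure-preserving shifts\<close>
     (\<forall>t\<in>T. \<theta> t \<in> measurable M M) \<and>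
     (\<forall>\<omega>\<in>space M. \<theta> 0 \<omega> = \<omega>) \<and>
     (\<forall>s\<in>T. \<forall>t\<in>T. \<forall>\<omega>\<in>space M. \<theta> (s + t) \<omega> = \<theta> s (\<theta> t \<omega>)) \<and>
     (\<forall>\<tau>\<in>T. \<forall>s\<in>T. \<forall>u\<in>T. s \<le> u \<longrightarrow> (\<lambda>A. \<theta> \<tau> ` A) ` F s u = F (s - \<tau>) (u - \<tau>)) \<and>
     (\<forall>t\<in>T. distr M M (\<theta> t) = M) \<and>
     \<comment> \<open>memoryless noise: past and future independent\<close>
     (\<forall>t\<in>T. prob_space.indep_set M (F_past T M F t) (F_future T M F t)) \<and>
     \<comment> \<open>state space\<close>
     X \<in> sets borel \<and>
     (\<exists>D\<subseteq>X. countable D \<and> X \<subseteq> closure D) \<and>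
     \<comment> \<open>the cocycle\<close>
     (\<forall>t\<in>Tpos T. \<forall>\<omega>\<in>space M. continuous_on X (\<phi> t \<omega>) \<and> \<phi> t \<omega> ` X \<subseteq> X) \<and>
     (\<forall>t\<in>Tpos T. \<forall>x\<in>X. (\<lambda>\<omega>. \<phi> t \<omega> x) \<in> measurable (sigma (space M) (F 0 t)) (restrict_space borel X)) \<and>
     (\<forall>\<omega>\<in>space M. \<forall>x\<in>X. \<phi> 0 \<omega> x = x) \<and>
     (\<forall>s\<in>Tpos T. \<forall>t\<in>Tpos T. \<forall>\<omega>\<in>space M. \<forall>x\<in>X. \<phi> (s + t) \<omega> x = \<phi> t (\<theta> s \<omega>) (\<phi> s \<omega> x)) \<and>
     (\<forall>\<omega>\<in>space M. \<forall>t\<in>Tpos T. \<forall>x\<in>X. \<forall>tn xn.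
        (\<forall>n. tn n \<in> Tpos T \<and> xn n \<in> X) \<and> decseq tn \<and> tn \<longlonglongrightarrow> t \<and> xn \<longlonglongrightarrow> x
        \<longrightarrow> (\<lambda>n. \<phi> (tn n) \<omega> (xn n)) \<longlonglongrightarrow> \<phi> t \<omega> x)"

definition prob_on :: "'m::metric_space set \<Rightarrow> 'm measure \<Rightarrow> bool" where
  "prob_on X \<rho> \<longleftrightarrow> prob_space \<rho> \<and> sets \<rho> = sets (restrict_space borel X) \<and> space \<rho> = X"

definition trans_prob :: "'w measure \<Rightarrow> (real \<Rightarrow> 'w \<Rightarrow> 'm \<Rightarrow> 'm) \<Rightarrow> real \<Rightarrow> 'm \<Rightarrow> 'm set \<Rightarrow> real" where
  "trans_prob M \<phi> t x A = measure M {\<omega> \<in> space M. \<phi> t \<omega> x \<in> A}"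

definition stationary ::
  "real set \<Rightarrow> 'w measure \<Rightarrow> 'm::metric_space set \<Rightarrow> (real \<Rightarrow> 'w \<Rightarrow> 'm \<Rightarrow> 'm) \<Rightarrow> 'm measure \<Rightarrow> bool" where
  "stationary T M X \<phi> \<rho> \<longleftrightarrow> prob_on X \<rho> \<and>
     (\<forall>t\<in>Tpos T. \<forall>A\<in>sets \<rho>. measure \<rho> A = (\<integral>x. trans_prob M \<phi> t x A \<partial>\<rho>))"

definition ergodic ::
  "real set \<Rightarrow> 'w measure \<Rightarrow> 'm::metric_space set \<Rightarrow> (real \<Rightarrow> 'w \<Rightarrow> 'm \<Rightarrow> 'm) \<Rightarrow> 'm measure \<Rightarrow> bool" where
  "ergodic T M X \<phi> \<rho> \<longleftrightarrow> stationary T M X \<phi> \<rho> \<and>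
     (\<forall>A\<in>sets \<rho>. (\<forall>t\<in>Tpos T. AE x in \<rho>. trans_prob M \<phi> t x A = indicator A x)
        \<longrightarrow> measure \<rho> A = 0 \<or> measure \<rho> A = 1)"

definition supp :: "'m::metric_space set \<Rightarrow> 'm measure \<Rightarrow> 'm set" where
  "supp X \<rho> = {x \<in> X. \<forall>U. openin (top_of_set X) U \<and> x \<in> U \<longrightarrow> 0 < measure \<rho> U}"

definition contracts ::
  "real set \<Rightarrow> (real \<Rightarrow> 'w \<Rightarrow> 'm::metric_space \<Rightarrow> 'm) \<Rightarrow> 'm set \<Rightarrow> 'w \<Rightarrow> bool" where
  "contracts T \<phi> A \<omega> \<longleftrightarrow>
     (\<forall>\<epsilon>>0. \<exists>s. \<forall>t\<in>Tpos T. s \<le> t \<longrightarrow> (\<forall>x\<in>A. \<forall>y\<in>A. dist (\<phi> t \<omega> x) (\<phi> t \<omega> y) \<le> \<epsilon>))"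

definition stable_wrt ::
  "real set \<Rightarrow> 'w measure \<Rightarrow> 'm::metric_space set \<Rightarrow> (real \<Rightarrow> 'w \<Rightarrow> 'm \<Rightarrow> 'm) \<Rightarrow> 'm measure \<Rightarrow> bool" where
  "stable_wrt T M X \<phi> \<rho> \<longleftrightarrow>
     pos_prob M {\<omega> \<in> space M. \<exists>U. openin (top_of_set X) U \<and> U \<inter> supp X \<rho> \<noteq> {} \<and> contracts T \<phi> U \<omega>}"

definition sigma_contracting ::
  "real set \<Rightarrow> 'm::metric_space set \<Rightarrow> (real \<Rightarrow> 'w \<Rightarrow> 'm \<Rightarrow> 'm) \<Rightarrow> 'm set \<Rightarrow> 'w \<Rightarrow> bool" where
  "sigma_contracting T X \<phi> U \<omega> \<longleftrightarrow> openin (top_of_set X) U \<and>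
     (\<exists>Ui :: nat \<Rightarrow> 'm set. incseq Ui \<and> (\<forall>i. openin (top_of_set X) (Ui i) \<and> contracts T \<phi> (Ui i) \<omega>)
        \<and> U = (\<Union>i. Ui i))"

definition ae_stably_synchronising ::
  "real set \<Rightarrow> 'w measure \<Rightarrow> 'm::metric_space set \<Rightarrow> (real \<Rightarrow> 'w \<Rightarrow> 'm \<Rightarrow> 'm) \<Rightarrow> 'm measure \<Rightarrow> bool" where
  "ae_stably_synchronising T M X \<phi> \<rho> \<longleftrightarrow>
     (AE \<omega> in M. \<exists>U. openin (top_of_set X) U \<and> measure \<rho> U = 1 \<and> sigma_contracting T X \<phi> U \<omega>)"

definition contractible_pt ::
  "real set \<Rightarrow> 'w measure \<Rightarrow> 'm::metric_space set \<Rightarrow> (real \<Rightarrow> 'w \<Rightarrow> 'm \<Rightarrow> 'm) \<Rightarrow> 'm \<Rightarrow> ('m \<times> 'm) set" where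
  "contractible_pt T M X \<phi> p = {(x, y) \<in> X \<times> X. \<forall>\<epsilon>>0.
     pos_prob M {\<omega> \<in> space M. \<exists>t\<in>Tpos T. \<phi> t \<omega> x \<in> ball p \<epsilon> \<and> \<phi> t \<omega> y \<in> ball p \<epsilon>}}"

definition contractible_set ::
  "real set \<Rightarrow> 'w measure \<Rightarrow> 'm::metric_space set \<Rightarrow> (real \<Rightarrow> 'w \<Rightarrow> 'm \<Rightarrow> 'm) \<Rightarrow> 'm set \<Rightarrow> ('m \<times> 'm) set" where
  "contractible_set T M X \<phi> A = {(x, y) \<in> X \<times> X. \<forall>V.
     (\<exists>W. openin (top_of_set (X \<times> X)) W \<and> {(a, a) |a. a \<in> A} \<subseteq> W \<and> W \<subseteq> V) \<longrightarrow>
     pos_prob M {\<omega> \<in> space M. \<exists>t\<in>Tpos T. (\<phi> t \<omega> x, \<phi> t \<omega> y) \<in> V}}"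

definition transitive_pts ::
  "real set \<Rightarrow> 'w measure \<Rightarrow> 'm::metric_space set \<Rightarrow> (real \<Rightarrow> 'w \<Rightarrow> 'm \<Rightarrow> 'm) \<Rightarrow> 'm measure \<Rightarrow> 'm set" where
  "transitive_pts T M X \<phi> \<rho> = {x \<in> supp X \<rho>. \<forall>U. openin (top_of_set X) U \<and> 0 < measure \<rho> U \<longrightarrow>
     pos_prob M {\<omega> \<in> space M. \<exists>t\<in>Tpos T. \<phi> t \<omega> x \<in> U}}"

definition contains_full_rect :: "'m measure \<Rightarrow> ('m \<times> 'm) set \<Rightarrow> bool" where
  "contains_full_rect \<rho> C \<longleftrightarrow> (\<exists>A1 A2. A1 \<in> sets \<rho> \<and> A2 \<in> sets \<rho> \<and>
     0 < measure \<rho> A1 \<and> measure \<rho> A2 = 1 \<and> A1 \<times> A2 \<subseteq> C)"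

end

theory Submission
  imports Defs
begin

text \<open>The hard implication is (ii) to (iii). Transitivity and stability upgrade contractibility of \<open>(x, y)\<close> towards
  \<open>A\<^sub>\<rho>\<close> to: with positive probability whole balls around \<open>x\<close> and \<open>y\<close> contract together. This lower bound is uniform on
  compact rectangles \<open>K1 \<times> K2\<close>, and \<open>\<rho>\<close> is tight. Two independent \<open>\<rho>\<close>-distributed points enter such a rectangle, within
  boundedly many times after any given time and outside a set of small probability: the first coordinate by recurrence,
  the second by stationarity. Since the event of not synchronising is asymptotically determined by the past, it
  cannot have positive probability. Almost sure synchronisation of \<open>\<rho>\<close>-almost all pairs then merges the countably
  many contracting neighbourhoods of typical points. Conversely, synchronised trajectories of typical points
  visit open sets of positive measure together, because a single one does so infinitely often.\<close>

section \<open>Approximation and regularity of finite measures\<close>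

text \<open>Only the one-point motions are stationary. Recurrence is therefore asked of the first
  coordinate alone, and a union bound over finitely many times keeps the second one in
  \<open>K2\<close>. This is why one side of the rectangle must have full measure while positive
  measure suffices for the other. Recurrence and almost sure local contraction both come from one
  zero-one law for events of a starting point and the future noise that hold at the start whenever
  they hold after some elapsed time. Where martingale convergence would be natural, an event is
  approximated by one determined in finite time. The cycle of implications closes through joint
  visits to balls around points of the support, which give (i), and (i) gives (ii) because the
  transitive points have full measure and hence meet \<open>R\<close>.\<close>

lemma (in finite_measure) algebra_approximation:
  assumes alg: "algebra (space M) \<A>" and sub: "\<A> \<subseteq> sets M"
    and B: "B \<in> sigma_sets (space M) \<A>" and "0 < (e::real)"
  shows "\<exists>G\<in>\<A>. measure M (B - G) + measure M (G - B) < e"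
  using B \<open>0 < e\<close>
proof (induction arbitrary: e rule: sigma_sets.induct)
  case (Basic a)
  then show ?case by (intro bexI[of _ a]) auto
next
  case Empty
  have "{} \<in> \<A>" using alg by (simp add: algebra_iff_Un)
  then show ?case using Empty by (intro bexI[of _ "{}"]) auto
next
  case (Compl a)
  then obtain G where G: "G \<in> \<A>" "measure M (a - G) + measure M (G - a) < e" by blast
  have "G \<subseteq> space M" "a \<subseteq> space M"
    using G sub sets.sets_into_space Compl(1) sub[THEN order_trans, OF sets.space_closed]
      sigma_sets_into_sp[of \<A> "space M" a] by blast+
  then have "(space M - a) - (space M - G) = G - a" "(space M - G) - (space M - a) = a - G" by auto
  then show ?case
    using G algebra.compl_sets[OF alg G(1)] by (intro bexI[of _ "space M - G"]) auto
next
  case (Union a)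
  have aM: "a i \<in> sets M" for i
    using Union(1)[of i] sets.sigma_sets_subset[OF sub] by blast
  have "(\<lambda>n. measure M (\<Union>i<n. a i)) \<longlonglongrightarrow> measure M (\<Union>n. \<Union>i<n. a i)"
  proof (rule finite_Lim_measure_incseq)
    show "incseq (\<lambda>n. \<Union>i<n. a i)" unfolding incseq_def by (intro allI impI UN_mono) auto
  qed (use aM in auto)
  moreover have U: "(\<Union>n. \<Union>i<n. a i) = (\<Union>i. a i)" by auto
  ultimately have "\<forall>\<^sub>F n in sequentially. measure M (\<Union>i. a i) - e/2 < measure M (\<Union>i<n. a i)"
    using Union.prems by (intro order_tendstoD) auto
  then obtain n where n: "measure M (\<Union>i. a i) - e/2 < measure M (\<Union>i<n. a i)"
    by (auto simp: eventually_sequentially)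
  \<comment> \<open>Half of \<open>e\<close> pays for the part of the union beyond \<open>n\<close>;
    the other half is split among the first \<open>n\<close> sets. Dividing by \<open>Suc n\<close>
    covers \<open>n = 0\<close>.\<close>
  have "\<exists>G\<in>\<A>. measure M (a i - G) + measure M (G - a i) < e / (2 * real (Suc n))" for i
    by (rule Union.IH) (use Union.prems in auto)
  then obtain G where G: "\<And>i. G i \<in> \<A>"
    and Gm: "\<And>i. measure M (a i - G i) + measure M (G i - a i) < e / (2 * real (Suc n))" by metis
  have GM: "\<And>i. G i \<in> sets M" using G sub by auto
  let ?G = "\<Union>i<n. G i"
  have "?G \<in> \<A>" using alg G by (intro ring_of_sets.finite_UN) (auto simp: algebra_def)
  moreover have "measure M ((\<Union>i. a i) - ?G) + measure M (?G - (\<Union>i. a i)) < e"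
  proof -
    have "measure M ((\<Union>i. a i) - ?G)
        \<le> measure M (((\<Union>i. a i) - (\<Union>i<n. a i)) \<union> (\<Union>i<n. a i - G i))"
      by (rule finite_measure_mono) (use aM GM in auto)
    also have "\<dots> \<le> measure M ((\<Union>i. a i) - (\<Union>i<n. a i)) + measure M (\<Union>i<n. a i - G i)"
      by (rule measure_Un_le) (use aM GM in auto)
    also have "measure M ((\<Union>i. a i) - (\<Union>i<n. a i)) < e/2"
      using n aM by (subst finite_measure_Diff) auto
    also have "measure M (\<Union>i<n. a i - G i) \<le> (\<Sum>i<n. measure M (a i - G i))"
      by (rule finite_measure_subadditive_finite) (use aM GM in auto)
    finally have 1: "measure M ((\<Union>i. a i) - ?G) < e/2 + (\<Sum>i<n. measure M (a i - G i))" by simp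
    have "measure M (?G - (\<Union>i. a i)) \<le> measure M (\<Union>i<n. G i - a i)"
      by (rule finite_measure_mono) (use aM GM in auto)
    also have "\<dots> \<le> (\<Sum>i<n. measure M (G i - a i))"
      by (rule finite_measure_subadditive_finite) (use aM GM in auto)
    finally have "measure M ((\<Union>i. a i) - ?G) + measure M (?G - (\<Union>i. a i))
        < e/2 + (\<Sum>i<n. measure M (a i - G i) + measure M (G i - a i))"
      using 1 by (simp add: sum.distrib)
    also have "(\<Sum>i<n. measure M (a i - G i) + measure M (G i - a i))
        \<le> (\<Sum>i<n. e / (2 * real (Suc n)))"
      by (rule sum_mono) (use Gm less_imp_le in blast)
    also have "\<dots> \<le> e/2" using Union.prems by (simp add: field_simps)
    finally show ?thesis by simp
  qed
  ultimately show ?case by blast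
qed

text \<open>Sets squeezed between a closed and an open set with small difference form a
  sigma-algebra: complementation exchanges the two, and a countable union costs a geometric series
  outside and a truncation inside. Closed sets belong to it as decreasing intersections of open
  neighbourhoods. The argument works in any metric space, as the ambient type of \<open>X\<close>
  may be non-separable.\<close>

lemma finite_measure_borel_regular:
  fixes N :: "'a::metric_space measure"
  assumes fin: "finite_measure N" and sets: "sets N = sets borel"
    and A: "A \<in> sets borel" and "0 < (e::real)"
  shows "\<exists>C G. closed C \<and> open G \<and> C \<subseteq> A \<and> A \<subseteq> G \<and> measure N (G - C) < e"
proof -
  interpret finite_measure N by fact
  note sets[simp]
  have "A \<in> sigma_sets UNIV {S. closed S}"
    using A by (simp add: borel_eq_closed)
  then show ?thesis using \<open>0 < e\<close>
  proof (induction arbitrary: e rule: sigma_sets.induct)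
    case (Basic a)
    then have cl: "closed a" by simp
    show ?case
    \<comment> \<open>\<open>infdist x {}\<close> is 0 by convention, so the neighbourhoods of the
      empty set would be the whole space.\<close>
    proof (cases "a = {}")
      case True
      then show ?thesis using Basic by (intro exI[of _ "{}"]) auto
    next
      case False
      define G where "G n = {x. infdist x a < 1 / real (Suc n)}" for n
      have op: "open (G n)" for n
        unfolding G_def by (intro open_Collect_less continuous_intros)
      have "(\<lambda>n. measure N (G n)) \<longlonglongrightarrow> measure N (\<Inter>n. G n)"
      proof (rule finite_Lim_measure_decseq)
        show "decseq G"
          unfolding decseq_def
        proof (intro allI impI subsetI)
          fix m n x assume "m \<le> n" "x \<in> G n"
          then have "infdist x a < 1 / real (Suc n)" "1 / real (Suc n) \<le> 1 / real (Suc m)"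
            by (auto simp: G_def intro!: divide_left_mono)
          then show "x \<in> G m" unfolding G_def by simp
        qed
      qed (use op in auto)
      moreover have "(\<Inter>n. G n) = a"
      proof safe
        fix x assume x: "x \<in> (\<Inter>n. G n)"
        have "infdist x a \<le> 0"
        proof (rule ccontr)
          assume "\<not> infdist x a \<le> 0"
          then obtain n where "inverse (real (Suc n)) < infdist x a"
            using reals_Archimedean[of "infdist x a"] by auto
          moreover have "infdist x a < 1 / real (Suc n)" using x by (auto simp: G_def)
          ultimately show False by (simp add: inverse_eq_divide)
        qed
        then have "infdist x a = 0" using infdist_nonneg[of x a] by linarith
        then show "x \<in> a" using in_closed_iff_infdist_zero[OF cl False] by simp
      next
        fix x n assume "x \<in> a" then show "x \<in> G n" by (simp add: G_def)
      qed
      ultimately have "\<forall>\<^sub>F n in sequentially. measure N (G n) < measure N a + e"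
        using Basic by (intro order_tendstoD) auto
      then obtain n where n: "measure N (G n) < measure N a + e"
        by (auto simp: eventually_sequentially)
      have sub: "a \<subseteq> G n" by (auto simp: G_def)
      have "measure N (G n - a) = measure N (G n) - measure N a"
        by (rule finite_measure_Diff) (use sub op cl in auto)
      then show ?thesis using n op cl sub by (intro exI[of _ a] exI[of _ "G n"]) auto
    qed
  next
    case Empty
    then show ?case by (intro exI[of _ "{}"]) auto
  next
    case (Compl a)
    from Compl.IH[OF Compl.prems] obtain C G
      where *: "closed C" "open G" "C \<subseteq> a" "a \<subseteq> G" "measure N (G - C) < e" by auto
    have "(- C) - (- G) = G - C" "UNIV - a = - a" by auto
    with * show ?case
      by (intro exI[of _ "- G"] exI[of _ "- C"]) (simp add: closed_Compl open_Compl)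
  next
    case (Union a)
    have "\<exists>C G. closed C \<and> open G \<and> C \<subseteq> a i \<and> a i \<subseteq> G \<and> measure N (G - C) < (e/4) * (1/2)^i" for i
      by (rule Union.IH) (use Union.prems in auto)
    then obtain C G where *: "\<And>i. closed (C i)" "\<And>i. open (G i)" "\<And>i. C i \<subseteq> a i" "\<And>i. a i \<subseteq> G i"
      and m: "\<And>i. measure N (G i - C i) < (e/4) * (1/2)^i" by metis
    have [measurable]: "C i \<in> sets borel" "G i \<in> sets borel" for i using * by auto
    have sm: "summable (\<lambda>i. (e/4) * (1/2::real)^i)" by (intro summable_mult summable_geometric) auto
    have sm': "summable (\<lambda>i. measure N (G i - C i))"
      by (rule summable_comparison_test'[OF sm, of 0]) (use m less_imp_le in auto)
    have "measure N (\<Union>i. G i - C i) \<le> (\<Sum>i. measure N (G i - C i))"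
      by (rule finite_measure_subadditive_countably) (use sm' in auto)
    also have "\<dots> \<le> (\<Sum>i. (e/4) * (1/2)^i)"
      by (rule suminf_le) (use m less_imp_le sm sm' in auto)
    also have "\<dots> = e/2" by (subst suminf_mult) (auto simp: suminf_geometric)
    finally have b: "measure N (\<Union>i. G i - C i) \<le> e/2" .
    \<comment> \<open>The union of all \<open>C i\<close> need not be closed. A finite part of it
      is, and it leaves out less than \<open>e/2\<close>.\<close>
    have "(\<lambda>n. measure N (\<Union>i<n. C i)) \<longlonglongrightarrow> measure N (\<Union>n. \<Union>i<n. C i)"
    proof (rule finite_Lim_measure_incseq)
      show "incseq (\<lambda>n. \<Union>i<n. C i)" unfolding incseq_def by (intro allI impI UN_mono) auto
    qed auto
    moreover have "(\<Union>n. \<Union>i<n. C i) = (\<Union>i. C i)" by auto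
    ultimately have "\<forall>\<^sub>F n in sequentially. measure N (\<Union>i. C i) - e/2 < measure N (\<Union>i<n. C i)"
      using Union.prems by (intro order_tendstoD) auto
    then obtain n where n: "measure N (\<Union>i. C i) - e/2 < measure N (\<Union>i<n. C i)"
      by (auto simp: eventually_sequentially)
    let ?C = "\<Union>i<n. C i"
    have "measure N ((\<Union>i. G i) - ?C) \<le> measure N ((\<Union>i. G i - C i) \<union> ((\<Union>i. C i) - ?C))"
      by (rule finite_measure_mono) auto
    also have "\<dots> \<le> measure N (\<Union>i. G i - C i) + measure N ((\<Union>i. C i) - ?C)"
      by (rule measure_Un_le) auto
    also have "measure N ((\<Union>i. C i) - ?C) < e/2"
      using n by (subst finite_measure_Diff) auto
    finally have "measure N ((\<Union>i. G i) - ?C) < e" using b by simp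
    moreover have "closed ?C" "open (\<Union>i. G i)" using * by auto
    moreover have "?C \<subseteq> (\<Union>i. a i)" "(\<Union>i. a i) \<subseteq> (\<Union>i. G i)"
      using *(3) *(4)[THEN subsetD] by (fast, fast)
    ultimately show ?case by (intro exI[of _ ?C] exI[of _ "\<Union>i. G i"]) simp
  qed
qed

text \<open>Ulam's argument: finitely many closed balls of radius \<open>1 / real (Suc n)\<close>
  around points of \<open>D\<close> cover \<open>A\<close> up to small mass, and what lies in all
  these finite unions is totally bounded. Intersecting with a closed set inside \<open>A\<close>
  makes it complete, hence compact, and keeps it in \<open>A\<close>.\<close>

lemma finite_measure_borel_tight:
  fixes N :: "'a::complete_space measure"
  assumes fin: "finite_measure N" and sets: "sets N = sets borel"
    and A: "A \<in> sets borel" and D: "countable D" "A \<subseteq> closure D" and "0 < (e::real)"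
  shows "\<exists>K. compact K \<and> K \<subseteq> A \<and> measure N (A - K) < e"
proof (cases "D = {}")
  case True
  then show ?thesis using D \<open>0 < e\<close> by (intro exI[of _ "{}"]) auto
next
  case False
  interpret finite_measure N by fact
  note sets[simp]
  obtain C G where C: "closed C" "C \<subseteq> A" and G: "open G" "A \<subseteq> G" "measure N (G - C) < e/2"
    using finite_measure_borel_regular[OF fin sets A, of "e/2"] \<open>0 < e\<close> by auto
  have Am: "A \<in> sets N" and Cm: "C \<in> sets N" and Gm: "G \<in> sets N" using A C G by auto
  have AC: "measure N (A - C) < e/2"
    by (rule order.strict_trans1[OF finite_measure_mono G(3)]) (use Am Cm Gm G in auto)
  define d where "d = from_nat_into D"
  have ran: "range d = D" using D False by (simp add: d_def range_from_nat_into)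
  define U where "U n k = (\<Union>i<k. cball (d i) (1 / real (Suc n)))" for n k
  have Ucl: "closed (U n k)" for n k by (auto simp: U_def)
  have Um[measurable]: "U n k \<in> sets N" for n k using Ucl by simp
  \<comment> \<open>The losses over all \<open>n\<close> add up to \<open>e/4\<close>; with the
    \<open>e/2\<close> lost in passing to \<open>C\<close> they stay below \<open>e\<close>.\<close>
  have "\<exists>k. measure N (A - U n k) < (e/8) * (1/2)^n" for n
  proof -
    have lim: "(\<lambda>k. measure N (A - U n k)) \<longlonglongrightarrow> measure N (\<Inter>k. A - U n k)"
    proof (rule finite_Lim_measure_decseq)
      have "U n k \<subseteq> U n l" if "k \<le> l" for k l
        unfolding U_def using that by (intro UN_mono) auto
      then show "decseq (\<lambda>k. A - U n k)" unfolding decseq_def by blast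
    qed (use Am Um in auto)
    have "(\<Inter>k. A - U n k) = {}"
    proof -
      have "\<exists>k. x \<in> U n k" if "x \<in> A" for x
      proof -
        have "\<exists>y\<in>D. dist y x < 1 / real (Suc n)"
          using that D(2) closure_approachable[of x D] by (auto dest: subsetD)
        then obtain i where "dist (d i) x < 1 / real (Suc n)" using ran by blast
        then show ?thesis by (intro exI[of _ "Suc i"]) (force simp: U_def)
      qed
      then show ?thesis by auto
    qed
    with lim have "(\<lambda>k. measure N (A - U n k)) \<longlonglongrightarrow> 0" by (simp only: measure_empty)
    then have "\<forall>\<^sub>F k in sequentially. measure N (A - U n k) < (e/8) * (1/2)^n"
      using \<open>0 < e\<close> by (intro order_tendstoD) auto
    then show ?thesis by (auto simp: eventually_sequentially)
  qed
  then obtain k where k: "\<And>n. measure N (A - U n (k n)) < (e/8) * (1/2)^n" by metis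
  define K where "K = C \<inter> (\<Inter>n. U n (k n))"
  have Kcl: "closed K" unfolding K_def using C Ucl by (intro closed_Int closed_INT) auto
  have "compact K"
    unfolding compact_eq_totally_bounded
  proof (intro conjI allI impI)
    show "Topological_Spaces.complete K" using Kcl by (simp add: complete_eq_closed)
    fix r :: real assume "0 < r"
    then obtain n where n: "inverse (real (Suc n)) < r" using reals_Archimedean by blast
    have "K \<subseteq> (\<Union>x\<in>d ` {..<k n}. ball x r)"
    proof
      fix x assume "x \<in> K"
      then have "x \<in> U n (k n)" by (auto simp: K_def)
      then show "x \<in> (\<Union>x\<in>d ` {..<k n}. ball x r)" using n by (force simp: U_def inverse_eq_divide)
    qed
    then show "\<exists>k. finite k \<and> K \<subseteq> (\<Union>x\<in>k. ball x r)" by (intro exI[of _ "d ` {..<k n}"]) auto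
  qed
  moreover have "K \<subseteq> A" using C by (auto simp: K_def)
  moreover have "measure N (A - K) < e"
  proof -
    have sm: "summable (\<lambda>n. (e/8) * (1/2::real)^n)" by (intro summable_mult summable_geometric) auto
    have sm': "summable (\<lambda>n. measure N (A - U n (k n)))"
      by (rule summable_comparison_test'[OF sm, of 0]) (use k less_imp_le in auto)
    have "measure N (\<Union>n. A - U n (k n)) \<le> (\<Sum>n. measure N (A - U n (k n)))"
      by (rule finite_measure_subadditive_countably) (use sm' Am Um in auto)
    also have "\<dots> \<le> (\<Sum>n. (e/8) * (1/2)^n)"
      by (rule suminf_le) (use k less_imp_le sm sm' in auto)
    also have "\<dots> = e/4" by (subst suminf_mult) (auto simp: suminf_geometric)
    finally have b: "measure N (\<Union>n. A - U n (k n)) \<le> e/4" .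
    have "measure N (A - K) \<le> measure N ((A - C) \<union> (\<Union>n. A - U n (k n)))"
      by (rule finite_measure_mono) (use Am Cm Um in \<open>auto simp: K_def\<close>)
    also have "\<dots> \<le> measure N (A - C) + measure N (\<Union>n. A - U n (k n))"
      by (rule measure_Un_le) (use Am Cm Um in auto)
    finally show ?thesis using b AC \<open>0 < e\<close> by linarith
  qed
  ultimately show ?thesis by blast
qed

section \<open>Random dynamical systems with memoryless noise\<close>

locale rds =
  fixes T :: "real set" and M :: "'w measure" and F :: "real \<Rightarrow> real \<Rightarrow> 'w set set"
    and \<theta> :: "real \<Rightarrow> 'w \<Rightarrow> 'w" and X :: "'m::complete_space set"
    and \<phi> :: "real \<Rightarrow> 'w \<Rightarrow> 'm \<Rightarrow> 'm"
  assumes rds: "memoryless_RDS T M F \<theta> X \<phi>"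
begin

lemma T_cases: "T = \<int> \<or> T = UNIV"
  and prob_space_M: "prob_space M"
  and F_sigma: "\<And>s u. s \<in> T \<Longrightarrow> u \<in> T \<Longrightarrow> s \<le> u \<Longrightarrow> sigma_algebra (space M) (F s u)"
  and F_mono: "\<And>t0 t1 t2 t3. t0 \<in> T \<Longrightarrow> t1 \<in> T \<Longrightarrow> t2 \<in> T \<Longrightarrow> t3 \<in> T \<Longrightarrow> t0 \<le> t1 \<Longrightarrow> t1 \<le> t2
    \<Longrightarrow> t2 \<le> t3 \<Longrightarrow> F t1 t2 \<subseteq> F t0 t3"
  and theta_measurable: "\<And>t. t \<in> T \<Longrightarrow> \<theta> t \<in> measurable M M"
  and theta_0: "\<And>\<omega>. \<omega> \<in> space M \<Longrightarrow> \<theta> 0 \<omega> = \<omega>"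
  and theta_add: "\<And>s t \<omega>. s \<in> T \<Longrightarrow> t \<in> T \<Longrightarrow> \<omega> \<in> space M \<Longrightarrow> \<theta> (s + t) \<omega> = \<theta> s (\<theta> t \<omega>)"
  and theta_F: "\<And>\<tau> s u. \<tau> \<in> T \<Longrightarrow> s \<in> T \<Longrightarrow> u \<in> T \<Longrightarrow> s \<le> u \<Longrightarrow>
    (\<lambda>A. \<theta> \<tau> ` A) ` F s u = F (s - \<tau>) (u - \<tau>)"
  and theta_distr: "\<And>t. t \<in> T \<Longrightarrow> distr M M (\<theta> t) = M"
  and indep_past_future: "\<And>t. t \<in> T \<Longrightarrow> prob_space.indep_set M (F_past T M F t) (F_future T M F t)"
  and X_borel: "X \<in> sets borel"
  and X_separable: "\<exists>D\<subseteq>X. countable D \<and> X \<subseteq> closure D"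
  and phi_continuous: "\<And>t \<omega>. t \<in> Tpos T \<Longrightarrow> \<omega> \<in> space M \<Longrightarrow> continuous_on X (\<phi> t \<omega>)"
  and phi_in: "\<And>t \<omega> x. t \<in> Tpos T \<Longrightarrow> \<omega> \<in> space M \<Longrightarrow> x \<in> X \<Longrightarrow> \<phi> t \<omega> x \<in> X"
  and phi_measurable: "\<And>t x. t \<in> Tpos T \<Longrightarrow> x \<in> X \<Longrightarrow>
    (\<lambda>\<omega>. \<phi> t \<omega> x) \<in> measurable (sigma (space M) (F 0 t)) (restrict_space borel X)"
  and cocycle: "\<And>s t \<omega> x. s \<in> Tpos T \<Longrightarrow> t \<in> Tpos T \<Longrightarrow> \<omega> \<in> space M \<Longrightarrow> x \<in> X \<Longrightarrow>
    \<phi> (s + t) \<omega> x = \<phi> t (\<theta> s \<omega>) (\<phi> s \<omega> x)"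
  and phi_right_continuous: "\<And>\<omega> t x tn xn. \<omega> \<in> space M \<Longrightarrow> t \<in> Tpos T \<Longrightarrow> x \<in> X \<Longrightarrow>
    (\<And>n. tn n \<in> Tpos T) \<Longrightarrow> (\<And>n. xn n \<in> X) \<Longrightarrow> decseq tn \<Longrightarrow> tn \<longlonglongrightarrow> t \<Longrightarrow> xn \<longlonglongrightarrow> x \<Longrightarrow>
    (\<lambda>n. \<phi> (tn n) \<omega> (xn n)) \<longlonglongrightarrow> \<phi> t \<omega> x"
  using rds unfolding memoryless_RDS_def by (simp_all add: image_subset_iff)

lemma F_events: "s \<in> T \<Longrightarrow> u \<in> T \<Longrightarrow> s \<le> u \<Longrightarrow> F s u \<subseteq> sets M"
  using rds[unfolded memoryless_RDS_def, THEN conjunct2, THEN conjunct2, THEN conjunct1] by blast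

end

sublocale rds \<subseteq> prob_space M by (rule prob_space_M)

context rds
begin

text \<open>By right-continuity the countable set \<open>Q\<close> of times suffices for hitting open sets and for contraction; by
  continuity of \<open>\<phi> t \<omega>\<close> the countable set \<open>D\<close> of points suffices for contraction of open sets. This is what makes
  the events below measurable. The class of \<open>'m\<close> is not second countable, so \<open>BB\<close> serves as countable base of \<open>X\<close>.\<close>

definition Q :: "real set" where "Q = {t \<in> Tpos T. t \<in> \<rat>}"
definition D :: "'m set" where "D = (SOME D. D \<subseteq> X \<and> countable D \<and> X \<subseteq> closure D)"
abbreviation BX :: "'m measure" where "BX \<equiv> restrict_space borel X"
text \<open>Only the noise between 0 and \<open>t\<close> is recorded, a part of
  \<open>F_past\<close>; \<open>\<phi> t\<close> depends on nothing else. \<open>Past t\<close> and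
  \<open>Fut\<close> serve as sigma-algebras only: the measure that \<open>sigma\<close> attaches is
  zero, and laws are taken with \<open>distr M\<close>.\<close>

definition Past :: "real \<Rightarrow> 'w measure" where "Past t = sigma (space M) (F 0 t)"
definition Fut :: "'w measure" where "Fut = sigma (space M) (F_future T M F 0)"
definition BB :: "'m set set" where "BB = (\<lambda>(d, q). ball d q \<inter> X) ` (D \<times> \<rat>)"

text \<open>Thresholds and times range over countable sets, and so do the points once
  \<open>A\<close> is countable, which makes the event measurable. The bounds are non-strict so that
  they survive limits in time and space.\<close>

definition contracts_rat :: "'m set \<Rightarrow> 'w \<Rightarrow> bool" where
  "contracts_rat A \<omega> \<longleftrightarrow> (\<forall>k::nat. \<exists>m::nat. \<forall>t\<in>Q. real m \<le> t \<longrightarrow>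
     (\<forall>x\<in>A. \<forall>y\<in>A. dist (\<phi> t \<omega> x) (\<phi> t \<omega> y) \<le> 1 / real (Suc k)))"

definition sync :: "'w \<Rightarrow> 'm \<Rightarrow> 'm \<Rightarrow> bool" where
  "sync \<omega> x y \<longleftrightarrow> (\<forall>k::nat. \<exists>m::nat. \<forall>t\<in>Q. real m \<le> t \<longrightarrow>
     dist (\<phi> t \<omega> x) (\<phi> t \<omega> y) \<le> 1 / real (Suc k))"

section \<open>Times in \<open>Q\<close> and the countable dense set\<close>

lemma T_0: "0 \<in> T" and T_add: "s \<in> T \<Longrightarrow> t \<in> T \<Longrightarrow> s + t \<in> T" and T_uminus: "s \<in> T \<Longrightarrow> - s \<in> T"
  and T_of_nat: "real n \<in> T" and T_diff: "s \<in> T \<Longrightarrow> t \<in> T \<Longrightarrow> s - t \<in> T"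
  using T_cases by auto

lemma Tpos_T: "t \<in> Tpos T \<Longrightarrow> t \<in> T" and Tpos_nonneg: "t \<in> Tpos T \<Longrightarrow> 0 \<le> t"
  by (auto simp: Tpos_def)

lemma Q_Tpos: "t \<in> Q \<Longrightarrow> t \<in> Tpos T" and Q_0: "0 \<in> Q"
  and Q_add: "s \<in> Q \<Longrightarrow> t \<in> Q \<Longrightarrow> s + t \<in> Q" and Q_of_nat: "real n \<in> Q"
  and Q_diff: "s \<in> Q \<Longrightarrow> t \<in> Q \<Longrightarrow> s \<le> t \<Longrightarrow> t - s \<in> Q"
  by (auto simp: Q_def Tpos_def T_0 T_add T_of_nat T_diff)

lemma Q_T: "t \<in> Q \<Longrightarrow> t \<in> T" and Q_nonneg: "t \<in> Q \<Longrightarrow> 0 \<le> t"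
  by (auto simp: Q_def Tpos_def)

lemma countable_Q: "countable Q"
  by (rule countable_subset[OF _ countable_rat]) (auto simp: Q_def)

lemma D_subset: "D \<subseteq> X" and countable_D: "countable D" and D_dense: "X \<subseteq> closure D"
  using someI_ex[OF X_separable[unfolded Bex_def]] X_separable
  unfolding D_def by (metis (mono_tags, lifting) someI_ex)+

text \<open>Right-continuity is available only along nonincreasing times. Rounding up to dyadic
  numbers provides them, since refining the grid never increases the rounded value; for integer time
  a constant sequence does.\<close>

lemma Q_approx:
  assumes "t \<in> Tpos T"
  shows "\<exists>tn. (\<forall>n. tn n \<in> Q) \<and> decseq tn \<and> tn \<longlonglongrightarrow> t"
proof (cases "T = UNIV")
  case False
  then have "t \<in> \<int>" using T_cases Tpos_T[OF assms] by auto
  then have "t \<in> Q" using assms Ints_subset_Rats by (auto simp: Q_def)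
  then show ?thesis by (intro exI[of _ "\<lambda>_. t"]) auto
next
  case True
  define tn where "tn n = of_int \<lceil>t * 2 ^ n\<rceil> / (2 ^ n :: real)" for n :: nat
  have lb: "t \<le> tn n" and ub: "tn n \<le> t + (1/2) ^ n" for n
  proof -
    have "t * 2 ^ n \<le> of_int \<lceil>t * 2 ^ n\<rceil>" "of_int \<lceil>t * 2 ^ n\<rceil> \<le> t * 2 ^ n + 1" by linarith+
    then show "t \<le> tn n" "tn n \<le> t + (1/2) ^ n"
      by (auto simp: tn_def field_simps power_one_over)
  qed
  have "tn n \<in> Q" for n
  proof -
    have "0 \<le> tn n" using lb[of n] Tpos_nonneg[OF assms] by linarith
    moreover have "tn n \<in> \<rat>" unfolding tn_def by auto
    ultimately show ?thesis unfolding Q_def Tpos_def using True by simp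
  qed
  moreover have "decseq tn"
  proof (rule decseq_SucI)
    fix n
    have "\<lceil>t * 2 ^ Suc n\<rceil> \<le> 2 * \<lceil>t * 2 ^ n\<rceil>"
      unfolding ceiling_le_iff using le_of_int_ceiling[of "t * 2 ^ n"] by simp
    then have "real_of_int \<lceil>t * 2 ^ Suc n\<rceil> \<le> 2 * real_of_int \<lceil>t * 2 ^ n\<rceil>" by linarith
    then show "tn (Suc n) \<le> tn n" by (simp add: tn_def field_simps)
  qed
  moreover have "tn \<longlonglongrightarrow> t"
  proof (rule tendsto_sandwich[of "\<lambda>_. t" _ _ "\<lambda>n. t + (1/2) ^ n"])
    have "(\<lambda>n. t + (1/2::real) ^ n) \<longlonglongrightarrow> t + 0" by (intro tendsto_intros LIMSEQ_realpow_zero) auto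
    then show "(\<lambda>n. t + (1/2::real) ^ n) \<longlonglongrightarrow> t" by simp
  qed (use lb ub in auto)
  ultimately show ?thesis by blast
qed

text \<open>One sequence of times serves all points at once and stays above \<open>t\<close>; both
  are used to pass bounds valid at late times in \<open>Q\<close> to all late times.\<close>

lemma Q_right_limit:
  assumes "t \<in> Tpos T" "\<omega> \<in> space M"
  shows "\<exists>tn. (\<forall>n. tn n \<in> Q \<and> t \<le> tn n) \<and> (\<forall>x\<in>X. (\<lambda>n. \<phi> (tn n) \<omega> x) \<longlonglongrightarrow> \<phi> t \<omega> x)"
proof -
  obtain tn where tn: "\<And>n. tn n \<in> Q" "decseq tn" "tn \<longlonglongrightarrow> t" using Q_approx[OF assms(1)] by auto
  have "(\<lambda>n. \<phi> (tn n) \<omega> x) \<longlonglongrightarrow> \<phi> t \<omega> x" if "x \<in> X" for x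
    by (rule phi_right_continuous[where xn = "\<lambda>_. x"]) (use that tn assms Q_Tpos in auto)
  then show ?thesis using tn decseq_ge[OF tn(2,3)] by blast
qed

text \<open>Membership in an open set persists for a while after \<open>t\<close>. The formulation
  for pairs covers single trajectories by taking \<open>x = y\<close> and a square.\<close>

lemma hit_open_Q:
  assumes W: "openin (top_of_set (X \<times> X)) W" and t: "t \<in> Tpos T" and w: "\<omega> \<in> space M"
    and "x \<in> X" "y \<in> X" "(\<phi> t \<omega> x, \<phi> t \<omega> y) \<in> W"
  shows "\<exists>q\<in>Q. (\<phi> q \<omega> x, \<phi> q \<omega> y) \<in> W"
proof -
  obtain W' where W': "open W'" "W = (X \<times> X) \<inter> W'" using W by (auto simp: openin_open)
  obtain tn where tn: "\<And>n. tn n \<in> Q" "\<And>x. x \<in> X \<Longrightarrow> (\<lambda>n. \<phi> (tn n) \<omega> x) \<longlonglongrightarrow> \<phi> t \<omega> x"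
    using Q_right_limit[OF t w] by blast
  have "(\<lambda>n. (\<phi> (tn n) \<omega> x, \<phi> (tn n) \<omega> y)) \<longlonglongrightarrow> (\<phi> t \<omega> x, \<phi> t \<omega> y)"
    by (intro tendsto_Pair tn assms)
  then have "\<forall>\<^sub>F n in sequentially. (\<phi> (tn n) \<omega> x, \<phi> (tn n) \<omega> y) \<in> W'"
    by (rule topological_tendstoD) (use W' assms in auto)
  then obtain n where "(\<phi> (tn n) \<omega> x, \<phi> (tn n) \<omega> y) \<in> W'" by (auto simp: eventually_sequentially)
  then show ?thesis using W' tn(1) phi_in Q_Tpos w assms by (intro bexI[of _ "tn n"]) auto
qed

section \<open>Synchronisation and contraction along times in \<open>Q\<close>\<close>

lemma sync_sym: "sync \<omega> x y \<Longrightarrow> sync \<omega> y x"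
  by (simp add: sync_def dist_commute)

lemma sync_trans:
  assumes "sync \<omega> x y" "sync \<omega> y z"
  shows "sync \<omega> x z"
  unfolding sync_def
proof
  fix k :: nat
  obtain m1 m2 :: nat where 1: "\<And>t. t \<in> Q \<Longrightarrow> real m1 \<le> t \<Longrightarrow> dist (\<phi> t \<omega> x) (\<phi> t \<omega> y) \<le> 1 / real (Suc (2*k+1))"
    and 2: "\<And>t. t \<in> Q \<Longrightarrow> real m2 \<le> t \<Longrightarrow> dist (\<phi> t \<omega> y) (\<phi> t \<omega> z) \<le> 1 / real (Suc (2*k+1))"
    using assms unfolding sync_def by blast
  have e: "1 / real (Suc (2*k+1)) + 1 / real (Suc (2*k+1)) = 1 / real (Suc k)"
    by (simp add: field_simps)
  have "dist (\<phi> t \<omega> x) (\<phi> t \<omega> z) \<le> 1 / real (Suc k)" if "t \<in> Q" "real (max m1 m2) \<le> t" for t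
    using 1[of t] 2[of t] that dist_triangle[of "\<phi> t \<omega> x" "\<phi> t \<omega> z" "\<phi> t \<omega> y"]
    unfolding e[symmetric] by (auto simp: of_nat_max)
  then show "\<exists>m::nat. \<forall>t\<in>Q. real m \<le> t \<longrightarrow> dist (\<phi> t \<omega> x) (\<phi> t \<omega> z) \<le> 1 / real (Suc k)" by blast
qed

text \<open>By the cocycle property the trajectory after time \<open>t\<close> runs under
  \<open>\<theta> t \<omega>\<close>, and synchronisation concerns late times only, here those
  beyond \<open>real m + t\<close>.\<close>

lemma sync_shift:
  assumes t: "t \<in> Q" and "\<omega> \<in> space M" "x \<in> X" "y \<in> X"
    and s: "sync (\<theta> t \<omega>) (\<phi> t \<omega> x) (\<phi> t \<omega> y)"
  shows "sync \<omega> x y"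
  unfolding sync_def
proof
  fix k :: nat
  obtain m where m: "\<And>s. s \<in> Q \<Longrightarrow> real m \<le> s \<Longrightarrow>
      dist (\<phi> s (\<theta> t \<omega>) (\<phi> t \<omega> x)) (\<phi> s (\<theta> t \<omega>) (\<phi> t \<omega> y)) \<le> 1 / real (Suc k)"
    using s unfolding sync_def by blast
  obtain n :: nat where n: "real m + t \<le> real n" using real_arch_simple by blast
  have "dist (\<phi> u \<omega> x) (\<phi> u \<omega> y) \<le> 1 / real (Suc k)" if u: "u \<in> Q" "real n \<le> u" for u
  proof -
    have *: "u - t \<in> Q" "real m \<le> u - t" using u n by (auto intro!: Q_diff t)
    have "\<phi> u \<omega> z = \<phi> (u - t) (\<theta> t \<omega>) (\<phi> t \<omega> z)" if "z \<in> X" for z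
      using cocycle[of t "u - t" \<omega> z] Q_Tpos t * assms that by simp
    then show ?thesis using m[OF *] assms by simp
  qed
  then show "\<exists>m::nat. \<forall>t\<in>Q. real m \<le> t \<longrightarrow> dist (\<phi> t \<omega> x) (\<phi> t \<omega> y) \<le> 1 / real (Suc k)" by blast
qed

lemma contracts_rat_shift:
  assumes t: "t \<in> Q" and w: "\<omega> \<in> space M" and A: "A \<subseteq> X"
    and s: "contracts_rat (\<phi> t \<omega> ` A) (\<theta> t \<omega>)"
  shows "contracts_rat A \<omega>"
  unfolding contracts_rat_def
proof
  fix k :: nat
  obtain m where m: "\<And>s x y. s \<in> Q \<Longrightarrow> real m \<le> s \<Longrightarrow> x \<in> A \<Longrightarrow> y \<in> A \<Longrightarrow>
      dist (\<phi> s (\<theta> t \<omega>) (\<phi> t \<omega> x)) (\<phi> s (\<theta> t \<omega>) (\<phi> t \<omega> y)) \<le> 1 / real (Suc k)"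
    using s unfolding contracts_rat_def by blast
  obtain n :: nat where n: "real m + t \<le> real n" using real_arch_simple by blast
  have "dist (\<phi> u \<omega> x) (\<phi> u \<omega> y) \<le> 1 / real (Suc k)"
    if u: "u \<in> Q" "real n \<le> u" and xy: "x \<in> A" "y \<in> A" for u x y
  proof -
    have *: "u - t \<in> Q" "real m \<le> u - t" using u n by (auto intro!: Q_diff t)
    have "\<phi> u \<omega> z = \<phi> (u - t) (\<theta> t \<omega>) (\<phi> t \<omega> z)" if "z \<in> X" for z
      using cocycle[of t "u - t" \<omega> z] Q_Tpos t * w that by simp
    then show ?thesis using m[OF * xy] A xy by (simp add: subset_iff)
  qed
  then show "\<exists>m::nat. \<forall>t\<in>Q. real m \<le> t \<longrightarrow>
      (\<forall>x\<in>A. \<forall>y\<in>A. dist (\<phi> t \<omega> x) (\<phi> t \<omega> y) \<le> 1 / real (Suc k))" by blast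
qed

lemma contracts_rat_sync: "contracts_rat A \<omega> \<Longrightarrow> x \<in> A \<Longrightarrow> y \<in> A \<Longrightarrow> sync \<omega> x y"
  unfolding contracts_rat_def sync_def by meson

lemma contracts_rat_mono: "contracts_rat A \<omega> \<Longrightarrow> B \<subseteq> A \<Longrightarrow> contracts_rat B \<omega>"
  unfolding contracts_rat_def by (meson subsetD)

lemma contracts_mono: "contracts T \<phi> A \<omega> \<Longrightarrow> B \<subseteq> A \<Longrightarrow> contracts T \<phi> B \<omega>"
  unfolding contracts_def by (meson subsetD)

text \<open>Two successive limits: continuity of \<open>\<phi> t \<omega>\<close> at a fixed time in
  \<open>Q\<close> passes the bound from \<open>B\<close> to \<open>A\<close>, then right-continuity
  passes it to all times. \<open>B = A\<close> compares the two notions on one set;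
  \<open>B = U \<inter> D\<close> yields measurable events.\<close>

lemma contracts_iff_dense:
  assumes w: "\<omega> \<in> space M" and A: "A \<subseteq> X" and B: "B \<subseteq> A" "A \<subseteq> closure B"
  shows "contracts T \<phi> A \<omega> \<longleftrightarrow> contracts_rat B \<omega>"
proof
  assume c: "contracts T \<phi> A \<omega>"
  show "contracts_rat B \<omega>"
    unfolding contracts_rat_def
  proof
    fix k :: nat
    obtain s where s: "\<And>t x y. t \<in> Tpos T \<Longrightarrow> s \<le> t \<Longrightarrow> x \<in> A \<Longrightarrow> y \<in> A \<Longrightarrow>
        dist (\<phi> t \<omega> x) (\<phi> t \<omega> y) \<le> 1 / real (Suc k)"
      using c unfolding contracts_def by (metis zero_less_divide_1_iff of_nat_0_less_iff zero_less_Suc)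
    obtain m :: nat where "s \<le> real m" using real_arch_simple by blast
    then show "\<exists>m::nat. \<forall>t\<in>Q. real m \<le> t \<longrightarrow>
        (\<forall>x\<in>B. \<forall>y\<in>B. dist (\<phi> t \<omega> x) (\<phi> t \<omega> y) \<le> 1 / real (Suc k))"
      using s B(1) Q_Tpos by (intro exI[of _ m]) (meson order_trans subsetD)
  qed
next
  assume c: "contracts_rat B \<omega>"
  show "contracts T \<phi> A \<omega>"
    unfolding contracts_def
  proof (intro allI impI)
    fix \<epsilon> :: real assume "0 < \<epsilon>"
    then obtain k where k: "1 / real (Suc k) < \<epsilon>" using nat_approx_posE by blast
    obtain m where m: "\<And>t x y. t \<in> Q \<Longrightarrow> real m \<le> t \<Longrightarrow> x \<in> B \<Longrightarrow> y \<in> B \<Longrightarrow>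
        dist (\<phi> t \<omega> x) (\<phi> t \<omega> y) \<le> 1 / real (Suc k)"
      using c unfolding contracts_rat_def by blast
    have 1: "dist (\<phi> t \<omega> x) (\<phi> t \<omega> y) \<le> 1 / real (Suc k)"
      if t: "t \<in> Q" "real m \<le> t" and xy: "x \<in> A" "y \<in> A" for t x y
    proof -
      obtain xn yn where *: "\<And>n. xn n \<in> B" "xn \<longlonglongrightarrow> x" "\<And>n. yn n \<in> B" "yn \<longlonglongrightarrow> y"
        using B(2) xy unfolding subset_eq closure_sequential by metis
      have cont: "(\<lambda>n. \<phi> t \<omega> (zn n)) \<longlonglongrightarrow> \<phi> t \<omega> z"
        if "\<And>n. zn n \<in> B" "zn \<longlonglongrightarrow> z" "z \<in> A" for zn z
        by (rule continuous_on_tendsto_compose[OF phi_continuous[OF Q_Tpos[OF t(1)] w] that(2)])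
          (use that A B in \<open>auto intro!: always_eventually\<close>)
      have "(\<lambda>n. dist (\<phi> t \<omega> (xn n)) (\<phi> t \<omega> (yn n))) \<longlonglongrightarrow> dist (\<phi> t \<omega> x) (\<phi> t \<omega> y)"
        by (intro tendsto_dist cont * xy)
      then show ?thesis by (rule LIMSEQ_le_const2) (use m t * in auto)
    qed
    have "dist (\<phi> t \<omega> x) (\<phi> t \<omega> y) \<le> \<epsilon>"
      if t: "t \<in> Tpos T" "real m \<le> t" and xy: "x \<in> A" "y \<in> A" for t x y
    proof -
      obtain tn where tn: "\<And>n. tn n \<in> Q" "\<And>n. t \<le> tn n"
          "\<And>x. x \<in> X \<Longrightarrow> (\<lambda>n. \<phi> (tn n) \<omega> x) \<longlonglongrightarrow> \<phi> t \<omega> x"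
        using Q_right_limit[OF t(1) w] by blast
      have "(\<lambda>n. dist (\<phi> (tn n) \<omega> x) (\<phi> (tn n) \<omega> y)) \<longlonglongrightarrow> dist (\<phi> t \<omega> x) (\<phi> t \<omega> y)"
        by (intro tendsto_dist tn(3)) (use xy A in auto)
      then have "dist (\<phi> t \<omega> x) (\<phi> t \<omega> y) \<le> 1 / real (Suc k)"
        by (rule LIMSEQ_le_const2) (use 1 tn t(2) xy order_trans in blast)
      then show ?thesis using k by simp
    qed
    then show "\<exists>s. \<forall>t\<in>Tpos T. s \<le> t \<longrightarrow> (\<forall>x\<in>A. \<forall>y\<in>A. dist (\<phi> t \<omega> x) (\<phi> t \<omega> y) \<le> \<epsilon>)"
      by blast
  qed
qed

lemma openin_dense:
  assumes "openin (top_of_set X) U"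
  shows "U \<subseteq> closure (U \<inter> D)"
proof
  fix x assume x: "x \<in> U"
  obtain V where V: "open V" "U = X \<inter> V" using assms by (auto simp: openin_open)
  have "x \<in> V \<inter> closure D" using x V D_dense by auto
  then have "x \<in> closure (V \<inter> D)"
    using open_Int_closure_subset[OF V(1)] by blast
  moreover have "V \<inter> D = U \<inter> D" using V D_subset by auto
  ultimately show "x \<in> closure (U \<inter> D)" by simp
qed

lemma contracts_iff:
  assumes "\<omega> \<in> space M" "openin (top_of_set X) U"
  shows "contracts T \<phi> U \<omega> \<longleftrightarrow> contracts_rat (U \<inter> D) \<omega>"
  using contracts_iff_dense[OF assms(1) _ _ openin_dense[OF assms(2)]] openin_imp_subset[OF assms(2)]
  by auto

lemma contracts_sync:
  assumes "\<omega> \<in> space M" "A \<subseteq> X" "contracts T \<phi> A \<omega>" "x \<in> A" "y \<in> A"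
  shows "sync \<omega> x y"
  using contracts_iff_dense[of \<omega> A A] closure_subset[of A] assms contracts_rat_sync by auto

lemma contracts_Un:
  assumes w: "\<omega> \<in> space M" and "A \<subseteq> X" "B \<subseteq> X" "contracts T \<phi> A \<omega>" "contracts T \<phi> B \<omega>"
    and ab: "a \<in> A" "b \<in> B" "sync \<omega> a b"
  shows "contracts T \<phi> (A \<union> B) \<omega>"
proof -
  have "contracts_rat (A \<union> B) \<omega>"
    unfolding contracts_rat_def
  proof
    fix k :: nat
    \<comment> \<open>Three legs through \<open>a\<close> and \<open>b\<close>, each at most
      \<open>1 / (3k + 3)\<close>, add up to \<open>1 / (k + 1)\<close>.\<close>
    define r where "r = 1 / real (Suc (3 * k + 2))"
    have cA: "contracts_rat A \<omega>" and cB: "contracts_rat B \<omega>"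
      using contracts_iff_dense[of \<omega> A A] contracts_iff_dense[of \<omega> B B] closure_subset assms by auto
    obtain m1 :: nat where 1: "\<And>t x y. t \<in> Q \<Longrightarrow> real m1 \<le> t \<Longrightarrow> x \<in> A \<Longrightarrow> y \<in> A \<Longrightarrow> dist (\<phi> t \<omega> x) (\<phi> t \<omega> y) \<le> r"
      using cA unfolding contracts_rat_def r_def by blast
    obtain m2 :: nat where 2: "\<And>t x y. t \<in> Q \<Longrightarrow> real m2 \<le> t \<Longrightarrow> x \<in> B \<Longrightarrow> y \<in> B \<Longrightarrow> dist (\<phi> t \<omega> x) (\<phi> t \<omega> y) \<le> r"
      using cB unfolding contracts_rat_def r_def by blast
    obtain m3 :: nat where 3: "\<And>t. t \<in> Q \<Longrightarrow> real m3 \<le> t \<Longrightarrow> dist (\<phi> t \<omega> a) (\<phi> t \<omega> b) \<le> r"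
      using ab(3) unfolding sync_def r_def by blast
    have r: "0 < r" "r + r + r = 1 / real (Suc k)" by (auto simp: r_def field_simps)
    have AB: "dist (\<phi> t \<omega> x) (\<phi> t \<omega> y) \<le> 1 / real (Suc k)"
      if "t \<in> Q" "real (m1 + m2 + m3) \<le> t" "x \<in> A" "y \<in> B" for t x y
    proof -
      have "dist (\<phi> t \<omega> x) (\<phi> t \<omega> a) \<le> r" "dist (\<phi> t \<omega> a) (\<phi> t \<omega> b) \<le> r" "dist (\<phi> t \<omega> b) (\<phi> t \<omega> y) \<le> r"
        using 1[of t x a] 3[of t] 2[of t b y] that ab by auto
      then show ?thesis
        using dist_triangle[of "\<phi> t \<omega> x" "\<phi> t \<omega> y" "\<phi> t \<omega> a"] dist_triangle[of "\<phi> t \<omega> a" "\<phi> t \<omega> y" "\<phi> t \<omega> b"]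
        unfolding r(2)[symmetric] by linarith
    qed
    have AA: "dist (\<phi> t \<omega> x) (\<phi> t \<omega> y) \<le> 1 / real (Suc k)"
      if "t \<in> Q" "real (m1 + m2 + m3) \<le> t" "x \<in> A \<and> y \<in> A \<or> x \<in> B \<and> y \<in> B" for t x y
      using 1[of t x y] 2[of t x y] that r by force
    have "dist (\<phi> t \<omega> x) (\<phi> t \<omega> y) \<le> 1 / real (Suc k)"
      if "t \<in> Q" "real (m1 + m2 + m3) \<le> t" "x \<in> A \<union> B" "y \<in> A \<union> B" for t x y
      using AA[of t x y] AB[of t x y] AB[of t y x] that by (auto simp: dist_commute)
    then show "\<exists>m::nat. \<forall>t\<in>Q. real m \<le> t \<longrightarrow>
        (\<forall>x\<in>A \<union> B. \<forall>y\<in>A \<union> B. dist (\<phi> t \<omega> x) (\<phi> t \<omega> y) \<le> 1 / real (Suc k))"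
      by (intro exI[of _ "m1 + m2 + m3"]) auto
  qed
  then show ?thesis using contracts_iff_dense[of \<omega> "A \<union> B" "A \<union> B"] closure_subset assms by auto
qed

section \<open>A countable base of \<open>X\<close>, past and future noise, joint
  measurability\<close>

lemma countable_BB: "countable BB"
  unfolding BB_def by (intro countable_image countable_SIGMA countable_D countable_rat)

lemma BB_open: "B \<in> BB \<Longrightarrow> openin (top_of_set X) B"
  unfolding BB_def by (auto simp: openin_open)

lemma BB_base:
  assumes "openin (top_of_set X) U" "x \<in> U"
  shows "\<exists>B\<in>BB. x \<in> B \<and> B \<subseteq> U"
proof -
  obtain V where V: "open V" "U = X \<inter> V" using assms by (auto simp: openin_open)
  then obtain e where e: "0 < e" "ball x e \<subseteq> V" using assms open_contains_ball by blast
  obtain d where d: "d \<in> D" "dist d x < e / 3"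
    using D_dense assms V closure_approachable[of x D] e by (metis IntD1 divide_pos_pos subsetD zero_less_numeral)
  \<comment> \<open>A radius between \<open>e/3\<close> and \<open>2e/3\<close> is large enough for
    the ball around \<open>d\<close> to contain \<open>x\<close> and small enough for it to stay
    inside \<open>ball x e\<close>.\<close>
  obtain q where q: "q \<in> \<rat>" "e / 3 < q" "q < 2 * e / 3"
    using Rats_dense_in_real[of "e/3" "2*e/3"] e by auto
  have "ball d q \<subseteq> ball x e"
  proof
    fix z assume "z \<in> ball d q"
    then show "z \<in> ball x e" using dist_triangle[of x z d] d q by (simp add: dist_commute)
  qed
  then have "ball d q \<inter> X \<subseteq> U" using e V by auto
  moreover have "x \<in> ball d q \<inter> X" using d q assms V by auto
  moreover have "ball d q \<inter> X \<in> BB" using d q unfolding BB_def by auto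
  ultimately show ?thesis by blast
qed

lemma openin_sets: "openin (top_of_set X) U \<Longrightarrow> U \<in> sets BX"
  by (auto simp: openin_open sets_restrict_space)

lemma space_BX [simp]: "space BX = X"
  by (simp add: space_restrict_space)

lemma space_Past [simp]: "space (Past t) = space M" and space_Fut [simp]: "space Fut = space M"
  by (simp_all add: Past_def Fut_def space_measure_of_conv)

lemma sets_Past: "t \<in> Tpos T \<Longrightarrow> sets (Past t) = F 0 t"
  unfolding Past_def
  by (rule sigma_algebra.sets_measure_of_eq) (use F_sigma T_0 in \<open>auto simp: Tpos_def\<close>)

lemma F_future_subset: "s \<in> T \<Longrightarrow> F_future T M F s \<subseteq> sets M"
  unfolding F_future_def by (rule sets.sigma_sets_subset) (use F_events in blast)

lemma sets_Fut: "sets Fut = F_future T M F 0"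
proof -
  have "F_future T M F 0 \<subseteq> Pow (space M)" "(\<Union>u\<in>{u \<in> T. 0 \<le> u}. F 0 u) \<subseteq> Pow (space M)"
    using F_future_subset[OF T_0] F_events[OF T_0] sets.space_closed by blast+
  then show ?thesis unfolding Fut_def
    by (simp add: F_future_def sigma_sets_sigma_sets_eq sets_measure_of_conv)
qed

lemma Fut_subset: "sets Fut \<subseteq> sets M"
  using F_future_subset[OF T_0] sets_Fut by simp

lemma Past_subset_Fut: "t \<in> Tpos T \<Longrightarrow> sets (Past t) \<subseteq> sets Fut"
  unfolding sets_Past sets_Fut F_future_def by (auto simp: Tpos_def intro!: sigma_sets.Basic)

lemma Past_mono: "s \<in> Tpos T \<Longrightarrow> t \<in> Tpos T \<Longrightarrow> s \<le> t \<Longrightarrow> sets (Past s) \<subseteq> sets (Past t)"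
  unfolding sets_Past using F_mono[of 0 0 s t] T_0 by (auto simp: Tpos_def)

lemma id_M_Fut: "(\<lambda>\<omega>. \<omega>) \<in> M \<rightarrow>\<^sub>M Fut"
  using Fut_subset by (auto simp: measurable_def Int_absorb2 dest: sets.sets_into_space)

lemma id_Fut_Past: "t \<in> Tpos T \<Longrightarrow> (\<lambda>\<omega>. \<omega>) \<in> Fut \<rightarrow>\<^sub>M Past t"
  using Past_subset_Fut[of t] sets.sets_into_space[of _ "Past t"] by (auto simp: measurable_def Int_absorb2)

text \<open>The sigma-algebras of the noise on \<open>[0, n]\<close> increase with \<open>n\<close>,
  so their union is an algebra, and it generates \<open>Fut\<close>. Any event of the future noise
  is thus decided within finite time up to probability \<open>e\<close>.\<close>

lemma Fut_approx:
  assumes B: "B \<in> sets Fut" and "0 < (e::real)"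
  shows "\<exists>n::nat. \<exists>G\<in>sets (Past (real n)). prob (B - G) + prob (G - B) < e"
proof -
  let ?A = "\<Union>n::nat. sets (Past (real n))"
  have P: "real n \<in> Tpos T" for n by (simp add: Tpos_def T_of_nat)
  have alg: "algebra (space M) ?A"
    unfolding algebra_iff_Un
  proof (intro conjI ballI)
    show "?A \<subseteq> Pow (space M)" using sets.sets_into_space by fastforce
    show "{} \<in> ?A" by auto
    show "space M - a \<in> ?A" if "a \<in> ?A" for a using that sets.compl_sets by fastforce
    fix a b assume "a \<in> ?A" "b \<in> ?A"
    then obtain i j where "a \<in> sets (Past (real i))" "b \<in> sets (Past (real j))" by auto
    then have "a \<in> sets (Past (real (max i j)))" "b \<in> sets (Past (real (max i j)))"
      using Past_mono[OF P P, of i "max i j"] Past_mono[OF P P, of j "max i j"] by auto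
    then show "a \<union> b \<in> ?A" by blast
  qed
  have sub: "?A \<subseteq> sets M" using Past_subset_Fut[OF P] Fut_subset by blast
  have "(\<Union>u\<in>{u \<in> T. 0 \<le> u}. F 0 u) \<subseteq> ?A"
  proof
    fix a assume "a \<in> (\<Union>u\<in>{u \<in> T. 0 \<le> u}. F 0 u)"
    then obtain u where u: "u \<in> Tpos T" "a \<in> F 0 u" by (auto simp: Tpos_def)
    obtain n :: nat where "u \<le> real n" using real_arch_simple by blast
    then show "a \<in> ?A" using u Past_mono[OF u(1) P, of n] sets_Past[OF u(1)] by blast
  qed
  then have "B \<in> sigma_sets (space M) ?A"
    using B sigma_sets_mono'[of "\<Union>u\<in>{u \<in> T. 0 \<le> u}. F 0 u" ?A] unfolding sets_Fut F_future_def by blast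
  from algebra_approximation[OF alg sub this \<open>0 < e\<close>] show ?thesis by blast
qed

lemma phi_Past: "t \<in> Tpos T \<Longrightarrow> x \<in> X \<Longrightarrow> (\<lambda>\<omega>. \<phi> t \<omega> x) \<in> Past t \<rightarrow>\<^sub>M BX"
  unfolding Past_def by (rule phi_measurable)

lemma ball_sets: "ball d q \<inter> X \<in> sets BX"
  by (rule openin_sets) (auto simp: openin_open)

lemma Past_to_Fut: "t \<in> Tpos T \<Longrightarrow> f \<in> Past t \<rightarrow>\<^sub>M N \<Longrightarrow> f \<in> Fut \<rightarrow>\<^sub>M N"
  using Past_subset_Fut[of t] by (auto simp: measurable_def)

lemma Fut_to_M: "f \<in> Fut \<rightarrow>\<^sub>M N \<Longrightarrow> f \<in> M \<rightarrow>\<^sub>M N"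
  using Fut_subset by (auto simp: measurable_def)

text \<open>A map continuous in \<open>x\<close> and measurable in \<open>\<omega>\<close> is
  jointly measurable: \<open>x\<close> is replaced by the first point in an enumeration of
  \<open>D\<close> within distance \<open>1 / real (Suc n)\<close>, which takes countably many
  values and depends measurably on \<open>x\<close>; then \<open>n\<close> tends to
  infinity.\<close>

lemma phi_joint_Past:
  assumes t: "t \<in> Tpos T"
  shows "(\<lambda>(x, \<omega>). \<phi> t \<omega> x) \<in> BX \<Otimes>\<^sub>M Past t \<rightarrow>\<^sub>M BX"
proof (cases "X = {}")
  case True
  then show ?thesis by (auto simp: measurable_def space_pair_measure space_restrict_space)
next
  case False
  then have "D \<noteq> {}" using D_dense by auto
  define d where "d = from_nat_into D"
  have ran: "range d = D" using countable_D \<open>D \<noteq> {}\<close> by (simp add: d_def range_from_nat_into)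
  have dX: "d i \<in> X" for i using ran D_subset by auto
  define idx where "idx n x = (LEAST i. dist (d i) x < 1 / real (Suc n))" for n x
  have idx_m: "idx n \<in> BX \<rightarrow>\<^sub>M count_space UNIV" for n
    unfolding idx_def
  proof (rule measurable_Least)
    fix i
    have "ball (d i) (1 / real (Suc n)) \<inter> X = {x \<in> space BX. dist (d i) x < 1 / real (Suc n)}"
      by auto
    then show "Measurable.pred BX (\<lambda>x. dist (d i) x < 1 / real (Suc n))"
      using ball_sets[of "d i" "1 / real (Suc n)"] by (simp add: pred_def)
  qed
  have idx: "dist (d (idx n x)) x < 1 / real (Suc n)" if "x \<in> X" for n x
  proof -
    have "\<exists>y\<in>D. dist y x < 1 / real (Suc n)"
      using that D_dense closure_approachable[of x D] by (auto dest: subsetD)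
    then obtain i where "dist (d i) x < 1 / real (Suc n)" using ran by (metis rangeE)
    then show ?thesis unfolding idx_def by (rule LeastI)
  qed
  have lim: "(\<lambda>n. d (idx n x)) \<longlonglongrightarrow> x" if "x \<in> X" for x
  proof (rule metric_LIMSEQ_I)
    fix r :: real assume "0 < r"
    then obtain N where N: "inverse (real (Suc N)) < r" using reals_Archimedean by blast
    have "dist (d (idx n x)) x < r" if "N \<le> n" for n
    proof -
      have "1 / real (Suc n) \<le> 1 / real (Suc N)" using that by (intro divide_left_mono) auto
      then show ?thesis using idx[OF \<open>x \<in> X\<close>, of n] N by (simp add: inverse_eq_divide)
    qed
    then show "\<exists>no. \<forall>n\<ge>no. dist (d (idx n x)) x < r" by blast
  qed
  have "(\<lambda>p. \<phi> t (snd p) (fst p)) \<in> borel_measurable (BX \<Otimes>\<^sub>M Past t)"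
  proof (rule borel_measurable_LIMSEQ_metric)
    fix n
    show "(\<lambda>p. \<phi> t (snd p) (d (idx n (fst p)))) \<in> borel_measurable (BX \<Otimes>\<^sub>M Past t)"
    proof (rule measurable_compose_countable[where g = "\<lambda>p. idx n (fst p)"])
      show "(\<lambda>p. \<phi> t (snd p) (d i)) \<in> borel_measurable (BX \<Otimes>\<^sub>M Past t)" for i
        using measurable_compose[OF measurable_snd phi_Past[OF t dX]] measurable_restrict_space2_iff by blast
      show "(\<lambda>p. idx n (fst p)) \<in> BX \<Otimes>\<^sub>M Past t \<rightarrow>\<^sub>M count_space UNIV"
        by (rule measurable_compose[OF measurable_fst idx_m])
    qed
  next
    fix p assume p: "p \<in> space (BX \<Otimes>\<^sub>M Past t)"
    then have p': "fst p \<in> X" "snd p \<in> space M" by (auto simp: space_pair_measure)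
    show "(\<lambda>n. \<phi> t (snd p) (d (idx n (fst p)))) \<longlonglongrightarrow> \<phi> t (snd p) (fst p)"
      by (rule continuous_on_tendsto_compose[OF phi_continuous[OF t p'(2)] lim[OF p'(1)]])
        (use p' dX in auto)
  qed
  then have "(\<lambda>p. \<phi> t (snd p) (fst p)) \<in> BX \<Otimes>\<^sub>M Past t \<rightarrow>\<^sub>M BX"
    by (rule measurable_restrict_space2[rotated]) (auto simp: space_pair_measure phi_in[OF t])
  then show ?thesis by (simp add: case_prod_beta')
qed

lemma pair_sub_Fut: "(\<lambda>p. p) \<in> N \<Otimes>\<^sub>M M \<rightarrow>\<^sub>M N \<Otimes>\<^sub>M Fut"
  by (rule measurable_pair) (auto simp: comp_def intro!: measurable_compose[OF measurable_snd id_M_Fut])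

lemma pair_sub_Past: "t \<in> Tpos T \<Longrightarrow> (\<lambda>p. p) \<in> N \<Otimes>\<^sub>M Fut \<rightarrow>\<^sub>M N \<Otimes>\<^sub>M Past t"
  by (rule measurable_pair) (auto simp: comp_def intro!: measurable_compose[OF measurable_snd id_Fut_Past])

lemma phi_joint_Fut: "t \<in> Tpos T \<Longrightarrow> (\<lambda>(x, \<omega>). \<phi> t \<omega> x) \<in> BX \<Otimes>\<^sub>M Fut \<rightarrow>\<^sub>M BX"
  using measurable_compose[OF pair_sub_Past phi_joint_Past] .

lemma phi_joint_M: "t \<in> Tpos T \<Longrightarrow> (\<lambda>(x, \<omega>). \<phi> t \<omega> x) \<in> BX \<Otimes>\<^sub>M M \<rightarrow>\<^sub>M BX"
  using measurable_compose[OF pair_sub_Fut phi_joint_Fut] .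

lemma pair_sets_Fut: "S \<in> sets (N \<Otimes>\<^sub>M Fut) \<Longrightarrow> S \<in> sets (N \<Otimes>\<^sub>M M)"
  using measurable_sets[OF pair_sub_Fut, of S N] sets.sets_into_space[of S "N \<Otimes>\<^sub>M Fut"]
  by (simp add: space_pair_measure Int_absorb2)

text \<open>Continuity of \<open>dist\<close> is not enough, since Borel sets of
  \<open>'m \<times> 'm\<close> need not be product measurable when \<open>'m\<close> is not second
  countable. Separability of \<open>X\<close> lets the sublevel set be written as a countable union
  of rectangles of balls centred in \<open>D\<close>.\<close>

lemma dist_measurable: "(\<lambda>p. dist (fst p) (snd p)) \<in> borel_measurable (BX \<Otimes>\<^sub>M BX)"
  unfolding borel_measurable_iff_less
proof
  fix a :: real
  have "{w \<in> space (BX \<Otimes>\<^sub>M BX). dist (fst w) (snd w) < a}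
      = (\<Union>(d, q)\<in>D \<times> \<rat>. (ball d q \<inter> X) \<times> (ball d (a - q) \<inter> X))" (is "?L = ?R")
  proof (intro set_eqI iffI)
    fix w assume "w \<in> ?L"
    then obtain x y where w: "w = (x, y)" "x \<in> X" "y \<in> X" "dist x y < a"
      by (auto simp: space_pair_measure)
    \<comment> \<open>With \<open>e\<close> a third of the gap,
      \<open>dist d y \<le> dist d x + dist x y < a - 2 * e < a - q\<close>.\<close>
    define e where "e = (a - dist x y) / 3"
    have e: "0 < e" "dist x y = a - 3 * e" using w(4) unfolding e_def by argo+
    obtain d where d: "d \<in> D" "dist d x < e"
      using D_dense w e closure_approachable[of x D] by (metis subsetD)
    obtain q where q: "q \<in> \<rat>" "e < q" "q < 2 * e"
      using Rats_dense_in_real[of e "2 * e"] e by auto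
    have "dist d y < a - q" using dist_triangle[of d y x] d q e by linarith
    then have "w \<in> (ball d q \<inter> X) \<times> (ball d (a - q) \<inter> X)" using w d q by auto
    then show "w \<in> ?R" using d q by blast
  next
    fix w assume "w \<in> ?R"
    then obtain d q x y where w: "w = (x, y)" "x \<in> X" "y \<in> X" "dist d x < q" "dist d y < a - q"
      by auto
    then have "dist x y < a" using dist_triangle[of x y d] by (simp add: dist_commute)
    then show "w \<in> ?L" using w by (auto simp: space_pair_measure)
  qed
  moreover have "?R \<in> sets (BX \<Otimes>\<^sub>M BX)"
  proof (rule sets.countable_UN'')
    show "countable (D \<times> \<rat> :: ('m \<times> real) set)" by (intro countable_SIGMA countable_D countable_rat)
  qed (auto intro!: pair_measureI ball_sets)
  ultimately show "{w \<in> space (BX \<Otimes>\<^sub>M BX). dist (fst w) (snd w) < a} \<in> sets (BX \<Otimes>\<^sub>M BX)" by simp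
qed

lemma dist_phi_measurable:
  assumes t: "t \<in> Tpos T" and f: "f \<in> N \<rightarrow>\<^sub>M BX" "g \<in> N \<rightarrow>\<^sub>M BX" and h: "h \<in> N \<rightarrow>\<^sub>M Fut"
  shows "(\<lambda>p. dist (\<phi> t (h p) (f p)) (\<phi> t (h p) (g p))) \<in> borel_measurable N"
proof -
  have 1: "(\<lambda>p. \<phi> t (h p) (f p)) \<in> N \<rightarrow>\<^sub>M BX" "(\<lambda>p. \<phi> t (h p) (g p)) \<in> N \<rightarrow>\<^sub>M BX"
    using measurable_compose[OF measurable_Pair[OF f(1) h] phi_joint_Fut[OF t]]
      measurable_compose[OF measurable_Pair[OF f(2) h] phi_joint_Fut[OF t]] by auto
  show ?thesis using measurable_compose[OF measurable_Pair[OF 1] dist_measurable] by simp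
qed

lemma sync_sets: "{p \<in> space ((BX \<Otimes>\<^sub>M BX) \<Otimes>\<^sub>M Fut). sync (snd p) (fst (fst p)) (snd (fst p))}
    \<in> sets ((BX \<Otimes>\<^sub>M BX) \<Otimes>\<^sub>M Fut)"
proof -
  have [measurable]: "(\<lambda>p. dist (\<phi> t (snd p) (fst (fst p))) (\<phi> t (snd p) (snd (fst p))))
      \<in> borel_measurable ((BX \<Otimes>\<^sub>M BX) \<Otimes>\<^sub>M Fut)" if "t \<in> Q" for t
    by (rule dist_phi_measurable[OF Q_Tpos[OF that]]) measurable
  show ?thesis
    unfolding sync_def
    by (intro sets.sets_Collect_countable_All sets.sets_Collect_countable_Ex
        sets.sets_Collect_countable_All' countable_Q sets.sets_Collect_imp sets.sets_Collect_const) measurable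
qed

lemma contracts_rat_sets:
  assumes A: "A \<subseteq> X" "countable A"
  shows "{\<omega> \<in> space Fut. contracts_rat A \<omega>} \<in> sets Fut"
proof -
  have [measurable]: "(\<lambda>\<omega>. dist (\<phi> t \<omega> x) (\<phi> t \<omega> y)) \<in> borel_measurable Fut"
    if "t \<in> Q" "x \<in> A" "y \<in> A" for t x y
    by (rule dist_phi_measurable[OF Q_Tpos[OF that(1)]]) (use that A in auto)
  show ?thesis
    unfolding contracts_rat_def
    by (intro sets.sets_Collect_countable_All sets.sets_Collect_countable_Ex
        sets.sets_Collect_countable_All' countable_Q A sets.sets_Collect_imp sets.sets_Collect_const) measurable
qed

lemma contracts_sets:
  assumes U: "openin (top_of_set X) U"
  shows "{\<omega> \<in> space M. contracts T \<phi> U \<omega>} \<in> sets Fut"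
proof -
  have "{\<omega> \<in> space M. contracts T \<phi> U \<omega>} = {\<omega> \<in> space Fut. contracts_rat (U \<inter> D) \<omega>}"
    using contracts_iff[OF _ U] by auto
  also have "\<dots> \<in> sets Fut"
    by (rule contracts_rat_sets) (use D_subset countable_subset[OF _ countable_D] in auto)
  finally show ?thesis .
qed

section \<open>Shifts of the noise and the Markov property\<close>

lemma theta_in: "t \<in> T \<Longrightarrow> \<omega> \<in> space M \<Longrightarrow> \<theta> t \<omega> \<in> space M"
  using theta_measurable by (auto dest: measurable_space)

text \<open>The setting speaks of images under the shifts; by the group law the preimage under
  \<open>\<theta> t\<close> is the image under \<open>\<theta> (-t)\<close>.\<close>

lemma theta_vimage_F:
  assumes t: "t \<in> T" and su: "s \<in> T" "u \<in> T" "s \<le> u" and A: "A \<in> F s u"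
  shows "\<theta> t -` A \<inter> space M \<in> F (s + t) (u + t)"
proof -
  have A': "A \<subseteq> space M" using F_events su A sets.sets_into_space by blast
  have inv: "\<theta> t (\<theta> (-t) \<omega>) = \<omega>" "\<theta> (-t) (\<theta> t \<omega>) = \<omega>" if "\<omega> \<in> space M" for \<omega>
    using theta_add[of t "-t" \<omega>] theta_add[of "-t" t \<omega>] theta_0 t T_uminus that by auto
  have "\<theta> t -` A \<inter> space M = \<theta> (-t) ` A"
  proof (intro set_eqI iffI)
    fix \<omega> assume "\<omega> \<in> \<theta> t -` A \<inter> space M"
    then show "\<omega> \<in> \<theta> (-t) ` A" using inv(2)[of \<omega>] by (intro image_eqI[of _ _ "\<theta> t \<omega>"]) auto
  next
    fix \<omega> assume "\<omega> \<in> \<theta> (-t) ` A"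
    then show "\<omega> \<in> \<theta> t -` A \<inter> space M" using A' inv(1) theta_in T_uminus[OF t] by auto
  qed
  also have "\<dots> \<in> F (s - (-t)) (u - (-t))"
    using theta_F[OF T_uminus[OF t] su] A by blast
  finally show ?thesis by simp
qed

lemma theta_vimage_Fut:
  assumes t: "t \<in> T" and A: "A \<in> sets Fut"
  shows "\<theta> t -` A \<inter> space M \<in> F_future T M F t"
proof -
  have "A \<in> sigma_sets (space M) (\<Union>u\<in>{u \<in> T. 0 \<le> u}. F 0 u)"
    using A unfolding sets_Fut F_future_def .
  then show ?thesis
  proof induction
    case (Basic a)
    then obtain u where u: "u \<in> T" "0 \<le> u" "a \<in> F 0 u" by auto
    then have "\<theta> t -` a \<inter> space M \<in> F t (u + t)" using theta_vimage_F[OF t T_0 u] by simp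
    moreover have "u + t \<in> {u \<in> T. t \<le> u}" using u T_add t by auto
    ultimately show ?case unfolding F_future_def by (intro sigma_sets.Basic) blast
  next
    case Empty
    then show ?case by (simp add: F_future_def sigma_sets.Empty)
  next
    case (Compl a)
    have "\<theta> t -` (space M - a) \<inter> space M = space M - (\<theta> t -` a \<inter> space M)"
      using theta_in[OF t] by auto
    then show ?case using Compl unfolding F_future_def by (auto intro: sigma_sets.Compl)
  next
    case (Union a)
    have *: "\<theta> t -` (\<Union>i. a i) \<inter> space M = (\<Union>i. \<theta> t -` a i \<inter> space M)" by auto
    show ?case unfolding * F_future_def
      by (rule sigma_sets.Union) (use Union.IH in \<open>simp add: F_future_def\<close>)
  qed
qed

lemma theta_M_Fut: "t \<in> T \<Longrightarrow> \<theta> t \<in> M \<rightarrow>\<^sub>M Fut"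
  using measurable_compose[OF theta_measurable id_M_Fut] .

text \<open>The identity, seen as a map into \<open>Past t\<close>, generates events of
  \<open>F_past\<close>, and the shifted noise generates events of \<open>F_future\<close>;
  independence passes to smaller sigma-algebras.\<close>

lemma indep_var_shift:
  assumes t: "t \<in> Tpos T"
  shows "indep_var (Past t) (\<lambda>\<omega>. \<omega>) Fut (\<theta> t)"
  unfolding indep_var_eq
proof (intro conjI)
  have tT: "t \<in> T" using t by (rule Tpos_T)
  show "(\<lambda>\<omega>. \<omega>) \<in> M \<rightarrow>\<^sub>M Past t" by (rule Fut_to_M[OF id_Fut_Past[OF t]])
  show "\<theta> t \<in> M \<rightarrow>\<^sub>M Fut" by (rule theta_M_Fut[OF tT])
  have 1: "sigma_sets (space M) {(\<lambda>\<omega>. \<omega>) -` A \<inter> space M |A. A \<in> sets (Past t)} \<subseteq> F_past T M F t"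
    unfolding F_past_def
  proof (rule sigma_sets_mono)
    show "{(\<lambda>\<omega>. \<omega>) -` A \<inter> space M |A. A \<in> sets (Past t)} \<subseteq> sigma_sets (space M) (\<Union>s\<in>{s \<in> T. s \<le> t}. F s t)"
    proof safe
      fix A assume A: "A \<in> sets (Past t)"
      then have "(\<lambda>\<omega>. \<omega>) -` A \<inter> space M = A" using sets.sets_into_space by fastforce
      then show "(\<lambda>\<omega>. \<omega>) -` A \<inter> space M \<in> sigma_sets (space M) (\<Union>s\<in>{s \<in> T. s \<le> t}. F s t)"
        using A sets_Past[OF t] Tpos_nonneg[OF t] T_0 by (auto intro!: sigma_sets.Basic)
    qed
  qed
  have 2: "sigma_sets (space M) {\<theta> t -` A \<inter> space M |A. A \<in> sets Fut} \<subseteq> F_future T M F t"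
    unfolding F_future_def
    by (rule sigma_sets_mono) (use theta_vimage_Fut[OF tT] in \<open>auto simp: F_future_def\<close>)
  show "indep_set (sigma_sets (space M) {(\<lambda>\<omega>. \<omega>) -` A \<inter> space M |A. A \<in> sets (Past t)})
      (sigma_sets (space M) {\<theta> t -` A \<inter> space M |A. A \<in> sets Fut})"
    using indep_past_future[OF tT] 1 2 unfolding indep_sets2_eq by blast
qed

lemma distr_theta_Fut: "t \<in> T \<Longrightarrow> distr M Fut (\<theta> t) = distr M Fut (\<lambda>\<omega>. \<omega>)"
  using distr_distr[OF id_M_Fut theta_measurable, of t] theta_distr[of t] by (simp add: comp_def)

text \<open>Markov property with the present frozen: the joint law of the noise up to
  \<open>t\<close> and the shifted noise is a product whose second factor is the unshifted law of
  the future, so Fubini integrates out the future for each fixed value of \<open>Z\<close>. The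
  arbitrary past event \<open>G\<close> makes this a conditional statement.\<close>

lemma markov_emeasure:
  assumes t: "t \<in> Tpos T" and G: "G \<in> sets (Past t)" and Z: "Z \<in> Past t \<rightarrow>\<^sub>M N"
    and H: "H \<in> sets (N \<Otimes>\<^sub>M Fut)"
  shows "emeasure M {\<omega> \<in> G. (Z \<omega>, \<theta> t \<omega>) \<in> H} = (\<integral>\<^sup>+\<omega>. indicator G \<omega> * emeasure M (Pair (Z \<omega>) -` H) \<partial>M)"
proof -
  have tT: "t \<in> T" using t by (rule Tpos_T)
  have idP: "(\<lambda>\<omega>. \<omega>) \<in> M \<rightarrow>\<^sub>M Past t" by (rule Fut_to_M[OF id_Fut_Past[OF t]])
  define A where "A = {p \<in> space (Past t \<Otimes>\<^sub>M Fut). fst p \<in> G \<and> (Z (fst p), snd p) \<in> H}"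
  have Zp: "(\<lambda>p. (Z (fst p), snd p)) \<in> Past t \<Otimes>\<^sub>M Fut \<rightarrow>\<^sub>M N \<Otimes>\<^sub>M Fut"
    by (intro measurable_Pair measurable_compose[OF measurable_fst Z] measurable_snd)
  have A: "A \<in> sets (Past t \<Otimes>\<^sub>M Fut)"
  proof -
    have "A = (\<lambda>p. (Z (fst p), snd p)) -` H \<inter> space (Past t \<Otimes>\<^sub>M Fut) \<inter> (G \<times> space Fut)"
      unfolding A_def by (auto simp: space_pair_measure)
    also have "\<dots> \<in> sets (Past t \<Otimes>\<^sub>M Fut)" by (intro sets.Int measurable_sets[OF Zp H] pair_measureI G sets.top)
    finally show ?thesis .
  qed
  have GM: "G \<subseteq> space M" using G sets.sets_into_space by fastforce
  have pm: "(\<lambda>\<omega>. (\<omega>, \<theta> t \<omega>)) \<in> M \<rightarrow>\<^sub>M Past t \<Otimes>\<^sub>M Fut"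
    by (intro measurable_Pair idP theta_M_Fut tT)
  interpret F: prob_space "distr M Fut (\<lambda>\<omega>. \<omega>)" by (rule prob_space_distr[OF id_M_Fut])
  have "{\<omega> \<in> G. (Z \<omega>, \<theta> t \<omega>) \<in> H} = (\<lambda>\<omega>. (\<omega>, \<theta> t \<omega>)) -` A \<inter> space M"
    using GM theta_in[OF tT] by (auto simp: A_def space_pair_measure)
  then have "emeasure M {\<omega> \<in> G. (Z \<omega>, \<theta> t \<omega>) \<in> H} = emeasure (distr M (Past t \<Otimes>\<^sub>M Fut) (\<lambda>\<omega>. (\<omega>, \<theta> t \<omega>))) A"
    using emeasure_distr[OF pm A] by simp
  also have "distr M (Past t \<Otimes>\<^sub>M Fut) (\<lambda>\<omega>. (\<omega>, \<theta> t \<omega>)) = distr M (Past t) (\<lambda>\<omega>. \<omega>) \<Otimes>\<^sub>M distr M Fut (\<lambda>\<omega>. \<omega>)"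
    using indep_var_shift[OF t] distr_theta_Fut[OF tT] unfolding indep_var_distribution_eq by simp
  also have "emeasure \<dots> A = (\<integral>\<^sup>+\<omega>. emeasure (distr M Fut (\<lambda>\<omega>. \<omega>)) (Pair \<omega> -` A) \<partial>distr M (Past t) (\<lambda>\<omega>. \<omega>))"
    by (rule F.emeasure_pair_measure_alt) (use A in simp)
  also have "\<dots> = (\<integral>\<^sup>+\<omega>. emeasure (distr M Fut (\<lambda>\<omega>. \<omega>)) (Pair \<omega> -` A) \<partial>M)"
    by (rule nn_integral_distr[OF idP]) (rule F.measurable_emeasure_Pair, use A in simp)
  also have "\<dots> = (\<integral>\<^sup>+\<omega>. indicator G \<omega> * emeasure M (Pair (Z \<omega>) -` H) \<partial>M)"
  proof (rule nn_integral_cong)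
    fix \<omega> assume w: "\<omega> \<in> space M"
    have "Pair \<omega> -` A = (if \<omega> \<in> G then Pair (Z \<omega>) -` H else {})"
      using w sets.sets_into_space[OF H] by (auto simp: A_def space_pair_measure)
    moreover have "emeasure (distr M Fut (\<lambda>\<omega>. \<omega>)) (Pair (Z \<omega>) -` H) = emeasure M (Pair (Z \<omega>) -` H)"
    proof -
      have "Pair (Z \<omega>) -` H \<in> sets Fut" using H by (rule sets_Pair1)
      then show ?thesis using emeasure_distr[OF id_M_Fut, of "Pair (Z \<omega>) -` H"] sets.sets_into_space[of _ Fut]
        by (simp add: Int_absorb2)
    qed
    ultimately show "emeasure (distr M Fut (\<lambda>\<omega>. \<omega>)) (Pair \<omega> -` A) = indicator G \<omega> * emeasure M (Pair (Z \<omega>) -` H)"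
      by (auto simp: indicator_def)
  qed
  finally show ?thesis .
qed

lemma markov_sets:
  assumes t: "t \<in> Tpos T" and Z: "Z \<in> Past t \<rightarrow>\<^sub>M N" and H: "H \<in> sets (N \<Otimes>\<^sub>M Fut)"
  shows "{\<omega> \<in> space M. (Z \<omega>, \<theta> t \<omega>) \<in> H} \<in> sets M"
proof -
  have "(\<lambda>\<omega>. (Z \<omega>, \<theta> t \<omega>)) \<in> M \<rightarrow>\<^sub>M N \<Otimes>\<^sub>M Fut"
    by (intro measurable_Pair theta_M_Fut Tpos_T t Fut_to_M[OF Past_to_Fut[OF t Z]])
  from measurable_sets[OF this H] show ?thesis by (simp add: vimage_def Int_def conj_commute)
qed

lemma prob_section_measurable: "H \<in> sets (N \<Otimes>\<^sub>M Fut) \<Longrightarrow> (\<lambda>y. prob (Pair y -` H)) \<in> borel_measurable N"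
  unfolding measure_def using measurable_emeasure_Pair[OF pair_sets_Fut] by measurable

lemma markov_prob:
  assumes t: "t \<in> Tpos T" and G: "G \<in> sets (Past t)" and Z: "Z \<in> Past t \<rightarrow>\<^sub>M N"
    and H: "H \<in> sets (N \<Otimes>\<^sub>M Fut)"
  shows "prob {\<omega> \<in> G. (Z \<omega>, \<theta> t \<omega>) \<in> H} = (\<integral>\<omega>. indicator G \<omega> * prob (Pair (Z \<omega>) -` H) \<partial>M)"
proof -
  have GM: "G \<in> sets M" using G Past_subset_Fut[OF t] Fut_subset by blast
  have ZM: "(\<lambda>\<omega>. prob (Pair (Z \<omega>) -` H)) \<in> borel_measurable M"
    by (rule measurable_compose[OF Fut_to_M[OF Past_to_Fut[OF t Z]] prob_section_measurable[OF H]])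
  have "emeasure M {\<omega> \<in> G. (Z \<omega>, \<theta> t \<omega>) \<in> H} = (\<integral>\<^sup>+\<omega>. ennreal (indicator G \<omega> * prob (Pair (Z \<omega>) -` H)) \<partial>M)"
    unfolding markov_emeasure[OF assms]
    by (intro nn_integral_cong) (auto simp: emeasure_eq_measure indicator_def)
  also have "\<dots> = ennreal (\<integral>\<omega>. indicator G \<omega> * prob (Pair (Z \<omega>) -` H) \<partial>M)"
  proof (rule nn_integral_eq_integral)
    show "integrable M (\<lambda>\<omega>. indicator G \<omega> * prob (Pair (Z \<omega>) -` H))"
      by (rule integrable_const_bound[of _ 1]) (use GM ZM in \<open>auto simp: indicator_def\<close>)
  qed auto
  finally show ?thesis by (simp add: measure_def integral_nonneg_AE)
qed

end

section \<open>Ergodic measures\<close>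

locale rds_ergodic = rds T M F \<theta> X \<phi>
  for T :: "real set" and M :: "'w measure" and F :: "real \<Rightarrow> real \<Rightarrow> 'w set set"
    and \<theta> :: "real \<Rightarrow> 'w \<Rightarrow> 'w" and X :: "'m::complete_space set"
    and \<phi> :: "real \<Rightarrow> 'w \<Rightarrow> 'm \<Rightarrow> 'm" +
  fixes \<rho> :: "'m measure"
  assumes erg: "ergodic T M X \<phi> \<rho>"
begin

lemma prob_space_rho: "prob_space \<rho>" and sets_rho [measurable_cong]: "sets \<rho> = sets BX"
  and space_rho [simp]: "space \<rho> = X"
  and stationary_rho: "t \<in> Tpos T \<Longrightarrow> A \<in> sets \<rho> \<Longrightarrow> measure \<rho> A = (\<integral>x. trans_prob M \<phi> t x A \<partial>\<rho>)"
  and ergodic_rho: "A \<in> sets \<rho> \<Longrightarrow>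
    (\<And>t. t \<in> Tpos T \<Longrightarrow> AE x in \<rho>. trans_prob M \<phi> t x A = indicator A x) \<Longrightarrow>
    measure \<rho> A = 0 \<or> measure \<rho> A = 1"
  using erg unfolding ergodic_def stationary_def prob_on_def by blast+

end

sublocale rds_ergodic \<subseteq> rho: prob_space \<rho> by (rule prob_space_rho)
sublocale rds_ergodic \<subseteq> pair: pair_prob_space \<rho> M ..

context rds_ergodic
begin

section \<open>Stationarity, regularity and invariant sets\<close>

abbreviation W :: "('m \<times> 'w) measure" where "W \<equiv> \<rho> \<Otimes>\<^sub>M M"

lemma phi_W: "t \<in> Tpos T \<Longrightarrow> (\<lambda>p. \<phi> t (snd p) (fst p)) \<in> W \<rightarrow>\<^sub>M \<rho>"
  using phi_joint_M[of t] by (simp add: case_prod_beta' cong: measurable_cong_sets)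

lemma phi_section_sets:
  "t \<in> Tpos T \<Longrightarrow> A \<in> sets \<rho> \<Longrightarrow> x \<in> X \<Longrightarrow> {\<omega> \<in> space M. \<phi> t \<omega> x \<in> A} \<in> sets M"
  using measurable_sets[OF Fut_to_M[OF Past_to_Fut[OF _ phi_Past]], of t x A]
  by (simp add: sets_rho vimage_def Int_def conj_commute)

lemma phi_W_sets: "t \<in> Tpos T \<Longrightarrow> A \<in> sets \<rho> \<Longrightarrow> {p \<in> space W. \<phi> t (snd p) (fst p) \<in> A} \<in> sets W"
  using measurable_sets[OF phi_W, of t A] by (simp add: vimage_def Int_def conj_commute)

lemma trans_prob_measurable:
  assumes t: "t \<in> Tpos T" and A: "A \<in> sets \<rho>"
  shows "(\<lambda>x. trans_prob M \<phi> t x A) \<in> borel_measurable \<rho>"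
proof -
  have "(\<lambda>x. measure M (Pair x -` {p \<in> space W. \<phi> t (snd p) (fst p) \<in> A})) \<in> borel_measurable \<rho>"
    unfolding measure_def using measurable_emeasure_Pair[OF phi_W_sets[OF t A]] by measurable
  then show ?thesis
    by (rule measurable_cong[THEN iffD1, rotated])
      (auto simp: trans_prob_def space_pair_measure intro!: arg_cong[where f = "measure M"])
qed

lemma trans_prob_bounds: "0 \<le> trans_prob M \<phi> t x A" "trans_prob M \<phi> t x A \<le> 1"
  by (auto simp: trans_prob_def)

text \<open>By Fubini, averaging \<open>trans_prob\<close> over \<open>\<rho>\<close> computes the
  law of the position at time \<open>t\<close> for a start independent of the noise. In this form
  almost everywhere statements and integrals can be moved along the flow.\<close>

lemma distr_phi:
  assumes t: "t \<in> Tpos T"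
  shows "distr W \<rho> (\<lambda>p. \<phi> t (snd p) (fst p)) = \<rho>"
proof (rule measure_eqI)
  fix A assume "A \<in> sets (distr W \<rho> (\<lambda>p. \<phi> t (snd p) (fst p)))"
  then have A: "A \<in> sets \<rho>" by simp
  have "emeasure (distr W \<rho> (\<lambda>p. \<phi> t (snd p) (fst p))) A = emeasure W {p \<in> space W. \<phi> t (snd p) (fst p) \<in> A}"
    using emeasure_distr[OF phi_W[OF t] A] by (simp add: vimage_def Int_def conj_commute)
  also have "\<dots> = (\<integral>\<^sup>+x. emeasure M (Pair x -` {p \<in> space W. \<phi> t (snd p) (fst p) \<in> A}) \<partial>\<rho>)"
    by (rule emeasure_pair_measure_alt[OF phi_W_sets[OF t A]])
  also have "\<dots> = (\<integral>\<^sup>+x. ennreal (trans_prob M \<phi> t x A) \<partial>\<rho>)"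
    by (rule nn_integral_cong)
      (auto simp: trans_prob_def emeasure_eq_measure space_pair_measure intro!: arg_cong[where f = "measure M"])
  also have "\<dots> = ennreal (\<integral>x. trans_prob M \<phi> t x A \<partial>\<rho>)"
  proof (rule nn_integral_eq_integral)
    show "integrable \<rho> (\<lambda>x. trans_prob M \<phi> t x A)"
      by (rule rho.integrable_const_bound[of _ 1])
        (use trans_prob_measurable[OF t A] trans_prob_bounds in auto)
  qed (auto simp: trans_prob_bounds)
  also have "\<dots> = emeasure \<rho> A"
    using stationary_rho[OF t A] by (simp add: rho.emeasure_eq_measure)
  finally show "emeasure (distr W \<rho> (\<lambda>p. \<phi> t (snd p) (fst p))) A = emeasure \<rho> A" .
qed simp

lemma measure_phi:
  assumes t: "t \<in> Tpos T" and A: "A \<in> sets \<rho>"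
  shows "measure W {p \<in> space W. \<phi> t (snd p) (fst p) \<in> A} = measure \<rho> A"
  using measure_distr[OF phi_W[OF t] A] unfolding distr_phi[OF t]
  by (simp add: vimage_def Int_def conj_commute)

lemma AE_phi:
  assumes t: "t \<in> Tpos T" and P: "AE x in \<rho>. P x"
  shows "AE x in \<rho>. AE \<omega> in M. P (\<phi> t \<omega> x)"
proof -
  have "AE x in distr W \<rho> (\<lambda>p. \<phi> t (snd p) (fst p)). P x" using P unfolding distr_phi[OF t] .
  from pair.AE_pair[OF AE_distrD[OF phi_W[OF t] this]] show ?thesis by simp
qed

lemma integral_phi:
  fixes f :: "'m \<Rightarrow> real"
  assumes t: "t \<in> Tpos T" and f: "f \<in> borel_measurable BX" and b: "\<And>x. x \<in> X \<Longrightarrow> 0 \<le> f x \<and> f x \<le> 1"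
  shows "(\<integral>x. (\<integral>\<omega>. f (\<phi> t \<omega> x) \<partial>M) \<partial>\<rho>) = (\<integral>x. f x \<partial>\<rho>)"
proof -
  have f': "f \<in> borel_measurable \<rho>" using f by (simp cong: measurable_cong_sets)
  have "(\<integral>x. f x \<partial>\<rho>) = (\<integral>p. f (\<phi> t (snd p) (fst p)) \<partial>W)"
    using integral_distr[OF phi_W[OF t] f'] unfolding distr_phi[OF t] by simp
  also have "\<dots> = (\<integral>x. (\<integral>\<omega>. f (\<phi> t (snd (x, \<omega>)) (fst (x, \<omega>))) \<partial>M) \<partial>\<rho>)"
  proof (rule pair.integral_fst'[symmetric])
    show "integrable W (\<lambda>p. f (\<phi> t (snd p) (fst p)))"
    proof (rule pair.P.integrable_const_bound[of _ 1])
      show "AE p in W. norm (f (\<phi> t (snd p) (fst p))) \<le> 1"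
        by (rule AE_I2) (use b phi_in[OF t] in \<open>auto simp: space_pair_measure\<close>)
    qed (rule measurable_compose[OF phi_W[OF t] f'])
  qed
  finally show ?thesis by simp
qed

text \<open>\<open>\<rho>\<close> lives on \<open>X\<close>, but closedness and completeness belong
  to the ambient type, so its image on all of \<open>'m\<close> is used; that image is tight because
  \<open>D\<close> is dense in \<open>X\<close>.\<close>

lemma rho_regular:
  assumes A: "A \<in> sets \<rho>" and "0 < (e::real)"
  shows "\<exists>G. openin (top_of_set X) G \<and> A \<subseteq> G \<and> measure \<rho> (G - A) < e"
    and "\<exists>K. compact K \<and> K \<subseteq> A \<and> measure \<rho> (A - K) < e"
proof -
  let ?N = "distr \<rho> borel (\<lambda>x. x)"
  have id: "(\<lambda>x. x) \<in> \<rho> \<rightarrow>\<^sub>M borel"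
    using measurable_restrict_space1[OF measurable_ident_sets[OF refl], of borel X]
    by (simp cong: measurable_cong_sets)
  interpret N: prob_space ?N by (rule rho.prob_space_distr[OF id])
  have fin: "finite_measure ?N" by (rule N.finite_measure_axioms)
  have AX: "A \<subseteq> X" and Ab: "A \<in> sets borel"
    using A sets.sets_into_space[OF A] X_borel by (auto simp: sets_rho sets_restrict_space)
  have meas: "measure ?N B = measure \<rho> (B \<inter> X)" if "B \<in> sets borel" for B
    using measure_distr[OF id that] by simp
  obtain C G where G: "closed C" "open G" "C \<subseteq> A" "A \<subseteq> G" "measure ?N (G - C) < e"
    using finite_measure_borel_regular[OF fin _ Ab \<open>0 < e\<close>] by auto
  have "measure \<rho> (G \<inter> X - A) \<le> measure \<rho> ((G - C) \<inter> X)"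
    by (rule rho.finite_measure_mono) (use G in \<open>auto simp: sets_rho sets_restrict_space Int_commute\<close>)
  then show "\<exists>G. openin (top_of_set X) G \<and> A \<subseteq> G \<and> measure \<rho> (G - A) < e"
    using G AX meas[of "G - C"] by (intro exI[of _ "G \<inter> X"]) (auto simp: openin_open)
  obtain K where K: "compact K" "K \<subseteq> A" "measure ?N (A - K) < e"
    using finite_measure_borel_tight[OF fin _ Ab countable_D order_trans[OF AX D_dense] \<open>0 < e\<close>] by auto
  have "measure ?N (A - K) = measure \<rho> (A - K)"
    using K Ab AX by (subst meas) (auto intro!: arg_cong[where f = "measure \<rho>"] simp: compact_imp_closed)
  then show "\<exists>K. compact K \<and> K \<subseteq> A \<and> measure \<rho> (A - K) < e" using K by auto
qed

lemma compact_sets: "compact K \<Longrightarrow> K \<subseteq> X \<Longrightarrow> K \<in> sets \<rho>"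
  by (auto simp: sets_rho sets_restrict_space compact_imp_closed intro!: image_eqI[of _ _ K])

text \<open>Absence of mass transport out of \<open>A\<close> passes from times in \<open>Q\<close> to all times: by right-continuity a path that
  is in an open \<open>G \<supseteq> X - A\<close> at time \<open>t\<close> is in \<open>G\<close> at nearby later times.\<close>

lemma invariant_extends:
  assumes A: "A \<in> sets \<rho>"
    and inv: "\<And>q. q \<in> Q \<Longrightarrow> measure W {p \<in> space W. fst p \<in> A \<and> \<phi> q (snd p) (fst p) \<in> X - A} = 0"
    and t: "t \<in> Tpos T"
  shows "measure W {p \<in> space W. fst p \<in> A \<and> \<phi> t (snd p) (fst p) \<in> X - A} = 0"
proof -
  let ?E = "\<lambda>t B. {p \<in> space W. fst p \<in> A \<and> \<phi> t (snd p) (fst p) \<in> B}"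
  have E: "?E t B \<in> sets W" if "t \<in> Tpos T" "B \<in> sets \<rho>" for t B
  proof -
    have "?E t B = {p \<in> space W. \<phi> t (snd p) (fst p) \<in> B} \<inter> (A \<times> space M)"
      by (auto simp: space_pair_measure)
    then show ?thesis using phi_W_sets[OF that] A by auto
  qed
  have Ac: "X - A \<in> sets \<rho>" using sets.compl_sets[OF A] by simp
  obtain tn where tn: "\<And>n. tn n \<in> Q" "decseq tn" "tn \<longlonglongrightarrow> t" using Q_approx[OF t] by auto
  have "measure W (?E t (X - A)) \<le> e" if "0 < e" for e :: real
  proof -
    obtain G where G: "openin (top_of_set X) G" "X - A \<subseteq> G" "measure \<rho> (G - (X - A)) < e"
      using rho_regular(1)[OF Ac \<open>0 < e\<close>] by blast
    have Gs: "G \<in> sets \<rho>" using openin_sets[OF G(1)] sets_rho by simp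
    have GX: "G \<subseteq> X" using openin_imp_subset[OF G(1)] .
    \<comment> \<open>Requiring membership in \<open>G\<close> at all later times
      \<open>tn m\<close> makes \<open>V n\<close> increase with \<open>n\<close>. Its mass is read
      off at the single time \<open>tn n\<close>: nothing passes into \<open>X - A\<close> by
      hypothesis, and by stationarity less than \<open>e\<close> lies in the excess
      \<open>G - (X - A)\<close>.\<close>
    define V where "V n = (\<Inter>m\<in>{n..}. ?E (tn m) G)" for n
    have Vs: "V n \<in> sets W" for n
      unfolding V_def by (rule sets.countable_INT) (use E[OF Q_Tpos[OF tn(1)] Gs] in auto)
    have Vb: "measure W (V n) \<le> e" for n
    proof -
      let ?t = "tn n"
      have tt: "?t \<in> Tpos T" by (rule Q_Tpos[OF tn(1)])
      have "measure W (V n) \<le> measure W (?E ?t (X - A) \<union> {p \<in> space W. \<phi> ?t (snd p) (fst p) \<in> G - (X - A)})"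
        by (rule pair.P.finite_measure_mono)
          (use E[OF tt Ac] phi_W_sets[OF tt, of "G - (X - A)"] Gs Ac GX in \<open>auto simp: V_def\<close>)
      also have "\<dots> \<le> measure W (?E ?t (X - A)) + measure W {p \<in> space W. \<phi> ?t (snd p) (fst p) \<in> G - (X - A)}"
        by (rule measure_Un_le) (use E[OF tt Ac] phi_W_sets[OF tt, of "G - (X - A)"] Gs Ac in auto)
      also have "\<dots> = measure \<rho> (G - (X - A))"
        using inv[OF tn(1)] measure_phi[OF tt, of "G - (X - A)"] Gs Ac by simp
      finally show ?thesis using G(3) by simp
    qed
    have "(\<lambda>n. measure W (V n)) \<longlonglongrightarrow> measure W (\<Union>n. V n)"
    proof (rule pair.P.finite_Lim_measure_incseq)
      show "incseq V" unfolding incseq_def V_def by (intro allI impI INT_anti_mono) auto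
    qed (use Vs in auto)
    then have U: "measure W (\<Union>n. V n) \<le> e" by (rule LIMSEQ_le_const2) (use Vb in auto)
    have "?E t (X - A) \<subseteq> (\<Union>n. V n)"
    proof
      fix p assume p: "p \<in> ?E t (X - A)"
      then obtain x \<omega> where p': "p = (x, \<omega>)" "x \<in> X" "\<omega> \<in> space M" "x \<in> A" "\<phi> t \<omega> x \<in> X - A"
        by (auto simp: space_pair_measure)
      obtain G' where G': "open G'" "G = X \<inter> G'" using G(1) by (auto simp: openin_open)
      have "(\<lambda>n. \<phi> (tn n) \<omega> x) \<longlonglongrightarrow> \<phi> t \<omega> x"
        by (rule phi_right_continuous[where xn = "\<lambda>_. x"]) (use p' tn Q_Tpos t in auto)
      then have "\<forall>\<^sub>F n in sequentially. \<phi> (tn n) \<omega> x \<in> G'"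
        by (rule topological_tendstoD) (use G' G(2) p' in auto)
      then obtain n where n: "\<And>m. n \<le> m \<Longrightarrow> \<phi> (tn m) \<omega> x \<in> G'" by (auto simp: eventually_sequentially)
      have "p \<in> V n" unfolding V_def
        using n p' G' phi_in[OF Q_Tpos[OF tn(1)]] by (auto simp: space_pair_measure)
      then show "p \<in> (\<Union>n. V n)" by blast
    qed
    then have "measure W (?E t (X - A)) \<le> measure W (\<Union>n. V n)"
      by (rule pair.P.finite_measure_mono) (use Vs in auto)
    then show ?thesis using U by simp
  qed
  then have "measure W (?E t (X - A)) \<le> 0" by (rule field_le_epsilon[where y = "0::real", simplified])
  then show ?thesis by (simp add: measure_le_0_iff)
qed

text \<open>Ergodicity concerns sets invariant at every time, whereas events formed with times in
  \<open>Q\<close> are only seen to be invariant under shifts from \<open>Q\<close>. Invariance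
  means that no mass leaves \<open>A\<close> and none leaves its complement, and each half extends
  to all times by \<open>invariant_extends\<close>.\<close>

lemma ergodic_Q:
  assumes A: "A \<in> sets \<rho>" and inv: "\<And>q. q \<in> Q \<Longrightarrow> AE x in \<rho>. trans_prob M \<phi> q x A = indicator A x"
  shows "measure \<rho> A = 0 \<or> measure \<rho> A = 1"
proof (rule ergodic_rho[OF A])
  have AX: "A \<subseteq> X" using sets.sets_into_space[OF A] by simp
  have Ac: "X - A \<in> sets \<rho>" using sets.compl_sets[OF A] by simp
  have compl: "trans_prob M \<phi> t x (X - B) = 1 - trans_prob M \<phi> t x B"
    if "t \<in> Tpos T" "x \<in> X" "B \<in> sets \<rho>" for t x B
  proof -
    have "{\<omega> \<in> space M. \<phi> t \<omega> x \<in> X - B} = space M - {\<omega> \<in> space M. \<phi> t \<omega> x \<in> B}"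
      using phi_in[OF that(1) _ that(2)] by auto
    then show ?thesis using prob_compl[OF phi_section_sets[OF that(1,3,2)]] by (simp add: trans_prob_def)
  qed
  \<comment> \<open>Fubini translates between transported mass, as in
    \<open>invariant_extends\<close>, and \<open>trans_prob\<close>.\<close>
  have iff: "measure W {p \<in> space W. fst p \<in> B \<and> \<phi> t (snd p) (fst p) \<in> X - B} = 0
      \<longleftrightarrow> (AE x in \<rho>. x \<in> B \<longrightarrow> trans_prob M \<phi> t x (X - B) = 0)"
    if t: "t \<in> Tpos T" and B: "B \<in> sets \<rho>" for t B
  proof -
    let ?S = "{p \<in> space W. fst p \<in> B \<and> \<phi> t (snd p) (fst p) \<in> X - B}"
    have Bc: "X - B \<in> sets \<rho>" using sets.compl_sets[OF B] by simp
    have "?S = {p \<in> space W. \<phi> t (snd p) (fst p) \<in> X - B} \<inter> (B \<times> space M)"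
      by (auto simp: space_pair_measure)
    then have S: "?S \<in> sets W" using phi_W_sets[OF t Bc] B by auto
    have sec: "emeasure M (Pair x -` ?S) = ennreal (if x \<in> B then trans_prob M \<phi> t x (X - B) else 0)"
      if "x \<in> X" for x
    proof -
      have "Pair x -` ?S = (if x \<in> B then {\<omega> \<in> space M. \<phi> t \<omega> x \<in> X - B} else {})"
        using that by (auto simp: space_pair_measure)
      then show ?thesis by (simp add: trans_prob_def emeasure_eq_measure)
    qed
    have "measure W ?S = 0 \<longleftrightarrow> emeasure W ?S = 0"
      by (simp add: pair.P.emeasure_eq_measure)
    also have "\<dots> \<longleftrightarrow> (AE x in \<rho>. emeasure M (Pair x -` ?S) = 0)"
      unfolding emeasure_pair_measure_alt[OF S]
      by (rule nn_integral_0_iff_AE) (rule measurable_emeasure_Pair[OF S])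
    also have "\<dots> \<longleftrightarrow> (AE x in \<rho>. x \<in> B \<longrightarrow> trans_prob M \<phi> t x (X - B) = 0)"
      by (rule AE_cong) (use sec trans_prob_bounds in auto)
    finally show ?thesis .
  qed
  fix t assume t: "t \<in> Tpos T"
  have 1: "AE x in \<rho>. x \<in> A \<longrightarrow> trans_prob M \<phi> t x (X - A) = 0"
  proof (subst iff[OF t A, symmetric], rule invariant_extends[OF A _ t])
    fix q assume q: "q \<in> Q"
    show "measure W {p \<in> space W. fst p \<in> A \<and> \<phi> q (snd p) (fst p) \<in> X - A} = 0"
      unfolding iff[OF Q_Tpos[OF q] A] using inv[OF q] AE_space
      by eventually_elim (auto simp: compl[OF Q_Tpos[OF q] _ A])
  qed
  have 2: "AE x in \<rho>. x \<in> X - A \<longrightarrow> trans_prob M \<phi> t x (X - (X - A)) = 0"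
  proof (subst iff[OF t Ac, symmetric], rule invariant_extends[OF Ac _ t])
    fix q assume q: "q \<in> Q"
    have XA: "X - (X - A) = A" using AX by auto
    show "measure W {p \<in> space W. fst p \<in> X - A \<and> \<phi> q (snd p) (fst p) \<in> X - (X - A)} = 0"
      unfolding iff[OF Q_Tpos[OF q] Ac] using inv[OF q] AE_space
      by eventually_elim (auto simp: XA)
  qed
  show "AE x in \<rho>. trans_prob M \<phi> t x A = indicator A x"
    using 1 2 AE_space
    by eventually_elim (use AX in \<open>auto simp: compl[OF t _ A] double_diff indicator_def\<close>)
qed

end

context rds
begin

lemma AE_pos_prob:
  assumes "AE \<omega> in M. P \<omega>" "\<And>\<omega>. \<omega> \<in> space M \<Longrightarrow> P \<omega> \<Longrightarrow> \<omega> \<in> S"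
  shows "pos_prob M S"
proof -
  obtain N where N: "{\<omega> \<in> space M. \<not> P \<omega>} \<subseteq> N" "emeasure M N = 0" "N \<in> sets M"
    using assms(1) by (rule AE_E)
  then have "prob (space M - N) = 1" using prob_compl[OF N(3)] by (simp add: emeasure_eq_measure)
  then show ?thesis unfolding pos_prob_def
    using N assms(2) by (intro bexI[of _ "space M - N"]) auto
qed

text \<open>\<open>S\<close> may be non-measurable, for instance as a union over uncountably many
  times or open sets; its measurable witness would be null if every \<open>A i\<close> were. In this
  way such an event yields one time in \<open>Q\<close> or one basic set.\<close>

lemma pos_prob_countable_UN:
  assumes "pos_prob M S" "countable I" "S \<subseteq> (\<Union>i\<in>I. A i)" "\<And>i. i \<in> I \<Longrightarrow> A i \<in> sets M"
  shows "\<exists>i\<in>I. 0 < prob (A i)"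
proof (rule ccontr)
  assume "\<not> ?thesis"
  then have z: "emeasure M (A i) = 0" if "i \<in> I" for i
    using that by (simp add: emeasure_eq_measure not_less measure_le_0_iff)
  obtain E where E: "E \<in> sets M" "E \<subseteq> S" "0 < prob E" using assms(1) by (auto simp: pos_prob_def)
  have "(\<Union>i\<in>I. A i) \<in> null_sets M"
    using z assms by (intro null_sets_UN') auto
  then have "emeasure M (\<Union>i\<in>I. A i) = 0" by auto
  then have "emeasure M E = 0"
    using E assms emeasure_mono[of E "\<Union>i\<in>I. A i" M] by (auto intro!: sets.countable_UN'')
  then show False using E by (simp add: emeasure_eq_measure)
qed

end

section \<open>The zero-one law and recurrence\<close>

context rds_ergodic
begin

text \<open>With \<open>s x = P(S\<^sub>x)\<close>, invariance and stationarity give \<open>P(S\<^sub>x | F\<^sub>0\<^sup>t) = s(\<phi>(t) x)\<close>, which approaches the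
  indicator of \<open>S\<^sub>x\<close> as \<open>t\<close> grows; as the law of \<open>s(\<phi>(t) x)\<close> does not depend on \<open>t\<close>, \<open>s\<close> is
  \<open>{0, 1}\<close>-valued, and then ergodicity of \<open>\<rho>\<close> applies to \<open>{s = 1}\<close>.\<close>

lemma zero_one:
  assumes S: "S \<in> sets (BX \<Otimes>\<^sub>M Fut)"
    and inv: "\<And>t x \<omega>. t \<in> Q \<Longrightarrow> x \<in> X \<Longrightarrow> \<omega> \<in> space M \<Longrightarrow> (\<phi> t \<omega> x, \<theta> t \<omega>) \<in> S \<Longrightarrow> (x, \<omega>) \<in> S"
  shows "(AE x in \<rho>. prob (Pair x -` S) = 1) \<or> (AE x in \<rho>. prob (Pair x -` S) = 0)"
proof -
  define s where "s x = prob (Pair x -` S)" for x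
  \<comment> \<open>\<open>R t x\<close> is the event \<open>S\<close> restarted at time
    \<open>t\<close>; by \<open>inv\<close> it lies inside the section of \<open>S\<close> at
    \<open>x\<close>.\<close>
  define R where "R t x = {\<omega> \<in> space M. (\<phi> t \<omega> x, \<theta> t \<omega>) \<in> S}" for t x
  have s_m: "s \<in> borel_measurable BX" unfolding s_def by (rule prob_section_measurable[OF S])
  have s_r[measurable]: "s \<in> borel_measurable \<rho>" using s_m by (simp cong: measurable_cong_sets)
  have s_b: "0 \<le> s x" "s x \<le> 1" for x by (auto simp: s_def)
  have Sx: "Pair x -` S \<in> sets M" for x using sets_Pair1[OF S] Fut_subset by blast
  have R_s: "R t x \<in> sets M" if "t \<in> Q" "x \<in> X" for t x
    unfolding R_def by (rule markov_sets[OF _ phi_Past S]) (use that Q_Tpos in auto)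
  have R_sub: "R t x \<subseteq> Pair x -` S" if "t \<in> Q" "x \<in> X" for t x
    using inv that by (auto simp: R_def)
  have mk: "prob (G \<inter> R t x) = (\<integral>\<omega>. indicator G \<omega> * s (\<phi> t \<omega> x) \<partial>M)"
    if "t \<in> Q" "x \<in> X" "G \<in> sets (Past t)" for t x G
  proof -
    have "G \<inter> R t x = {\<omega> \<in> G. (\<phi> t \<omega> x, \<theta> t \<omega>) \<in> S}"
      using sets.sets_into_space[OF that(3)] by (auto simp: R_def)
    then show ?thesis
      using markov_prob[OF Q_Tpos[OF that(1)] that(3) phi_Past[OF Q_Tpos[OF that(1)] that(2)] S]
      by (simp add: s_def)
  qed
  have mk1: "prob (R t x) = (\<integral>\<omega>. s (\<phi> t \<omega> x) \<partial>M)" if "t \<in> Q" "x \<in> X" for t x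
  proof -
    have "space M \<in> sets (Past t)" using sets.top[of "Past t"] by simp
    moreover have "space M \<inter> R t x = R t x" by (auto simp: R_def)
    ultimately have "prob (R t x) = (\<integral>\<omega>. indicator (space M) \<omega> * s (\<phi> t \<omega> x) \<partial>M)"
      using mk[OF that] by metis
    also have "\<dots> = (\<integral>\<omega>. s (\<phi> t \<omega> x) \<partial>M)" by (rule Bochner_Integration.integral_cong) auto
    finally show ?thesis .
  qed
  have fphi: "(\<lambda>\<omega>. f (\<phi> t \<omega> x)) \<in> borel_measurable M"
    if "f \<in> borel_measurable BX" "t \<in> Q" "x \<in> X" for f :: "'m \<Rightarrow> real" and t x
    by (rule measurable_compose[OF Fut_to_M[OF Past_to_Fut[OF _ phi_Past]] that(1)]) (use that Q_Tpos in auto)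
  have fint: "(\<lambda>x. \<integral>\<omega>. f (\<phi> t \<omega> x) \<partial>M) \<in> borel_measurable \<rho>"
    if "f \<in> borel_measurable BX" "t \<in> Q" for f :: "'m \<Rightarrow> real" and t
  proof (rule borel_measurable_lebesgue_integral)
    have "(\<lambda>p. f (\<phi> t (snd p) (fst p))) \<in> borel_measurable W"
      by (rule measurable_compose[OF phi_W[OF Q_Tpos[OF that(2)]]])
        (use that in \<open>simp cong: measurable_cong_sets\<close>)
    then show "(\<lambda>(x, \<omega>). f (\<phi> t \<omega> x)) \<in> borel_measurable W" by (simp add: case_prod_beta')
  qed
  have eq: "AE x in \<rho>. prob (R t x) = s x" if t: "t \<in> Q" for t
  proof -
    let ?p = "\<lambda>x. \<integral>\<omega>. s (\<phi> t \<omega> x) \<partial>M"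
    have ps: "0 \<le> ?p x \<and> ?p x \<le> s x" if "x \<in> X" for x
    proof
      show "0 \<le> ?p x" using s_b by simp
      show "?p x \<le> s x"
        using finite_measure_mono[OF R_sub[OF t that] Sx] mk1[OF t that] by (simp add: s_def)
    qed
    have ip: "integrable \<rho> ?p"
      by (rule rho.integrable_const_bound[of _ 1])
        (use ps order_trans[OF conjunct2[OF ps] s_b(2)] fint[OF s_m t] in \<open>auto intro!: AE_I2\<close>)
    have i_s: "integrable \<rho> s"
      by (rule rho.integrable_const_bound[of _ 1]) (use s_b in auto)
    \<comment> \<open>By stationarity the restarted event has the same average probability, so the
      pointwise inequality \<open>?p x \<le> s x\<close> is an equality almost everywhere.\<close>
    have "(\<integral>x. s x - ?p x \<partial>\<rho>) = 0"
      using Bochner_Integration.integral_diff[OF i_s ip] integral_phi[OF Q_Tpos[OF t] s_m] s_b by simp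
    moreover have "AE x in \<rho>. 0 \<le> s x - ?p x" by (rule AE_I2) (use ps in auto)
    ultimately have "AE x in \<rho>. s x - ?p x = 0"
      using integral_nonneg_eq_0_iff_AE[OF Bochner_Integration.integrable_diff[OF i_s ip]] by blast
    then show ?thesis using AE_space by eventually_elim (use mk1[OF t] in auto)
  qed
  \<comment> \<open>\<open>v\<close> vanishes exactly where \<open>s\<close> is 0 or 1. Along the
    flow its mean becomes small: with \<open>G\<close> a finite-time approximation of the section,
    \<open>v\<close> is at most \<open>1 - s\<close> on \<open>G\<close> and at most
    \<open>s\<close> off \<open>G\<close>. Averaged over \<open>\<rho>\<close>, that mean is
    constant in \<open>n\<close> by stationarity.\<close>
  define v where "v x = s x * (1 - s x)" for x
  have v_m: "v \<in> borel_measurable BX" unfolding v_def using s_m by measurable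
  have v_r: "v \<in> borel_measurable \<rho>" using v_m by (simp cong: measurable_cong_sets)
  have v_b: "0 \<le> v x" "v x \<le> 1" for x
    using s_b[of x] mult_mono[of "s x" 1 "1 - s x" 1] by (auto simp: v_def)
  have conv: "(\<lambda>n. \<integral>\<omega>. v (\<phi> (real n) \<omega> x) \<partial>M) \<longlonglongrightarrow> 0"
    if x: "x \<in> X" and e: "\<And>n. prob (R (real n) x) = s x" for x
  proof (rule LIMSEQ_I)
    fix r :: real assume "0 < r"
    let ?S = "Pair x -` S"
    obtain n0 G where G: "G \<in> sets (Past (real n0))" and d: "prob (?S - G) + prob (G - ?S) < r"
      using Fut_approx[OF sets_Pair1[OF S] \<open>0 < r\<close>] by blast
    have GM: "G \<in> sets M" using G Past_subset_Fut[OF Q_Tpos[OF Q_of_nat]] Fut_subset by blast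
    have "norm ((\<integral>\<omega>. v (\<phi> (real n) \<omega> x) \<partial>M) - 0) < r" if n: "n0 \<le> n" for n
    proof -
      let ?t = "real n"
      have Gn: "G \<in> sets (Past ?t)" "space M - G \<in> sets (Past ?t)"
        using G Past_mono[OF Q_Tpos[OF Q_of_nat] Q_Tpos[OF Q_of_nat], of n0 n] n
          sets.compl_sets[of G "Past ?t"] by auto
      note R = R_s[OF Q_of_nat x, of n] and RS = R_sub[OF Q_of_nat x, of n]
      have ms: "(\<lambda>\<omega>. s (\<phi> ?t \<omega> x)) \<in> borel_measurable M" by (rule fphi[OF s_m Q_of_nat x])
      have i: "integrable M (\<lambda>\<omega>. indicator H \<omega> * s (\<phi> ?t \<omega> x))" if "H \<in> sets M" for H
        by (rule integrable_const_bound[of _ 1]) (use that ms s_b in \<open>auto simp: indicator_def\<close>)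
      have "(\<integral>\<omega>. v (\<phi> ?t \<omega> x) \<partial>M)
          \<le> (\<integral>\<omega>. indicator G \<omega> - indicator G \<omega> * s (\<phi> ?t \<omega> x) + indicator (space M - G) \<omega> * s (\<phi> ?t \<omega> x) \<partial>M)"
      proof (rule integral_mono)
        show "integrable M (\<lambda>\<omega>. v (\<phi> ?t \<omega> x))"
          by (rule integrable_const_bound[of _ 1]) (use fphi[OF v_m Q_of_nat x] v_b in auto)
        show "integrable M (\<lambda>\<omega>. indicator G \<omega> - indicator G \<omega> * s (\<phi> ?t \<omega> x) + indicator (space M - G) \<omega> * s (\<phi> ?t \<omega> x))"
          using i GM by (intro Bochner_Integration.integrable_add Bochner_Integration.integrable_diff)
            (auto simp: emeasure_eq_measure)
        fix \<omega> assume "\<omega> \<in> space M"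
        then show "v (\<phi> ?t \<omega> x) \<le> indicator G \<omega> - indicator G \<omega> * s (\<phi> ?t \<omega> x) + indicator (space M - G) \<omega> * s (\<phi> ?t \<omega> x)"
          using s_b[of "\<phi> ?t \<omega> x"] mult_right_mono[of "s (\<phi> ?t \<omega> x)" 1 "1 - s (\<phi> ?t \<omega> x)"]
            mult_left_mono[of "1 - s (\<phi> ?t \<omega> x)" 1 "s (\<phi> ?t \<omega> x)"]
          by (auto simp: v_def indicator_def)
      qed
      also have "\<dots> = prob G - prob (G \<inter> R ?t x) + prob ((space M - G) \<inter> R ?t x)"
        unfolding mk[OF Q_of_nat x Gn(1)] mk[OF Q_of_nat x Gn(2)]
        using i GM by (simp add: emeasure_eq_measure)
      also have "prob G = prob (G - ?S) + prob (G \<inter> ?S)"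
        using finite_measure_Diff'[OF GM Sx[of x]] by simp
      also have "prob (G \<inter> ?S) \<le> prob ((G \<inter> R ?t x) \<union> (?S - R ?t x))"
        by (rule finite_measure_mono) (use GM R Sx in auto)
      also have "\<dots> \<le> prob (G \<inter> R ?t x) + prob (?S - R ?t x)"
        by (rule measure_Un_le) (use GM R Sx in auto)
      \<comment> \<open>Inclusion and equal probability make the section and the restarted event
        agree up to a null set.\<close>
      also have "prob (?S - R ?t x) = 0"
        using finite_measure_Diff[OF Sx R RS] e[of n] by (simp add: s_def)
      also have "prob ((space M - G) \<inter> R ?t x) \<le> prob (?S - G)"
        by (rule finite_measure_mono) (use GM R Sx RS in auto)
      finally have "(\<integral>\<omega>. v (\<phi> ?t \<omega> x) \<partial>M) \<le> prob (G - ?S) + prob (?S - G)" by simp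
      moreover have "0 \<le> (\<integral>\<omega>. v (\<phi> ?t \<omega> x) \<partial>M)" using v_b by simp
      ultimately show ?thesis using d by simp
    qed
    then show "\<exists>no. \<forall>n\<ge>no. norm ((\<integral>\<omega>. v (\<phi> (real n) \<omega> x) \<partial>M) - 0) < r" by blast
  qed
  have "AE x in \<rho>. \<forall>n. prob (R (real n) x) = s x"
    unfolding AE_all_countable using eq[OF Q_of_nat] by blast
  then have AEconv: "AE x in \<rho>. (\<lambda>n. \<integral>\<omega>. v (\<phi> (real n) \<omega> x) \<partial>M) \<longlonglongrightarrow> 0"
    using AE_space by eventually_elim (use conv in auto)
  have "(\<lambda>n. \<integral>x. (\<integral>\<omega>. v (\<phi> (real n) \<omega> x) \<partial>M) \<partial>\<rho>) \<longlonglongrightarrow> (\<integral>x. 0 \<partial>\<rho>)"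
  proof (rule integral_dominated_convergence[where w = "\<lambda>_. 1"])
    show "AE x in \<rho>. norm (\<integral>\<omega>. v (\<phi> (real n) \<omega> x) \<partial>M) \<le> 1" for n
    proof (rule AE_I2)
      fix x assume "x \<in> space \<rho>"
      have "(\<integral>\<omega>. v (\<phi> (real n) \<omega> x) \<partial>M) \<le> 1"
        by (rule integral_le_const)
          (use v_b fphi[OF v_m Q_of_nat] \<open>x \<in> space \<rho>\<close> in \<open>auto intro!: integrable_const_bound[of _ 1]\<close>)
      then show "norm (\<integral>\<omega>. v (\<phi> (real n) \<omega> x) \<partial>M) \<le> 1" using v_b by simp
    qed
  qed (use AEconv fint[OF v_m Q_of_nat] in auto)
  then have "(\<integral>x. v x \<partial>\<rho>) = 0"
    using integral_phi[OF Q_Tpos[OF Q_of_nat] v_m] v_b by (simp add: LIMSEQ_const_iff)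
  moreover have "integrable \<rho> v"
    by (rule rho.integrable_const_bound[of _ 1]) (use v_r v_b in auto)
  ultimately have "AE x in \<rho>. v x = 0"
    using integral_nonneg_eq_0_iff_AE[of \<rho> v] v_b by auto
  then have s01: "AE x in \<rho>. s x = 0 \<or> s x = 1"
    by eventually_elim (auto simp: v_def)
  define B where "B = {x \<in> space \<rho>. s x = 1}"
  have B: "B \<in> sets \<rho>" unfolding B_def by measurable
  have "measure \<rho> B = 0 \<or> measure \<rho> B = 1"
  proof (rule ergodic_Q[OF B])
    fix q assume q: "q \<in> Q"
    show "AE x in \<rho>. trans_prob M \<phi> q x B = indicator B x"
      using eq[OF q] AE_phi[OF Q_Tpos[OF q] s01] s01 AE_space
    proof eventually_elim
      case (elim x)
      have x: "x \<in> X" using elim by simp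
      have "s x = (\<integral>\<omega>. s (\<phi> q \<omega> x) \<partial>M)" using elim(1) mk1[OF q x] by simp
      \<comment> \<open>At almost every point reached, \<open>s\<close> is 0 or 1, so
        \<open>s (\<phi> q \<omega> x)\<close> is the indicator of arriving in
        \<open>B\<close>.\<close>
      also have "\<dots> = (\<integral>\<omega>. indicator {\<omega> \<in> space M. \<phi> q \<omega> x \<in> B} \<omega> \<partial>M)"
      proof (rule integral_cong_AE)
        show "AE \<omega> in M. s (\<phi> q \<omega> x) = indicator {\<omega> \<in> space M. \<phi> q \<omega> x \<in> B} \<omega>"
          using elim(2) AE_space
          by eventually_elim (use phi_in[OF Q_Tpos[OF q] _ x] in \<open>auto simp: B_def\<close>)
      qed (use fphi[OF s_m q x] phi_section_sets[OF Q_Tpos[OF q] B x] in auto)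
      also have "\<dots> = trans_prob M \<phi> q x B"
        using phi_section_sets[OF Q_Tpos[OF q] B x] by (simp add: trans_prob_def)
      finally show ?case using elim(3) x by (auto simp: B_def indicator_def)
    qed
  qed
  then show ?thesis
  proof
    assume "measure \<rho> B = 1"
    then have "AE x in \<rho>. x \<in> B" using rho.prob_eq_1[OF B] by simp
    then have "AE x in \<rho>. s x = 1" by eventually_elim (simp add: B_def)
    then show ?thesis by (simp add: s_def)
  next
    assume "measure \<rho> B = 0"
    then have "AE x in \<rho>. x \<notin> B" using rho.prob_eq_0[OF B] by simp
    then have "AE x in \<rho>. s x = 0" using s01 AE_space by eventually_elim (auto simp: B_def)
    then show ?thesis by (simp add: s_def)
  qed
qed

lemma zero_one_AE:
  assumes S: "S \<in> sets (BX \<Otimes>\<^sub>M Fut)"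
    and inv: "\<And>t x \<omega>. t \<in> Q \<Longrightarrow> x \<in> X \<Longrightarrow> \<omega> \<in> space M \<Longrightarrow> (\<phi> t \<omega> x, \<theta> t \<omega>) \<in> S \<Longrightarrow> (x, \<omega>) \<in> S"
    and pos: "A \<in> sets \<rho>" "0 < measure \<rho> A" "\<And>x. x \<in> A \<Longrightarrow> 0 < prob (Pair x -` S)"
  shows "AE x in \<rho>. AE \<omega> in M. (x, \<omega>) \<in> S"
proof -
  have "\<not> (AE x in \<rho>. prob (Pair x -` S) = 0)"
  proof
    assume "AE x in \<rho>. prob (Pair x -` S) = 0"
    then have "AE x in \<rho>. x \<notin> A" by eventually_elim (use pos(3) in force)
    then show False using rho.prob_eq_0[OF pos(1)] pos(2) by simp
  qed
  then have "AE x in \<rho>. prob (Pair x -` S) = 1" using zero_one[OF S] inv by metis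
  then show ?thesis
  proof eventually_elim
    case (elim x)
    have "Pair x -` S \<in> sets M" using sets_Pair1[OF S] Fut_subset by blast
    then show ?case using prob_eq_1 elim by auto
  qed
qed

text \<open>A visit after time \<open>n\<close> remains one when a piece of trajectory is prepended,
  so the zero-one law applies. For a non-null set of starting points a visit at time
  \<open>n\<close> itself already has positive probability, because stationarity gives
  \<open>A\<close> its full mass \<open>measure \<rho> A\<close> at that time.\<close>

lemma recurrence:
  assumes A: "A \<in> sets \<rho>" "0 < measure \<rho> A"
  shows "AE x in \<rho>. AE \<omega> in M. \<exists>t\<in>Q. real n \<le> t \<and> \<phi> t \<omega> x \<in> A"
proof -
  let ?S = "\<Union>t\<in>{t \<in> Q. real n \<le> t}. {p \<in> space (BX \<Otimes>\<^sub>M Fut). \<phi> t (snd p) (fst p) \<in> A}"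
  have S: "?S \<in> sets (BX \<Otimes>\<^sub>M Fut)"
  proof (rule sets.countable_UN'')
    show "countable {t \<in> Q. real n \<le> t}" using countable_subset[OF _ countable_Q] by auto
    fix t assume "t \<in> {t \<in> Q. real n \<le> t}"
    then show "{p \<in> space (BX \<Otimes>\<^sub>M Fut). \<phi> t (snd p) (fst p) \<in> A} \<in> sets (BX \<Otimes>\<^sub>M Fut)"
      using measurable_sets[OF phi_joint_Fut[OF Q_Tpos], of t A] A(1)
      by (simp add: sets_rho vimage_def Int_def conj_commute case_prod_beta')
  qed
  have inv: "(x, \<omega>) \<in> ?S" if t: "t \<in> Q" "x \<in> X" "\<omega> \<in> space M" "(\<phi> t \<omega> x, \<theta> t \<omega>) \<in> ?S" for t x \<omega>
  proof -
    obtain u where u: "u \<in> Q" "real n \<le> u" "\<phi> u (\<theta> t \<omega>) (\<phi> t \<omega> x) \<in> A" using t(4) by auto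
    then have "\<phi> (t + u) \<omega> x \<in> A" using cocycle[of t u \<omega> x] Q_Tpos t by auto
    moreover have "t + u \<in> Q" "real n \<le> t + u" using Q_add Q_nonneg[OF t(1)] t u by auto
    ultimately show ?thesis using t by (auto simp: space_pair_measure)
  qed
  let ?B = "{x \<in> space \<rho>. 0 < trans_prob M \<phi> (real n) x A}"
  note n = Q_Tpos[OF Q_of_nat, of n]
  have B: "?B \<in> sets \<rho>" using trans_prob_measurable[OF n A(1)] by measurable
  have "measure \<rho> ?B \<noteq> 0"
  proof
    assume "measure \<rho> ?B = 0"
    then have "AE x in \<rho>. x \<notin> ?B" using rho.prob_eq_0[OF B] by simp
    then have "AE x in \<rho>. trans_prob M \<phi> (real n) x A = 0"
      using AE_space by eventually_elim (auto simp: less_le trans_prob_bounds)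
    then have "(\<integral>x. trans_prob M \<phi> (real n) x A \<partial>\<rho>) = 0" by (rule integral_eq_zero_AE)
    then show False using stationary_rho[OF n A(1)] A(2) by simp
  qed
  then have "0 < measure \<rho> ?B" by (simp add: zero_less_measure_iff)
  moreover have "0 < prob (Pair x -` ?S)" if "x \<in> ?B" for x
  proof -
    have x: "x \<in> X" using that by simp
    have "0 < prob {\<omega> \<in> space M. \<phi> (real n) \<omega> x \<in> A}" using that by (simp add: trans_prob_def)
    also have "\<dots> \<le> prob (Pair x -` ?S)"
    proof (rule finite_measure_mono)
      show "{\<omega> \<in> space M. \<phi> (real n) \<omega> x \<in> A} \<subseteq> Pair x -` ?S"
        using x Q_of_nat[of n] by (auto simp: space_pair_measure)
      show "Pair x -` ?S \<in> sets M" using sets_Pair1[OF S] Fut_subset by blast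
    qed
    finally show ?thesis .
  qed
  ultimately have "AE x in \<rho>. AE \<omega> in M. (x, \<omega>) \<in> ?S"
    by (intro zero_one_AE[OF S _ B]) (rule inv)
  then show ?thesis
  proof eventually_elim
    case (elim x)
    then show ?case by eventually_elim auto
  qed
qed

section \<open>Typical starting points: recurrence, support, transitivity, stability\<close>

lemma BB_sets: "B \<in> BB \<Longrightarrow> B \<in> sets \<rho>"
  using openin_sets[OF BB_open] sets_rho by simp

lemma recurrence_BB:
  "AE x in \<rho>. AE \<omega> in M. \<forall>B\<in>BB. 0 < measure \<rho> B \<longrightarrow> (\<forall>n::nat. \<exists>t\<in>Q. real n \<le> t \<and> \<phi> t \<omega> x \<in> B)"
proof -
  have "AE x in \<rho>. AE \<omega> in M. 0 < measure \<rho> B \<longrightarrow> (\<exists>t\<in>Q. real n \<le> t \<and> \<phi> t \<omega> x \<in> B)" if "B \<in> BB" for B n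
    using recurrence[OF BB_sets[OF that], of n] by (cases "0 < measure \<rho> B") auto
  then have "AE x in \<rho>. \<forall>B\<in>BB. \<forall>n::nat. AE \<omega> in M. 0 < measure \<rho> B \<longrightarrow> (\<exists>t\<in>Q. real n \<le> t \<and> \<phi> t \<omega> x \<in> B)"
    by (simp add: AE_ball_countable[OF countable_BB] AE_all_countable)
  then show ?thesis
  proof eventually_elim
    case (elim x)
    then have "AE \<omega> in M. \<forall>B\<in>BB. \<forall>n::nat. 0 < measure \<rho> B \<longrightarrow> (\<exists>t\<in>Q. real n \<le> t \<and> \<phi> t \<omega> x \<in> B)"
      by (simp add: AE_ball_countable[OF countable_BB] AE_all_countable)
    then show ?case by eventually_elim blast
  qed
qed

text \<open>Basic sets lying in \<open>U\<close> with some margin cover \<open>U\<close>, and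
  countably many null sets cannot, so one of them has positive measure. The margin
  \<open>\<delta>\<close> puts into \<open>U\<close> also a trajectory that is merely close to one
  in \<open>B\<close>.\<close>

lemma pos_measure_BB:
  assumes U: "openin (top_of_set X) U" "0 < measure \<rho> U"
  shows "\<exists>B\<in>BB. B \<subseteq> U \<and> 0 < measure \<rho> B \<and> (\<exists>\<delta>>0. \<forall>z\<in>B. ball z \<delta> \<inter> X \<subseteq> U)"
proof (rule ccontr)
  assume *: "\<not> ?thesis"
  define I where "I = {B \<in> BB. B \<subseteq> U \<and> (\<exists>\<delta>>0. \<forall>z\<in>B. ball z \<delta> \<inter> X \<subseteq> U)}"
  have z: "emeasure \<rho> B = 0" if "B \<in> I" for B
  proof -
    have "\<not> 0 < measure \<rho> B" using that * unfolding I_def by blast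
    then show ?thesis by (simp add: rho.emeasure_eq_measure zero_less_measure_iff)
  qed
  have "U \<subseteq> (\<Union>B\<in>I. B)"
  proof
    fix u assume u: "u \<in> U"
    obtain V where V: "open V" "U = X \<inter> V" using U(1) by (auto simp: openin_open)
    then obtain e where e: "0 < e" "ball u e \<subseteq> V" using u open_contains_ball by blast
    have "openin (top_of_set X) (X \<inter> ball u (e/2))" by auto
    moreover have "u \<in> X \<inter> ball u (e/2)" using u V e by auto
    ultimately obtain B where B: "B \<in> BB" "u \<in> B" "B \<subseteq> X \<inter> ball u (e/2)" using BB_base by blast
    have "ball z (e/2) \<inter> X \<subseteq> U" if "z \<in> B" for z
    proof
      fix y assume y: "y \<in> ball z (e/2) \<inter> X"
      have "dist u z < e/2" using B(3) that by auto
      then have "dist u y < e" using y dist_triangle[of u y z] by auto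
      then show "y \<in> U" using e V y by auto
    qed
    moreover have "B \<subseteq> U" using B(3) e V subset_ball[of "e/2" e u] by auto
    ultimately have "B \<in> I" using B(1) e(1) unfolding I_def by (auto intro!: exI[of _ "e/2"])
    then show "u \<in> (\<Union>B\<in>I. B)" using B(2) by blast
  qed
  then have "U = (\<Union>B\<in>I. B)" by (auto simp: I_def)
  moreover have "(\<Union>B\<in>I. B) \<in> null_sets \<rho>"
  proof (rule null_sets_UN')
    show "countable I" using countable_subset[OF _ countable_BB] by (auto simp: I_def)
  qed (use z BB_sets in \<open>auto simp: I_def\<close>)
  ultimately have "U \<in> null_sets \<rho>" by metis
  then show False using U(2) by (auto simp: rho.emeasure_eq_measure)
qed

lemma AE_supp: "AE x in \<rho>. x \<in> supp X \<rho>"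
proof -
  have "AE x in \<rho>. \<forall>B\<in>BB. measure \<rho> B = 0 \<longrightarrow> x \<notin> B"
    using rho.prob_eq_0[OF BB_sets] by (simp add: AE_ball_countable[OF countable_BB])
  then show ?thesis using AE_space
  proof eventually_elim
    case (elim x)
    have "0 < measure \<rho> U" if U: "openin (top_of_set X) U" "x \<in> U" for U
    proof -
      obtain B where B: "B \<in> BB" "x \<in> B" "B \<subseteq> U" using BB_base[OF U] by blast
      then have "0 < measure \<rho> B" using elim zero_less_measure_iff by metis
      also have "\<dots> \<le> measure \<rho> U"
        by (rule rho.finite_measure_mono) (use B openin_sets[OF U(1)] sets_rho in auto)
      finally show ?thesis .
    qed
    then show ?case using elim by (simp add: supp_def)
  qed
qed

lemma AE_transitive: "AE x in \<rho>. x \<in> transitive_pts T M X \<phi> \<rho>"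
  using recurrence_BB AE_supp
proof eventually_elim
  case (elim x)
  have "pos_prob M {\<omega> \<in> space M. \<exists>t\<in>Tpos T. \<phi> t \<omega> x \<in> U}"
    if U: "openin (top_of_set X) U" "0 < measure \<rho> U" for U
  proof -
    obtain B where B: "B \<in> BB" "B \<subseteq> U" "0 < measure \<rho> B" using pos_measure_BB[OF U] by blast
    show ?thesis by (rule AE_pos_prob[OF elim(1)]) (use B Q_Tpos in blast)
  qed
  then show ?case using elim(2) by (simp add: transitive_pts_def)
qed

text \<open>The contracting open set depends on \<open>\<omega>\<close>. Shrinking it to a basic set
  around a point of the support leaves countably many candidates, one of which works with positive
  probability.\<close>

lemma stable_basic:
  assumes "stable_wrt T M X \<phi> \<rho>"
  shows "\<exists>B\<in>BB. 0 < measure \<rho> B \<and> 0 < prob {\<omega> \<in> space M. contracts T \<phi> B \<omega>}"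
proof -
  let ?I = "{B \<in> BB. 0 < measure \<rho> B}"
  have "\<exists>B\<in>?I. 0 < prob {\<omega> \<in> space M. contracts T \<phi> B \<omega>}"
  proof (rule pos_prob_countable_UN[OF assms[unfolded stable_wrt_def]])
    show "countable ?I" using countable_subset[OF _ countable_BB] by auto
    show "{\<omega> \<in> space M. contracts T \<phi> B \<omega>} \<in> sets M" if "B \<in> ?I" for B
      using contracts_sets[OF BB_open] that Fut_subset by auto
    show "{\<omega> \<in> space M. \<exists>U. openin (top_of_set X) U \<and> U \<inter> supp X \<rho> \<noteq> {} \<and> contracts T \<phi> U \<omega>}
        \<subseteq> (\<Union>B\<in>?I. {\<omega> \<in> space M. contracts T \<phi> B \<omega>})"
    proof
      fix \<omega> assume "\<omega> \<in> {\<omega> \<in> space M. \<exists>U. openin (top_of_set X) U \<and> U \<inter> supp X \<rho> \<noteq> {} \<and> contracts T \<phi> U \<omega>}"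
      then obtain U x where U: "\<omega> \<in> space M" "openin (top_of_set X) U" "x \<in> U" "x \<in> supp X \<rho>" "contracts T \<phi> U \<omega>"
        by blast
      then obtain B where B: "B \<in> BB" "x \<in> B" "B \<subseteq> U" using BB_base by blast
      then have "0 < measure \<rho> B" using U(4) BB_open unfolding supp_def by blast
      then show "\<omega> \<in> (\<Union>B\<in>?I. {\<omega> \<in> space M. contracts T \<phi> B \<omega>})"
        using B U contracts_mono by blast
    qed
  qed
  then show ?thesis by blast
qed

text \<open>The preimage under the continuous map \<open>\<phi> t \<omega>\<close> of a set
  contracting under \<open>\<theta> t \<omega>\<close> contracts under \<open>\<omega>\<close>, so
  having a contracting neighbourhood is an event for the zero-one law. Points of the set from
  \<open>stable_basic\<close> have one with positive probability.\<close>

lemma AE_stable: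
  assumes "stable_wrt T M X \<phi> \<rho>"
  shows "AE x in \<rho>. AE \<omega> in M. \<exists>B\<in>BB. x \<in> B \<and> contracts T \<phi> B \<omega>"
proof -
  let ?C = "\<lambda>B. {\<omega> \<in> space M. contracts T \<phi> B \<omega>}"
  let ?S = "\<Union>B\<in>BB. B \<times> ?C B"
  obtain B0 where B0: "B0 \<in> BB" "0 < measure \<rho> B0" "0 < prob (?C B0)" using stable_basic[OF assms] by blast
  have S: "?S \<in> sets (BX \<Otimes>\<^sub>M Fut)"
    by (rule sets.countable_UN''[OF countable_BB])
      (auto intro!: pair_measureI contracts_sets openin_sets BB_open)
  have inv: "(x, \<omega>) \<in> ?S" if t: "t \<in> Q" "x \<in> X" "\<omega> \<in> space M" "(\<phi> t \<omega> x, \<theta> t \<omega>) \<in> ?S" for t x \<omega>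
  proof -
    obtain B where B: "B \<in> BB" "\<phi> t \<omega> x \<in> B" "\<theta> t \<omega> \<in> space M" "contracts T \<phi> B (\<theta> t \<omega>)" using t(4) by auto
    have BX: "B \<subseteq> X" using openin_imp_subset[OF BB_open[OF B(1)]] .
    let ?U = "{y \<in> X. \<phi> t \<omega> y \<in> B}"
    have "?U = X \<inter> \<phi> t \<omega> -` B" by auto
    then have U: "openin (top_of_set X) ?U"
      using continuous_openin_preimage[OF phi_continuous[OF Q_Tpos[OF t(1)] t(3)] _ BB_open[OF B(1)]]
        phi_in[OF Q_Tpos[OF t(1)] t(3)] by auto
    have "contracts_rat B (\<theta> t \<omega>)" using contracts_iff_dense[of "\<theta> t \<omega>" B B] B BX closure_subset by auto
    then have "contracts_rat (\<phi> t \<omega> ` ?U) (\<theta> t \<omega>)" by (rule contracts_rat_mono) auto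
    then have "contracts_rat ?U \<omega>" by (intro contracts_rat_shift[OF t(1) t(3)]) auto
    then have "contracts T \<phi> ?U \<omega>" using contracts_iff_dense[of \<omega> ?U ?U] t(3) closure_subset[of ?U] by auto
    moreover obtain B' where "B' \<in> BB" "x \<in> B'" "B' \<subseteq> ?U" using BB_base[OF U, of x] t B by auto
    ultimately show ?thesis using t(3) contracts_mono by blast
  qed
  have "0 < prob (Pair x -` ?S)" if "x \<in> B0" for x
  proof -
    have "prob (?C B0) \<le> prob (Pair x -` ?S)"
    proof (rule finite_measure_mono)
      show "?C B0 \<subseteq> Pair x -` ?S" using that B0(1) by blast
      show "Pair x -` ?S \<in> sets M" using sets_Pair1[OF S] Fut_subset by blast
    qed
    then show ?thesis using B0 by simp
  qed
  then have "AE x in \<rho>. AE \<omega> in M. (x, \<omega>) \<in> ?S"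
    by (intro zero_one_AE[OF S _ BB_sets[OF B0(1)] B0(2)]) (rule inv)
  then show ?thesis
  proof eventually_elim
    case (elim x)
    then show ?case by eventually_elim auto
  qed
qed

end

section \<open>Contracting pairs\<close>

context rds
begin

text \<open>The two balls contract as one set, so they also approach each other. The radius is
  existential: shrinking it makes the condition open in \<open>(x, y)\<close>, and only
  \<open>\<epsilon>\<close> has to be uniform on compact sets.\<close>

definition contracting_pair :: "real \<Rightarrow> 'm \<Rightarrow> 'm \<Rightarrow> bool" where
  "contracting_pair \<epsilon> x y \<longleftrightarrow> (\<exists>r>0. \<exists>E\<in>sets M. \<epsilon> \<le> prob E \<and>
     (\<forall>\<omega>\<in>E. contracts T \<phi> ((ball x r \<union> ball y r) \<inter> X) \<omega>))"

lemma contracting_pair_mono: "contracting_pair \<epsilon> x y \<Longrightarrow> \<epsilon>' \<le> \<epsilon> \<Longrightarrow> contracting_pair \<epsilon>' x y"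
  unfolding contracting_pair_def by (meson order_trans)

lemma open_contracting_pair: "open {p. contracting_pair \<epsilon> (fst p) (snd p)}"
  unfolding open_contains_ball
proof
  fix p assume "p \<in> {p. contracting_pair \<epsilon> (fst p) (snd p)}"
  then obtain r E where r: "0 < r" "E \<in> sets M" "\<epsilon> \<le> prob E"
    and c: "\<And>\<omega>. \<omega> \<in> E \<Longrightarrow> contracts T \<phi> ((ball (fst p) r \<union> ball (snd p) r) \<inter> X) \<omega>"
    by (auto simp: contracting_pair_def)
  have "contracting_pair \<epsilon> (fst q) (snd q)" if q: "q \<in> ball p (r/2)" for q
  proof -
    have d: "dist (fst p) (fst q) < r/2" "dist (snd p) (snd q) < r/2"
      using q dist_fst_le[of p q] dist_snd_le[of p q] by auto
    have "ball (fst q) (r/2) \<subseteq> ball (fst p) r"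
    proof
      fix z assume "z \<in> ball (fst q) (r/2)"
      then show "z \<in> ball (fst p) r" using d(1) dist_triangle[of "fst p" z "fst q"] by simp
    qed
    moreover have "ball (snd q) (r/2) \<subseteq> ball (snd p) r"
    proof
      fix z assume "z \<in> ball (snd q) (r/2)"
      then show "z \<in> ball (snd p) r" using d(2) dist_triangle[of "snd p" z "snd q"] by simp
    qed
    ultimately have "(ball (fst q) (r/2) \<union> ball (snd q) (r/2)) \<inter> X \<subseteq> (ball (fst p) r \<union> ball (snd p) r) \<inter> X"
      by blast
    then have "\<forall>\<omega>\<in>E. contracts T \<phi> ((ball (fst q) (r/2) \<union> ball (snd q) (r/2)) \<inter> X) \<omega>"
      using c contracts_mono by blast
    then show ?thesis unfolding contracting_pair_def using r by (intro exI[of _ "r/2"]) auto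
  qed
  then show "\<exists>e>0. ball p e \<subseteq> {p. contracting_pair \<epsilon> (fst p) (snd p)}" using r(1) by (intro exI[of _ "r/2"]) auto
qed

text \<open>The conditions with threshold \<open>1 / real (Suc n)\<close> are open and weaken as
  \<open>n\<close> grows, so a finite subcover is dominated by its largest index.\<close>

lemma contracting_pair_on_compact:
  assumes K: "compact K1" "compact K2" and g: "\<And>x y. x \<in> K1 \<Longrightarrow> y \<in> K2 \<Longrightarrow> \<exists>\<epsilon>>0. contracting_pair \<epsilon> x y"
  shows "\<exists>\<epsilon>>0. \<forall>x\<in>K1. \<forall>y\<in>K2. contracting_pair \<epsilon> x y"
proof -
  let ?O = "\<lambda>n::nat. {p. contracting_pair (1 / real (Suc n)) (fst p) (snd p)}"
  have "K1 \<times> K2 \<subseteq> (\<Union>n\<in>UNIV. ?O n)"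
  proof safe
    fix x y assume "x \<in> K1" "y \<in> K2"
    then obtain \<epsilon> where e: "0 < \<epsilon>" "contracting_pair \<epsilon> x y" using g by blast
    then obtain n where "1 / real (Suc n) < \<epsilon>" using nat_approx_posE by blast
    then have "contracting_pair (1 / real (Suc n)) x y" using contracting_pair_mono[OF e(2)] by simp
    then show "(x, y) \<in> (\<Union>n\<in>UNIV. ?O n)" by auto
  qed
  then obtain N where N: "finite N" "K1 \<times> K2 \<subseteq> (\<Union>n\<in>N. ?O n)"
    by (rule compactE_image[OF compact_Times[OF K] open_contracting_pair])
  define m where "m = Max (insert 0 N)"
  have "contracting_pair (1 / real (Suc m)) x y" if "x \<in> K1" "y \<in> K2" for x y
  proof -
    have "(x, y) \<in> (\<Union>n\<in>N. ?O n)" using N(2) that by (simp only: subset_iff mem_Times_iff fst_conv snd_conv)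
    then obtain n where n: "n \<in> N" "contracting_pair (1 / real (Suc n)) x y" by auto
    have "n \<le> m" using n N(1) by (simp add: m_def)
    then have "1 / real (Suc m) \<le> 1 / real (Suc n)" by (intro divide_left_mono) auto
    then show ?thesis by (rule contracting_pair_mono[OF n(2)])
  qed
  then show ?thesis by (intro exI[of _ "1 / real (Suc m)"]) auto
qed

lemma sync_section_sets:
  assumes "x \<in> X" "y \<in> X"
  shows "{\<omega> \<in> space M. sync \<omega> x y} \<in> sets Fut"
proof -
  have "Pair (x, y) -` {p \<in> space ((BX \<Otimes>\<^sub>M BX) \<Otimes>\<^sub>M Fut). sync (snd p) (fst (fst p)) (snd (fst p))}
      = {\<omega> \<in> space M. sync \<omega> x y}"
    using assms by (auto simp: space_pair_measure)
  then show ?thesis using sets_Pair1[OF sync_sets, of "(x, y)"] by simp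
qed

lemma contracting_pair_sync:
  assumes xy: "x \<in> X" "y \<in> X" and g: "contracting_pair \<epsilon> x y"
  shows "\<epsilon> \<le> prob {\<omega> \<in> space M. sync \<omega> x y}"
proof -
  obtain r E where r: "0 < r" "E \<in> sets M" "\<epsilon> \<le> prob E"
    and c: "\<And>\<omega>. \<omega> \<in> E \<Longrightarrow> contracts T \<phi> ((ball x r \<union> ball y r) \<inter> X) \<omega>"
    using g by (auto simp: contracting_pair_def)
  have "prob E \<le> prob {\<omega> \<in> space M. sync \<omega> x y}"
  proof (rule finite_measure_mono)
    show "E \<subseteq> {\<omega> \<in> space M. sync \<omega> x y}"
    proof
      fix \<omega> assume w: "\<omega> \<in> E"
      then have "\<omega> \<in> space M" using r(2) sets.sets_into_space by blast
      then show "\<omega> \<in> {\<omega> \<in> space M. sync \<omega> x y}"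
        using contracts_sync[OF _ _ c[OF w], of x y] r(1) xy by simp
    qed
  qed (use sync_section_sets[OF xy] Fut_subset in auto)
  then show ?thesis using r by simp
qed

lemma phi_set_Past:
  assumes "t \<in> Tpos T" "x \<in> X" "B \<in> sets BX"
  shows "{\<omega> \<in> space M. \<phi> t \<omega> x \<in> B} \<in> sets (Past t)"
  using measurable_sets[OF phi_Past[OF assms(1,2)] assms(3)] by (simp add: vimage_def Int_def conj_commute)

text \<open>This is the Markov property with a one-point state \<open>Z\<close>.\<close>

lemma prob_indep:
  assumes t: "t \<in> Tpos T" and G: "G \<in> sets (Past t)" and C: "C \<in> sets Fut"
  shows "prob (G \<inter> \<theta> t -` C) = prob G * prob C"
proof -
  have GM: "G \<in> sets M" using G Past_subset_Fut[OF t] Fut_subset by blast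
  have H: "UNIV \<times> C \<in> sets (count_space (UNIV :: unit set) \<Otimes>\<^sub>M Fut)" using C by (intro pair_measureI) auto
  have Z: "(\<lambda>_. ()) \<in> Past t \<rightarrow>\<^sub>M count_space UNIV" by simp
  have "G \<inter> \<theta> t -` C = {\<omega> \<in> G. ((), \<theta> t \<omega>) \<in> UNIV \<times> C}" by auto
  then have "prob (G \<inter> \<theta> t -` C) = (\<integral>\<omega>. indicator G \<omega> * prob (Pair () -` (UNIV \<times> C)) \<partial>M)"
    using markov_prob[OF t G Z H] by (simp only:)
  also have "Pair () -` (UNIV \<times> C) = C" by auto
  finally show ?thesis using GM by simp
qed

text \<open>Joint visits to a set that contracts with positive probability propagate backwards to whole neighbourhoods of the
  starting points.\<close>

lemma visit_contracting_pair:
  assumes xy: "x \<in> X" "y \<in> X" and t: "t \<in> Q" and B: "B \<in> BB"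
    and v: "0 < prob {\<omega> \<in> space M. \<phi> t \<omega> x \<in> B \<and> \<phi> t \<omega> y \<in> B}"
    and c: "0 < prob {\<omega> \<in> space M. contracts T \<phi> B \<omega>}"
  shows "\<exists>\<epsilon>>0. contracting_pair \<epsilon> x y"
proof -
  let ?r = "\<lambda>m. 1 / real (Suc m)"
  let ?V = "{\<omega> \<in> space M. \<phi> t \<omega> x \<in> B \<and> \<phi> t \<omega> y \<in> B}"
  define A where "A m = (ball x (?r m) \<union> ball y (?r m)) \<inter> X" for m
  \<comment> \<open>Testing only points of \<open>D\<close> places \<open>E m\<close> in
    \<open>Past t\<close>, independent of the contraction of \<open>B\<close> under the shifted
    noise. These points suffice by \<open>contracts_iff\<close>.\<close>
  define E where "E m = {\<omega> \<in> space M. \<forall>d\<in>A m \<inter> D. \<phi> t \<omega> d \<in> B}" for m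
  have tp: "t \<in> Tpos T" using Q_Tpos[OF t] .
  have Bs: "B \<in> sets BX" using openin_sets[OF BB_open[OF B]] .
  have Ao: "openin (top_of_set X) (A m)" for m
    unfolding A_def by (subst Int_commute) (intro openin_open_Int open_Un open_ball)
  have Es: "E m \<in> sets (Past t)" for m
  proof -
    have "{\<omega> \<in> space (Past t). \<forall>d\<in>A m \<inter> D. \<phi> t \<omega> d \<in> B} \<in> sets (Past t)"
      by (rule sets.sets_Collect_countable_All')
        (use phi_set_Past[OF tp _ Bs] countable_subset[OF _ countable_D] in \<open>auto simp: A_def\<close>)
    then show ?thesis by (simp add: E_def)
  qed
  have EM: "E m \<in> sets M" for m using Es Past_subset_Fut[OF tp] Fut_subset by blast
  have "?V = {\<omega> \<in> space M. \<phi> t \<omega> x \<in> B} \<inter> {\<omega> \<in> space M. \<phi> t \<omega> y \<in> B}" by auto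
  also have "\<dots> \<in> sets M"
    using phi_set_Past[OF tp _ Bs] xy Past_subset_Fut[OF tp] Fut_subset by blast
  finally have "pos_prob M ?V" using v unfolding pos_prob_def by blast
  moreover have "?V \<subseteq> (\<Union>m\<in>UNIV. E m)"
  proof
    fix \<omega> assume w: "\<omega> \<in> ?V"
    let ?U = "X \<inter> \<phi> t \<omega> -` B"
    have "openin (top_of_set X) ?U"
      using continuous_openin_preimage[OF phi_continuous[OF tp] _ BB_open[OF B]] w phi_in[OF tp] by auto
    then obtain U where U: "open U" "?U = X \<inter> U" by (auto simp: openin_open)
    then have "x \<in> U" "y \<in> U" using w xy by auto
    then obtain e1 e2 where e: "0 < e1" "ball x e1 \<subseteq> U" "0 < e2" "ball y e2 \<subseteq> U"
      using U(1) open_contains_ball by metis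
    obtain m where m: "?r m < min e1 e2" using nat_approx_posE[of "min e1 e2"] e by auto
    have "A m \<subseteq> X \<inter> U"
    proof
      fix z assume "z \<in> A m"
      then have "z \<in> X" "z \<in> ball x e1 \<or> z \<in> ball y e2" using m by (auto simp: A_def)
      then show "z \<in> X \<inter> U" using e by blast
    qed
    then have "\<omega> \<in> E m" using w U(2) by (auto simp: E_def)
    then show "\<omega> \<in> (\<Union>m\<in>UNIV. E m)" by blast
  qed
  ultimately obtain m where m: "0 < prob (E m)"
    using pos_prob_countable_UN[of ?V UNIV E] EM by auto
  let ?C = "{\<omega> \<in> space M. contracts T \<phi> B \<omega>}"
  have Cs: "?C \<in> sets Fut" by (rule contracts_sets[OF BB_open[OF B]])
  have pos: "0 < prob (E m \<inter> \<theta> t -` ?C)" using prob_indep[OF tp Es Cs] m c by simp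
  moreover have "E m \<inter> \<theta> t -` ?C \<in> sets M"
  proof -
    have "E m \<inter> \<theta> t -` ?C = E m \<inter> (\<theta> t -` ?C \<inter> space M)" by (auto simp: E_def)
    then show ?thesis using EM measurable_sets[OF theta_M_Fut[OF Q_T[OF t]] Cs] by auto
  qed
  moreover have "contracts T \<phi> (A m) \<omega>" if w: "\<omega> \<in> E m \<inter> \<theta> t -` ?C" for \<omega>
  proof -
    have wM: "\<omega> \<in> space M" using w by (auto simp: E_def)
    have BX: "B \<subseteq> X" using openin_imp_subset[OF BB_open[OF B]] .
    have "contracts_rat B (\<theta> t \<omega>)" using contracts_iff_dense[of "\<theta> t \<omega>" B B] w BX closure_subset[of B] by auto
    then have "contracts_rat (\<phi> t \<omega> ` (A m \<inter> D)) (\<theta> t \<omega>)"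
      by (rule contracts_rat_mono) (use w in \<open>auto simp: E_def\<close>)
    then have "contracts_rat (A m \<inter> D) \<omega>" by (intro contracts_rat_shift[OF t wM]) (auto simp: A_def)
    then show ?thesis using contracts_iff[OF wM Ao] by simp
  qed
  ultimately have "contracting_pair (prob (E m \<inter> \<theta> t -` ?C)) x y"
    unfolding contracting_pair_def A_def by (intro exI[of _ "?r m"]) auto
  then show ?thesis using pos by blast
qed

text \<open>Given \<open>F\<^sub>0\<^sup>t\<close>, a \<open>contracting_pair\<close> at time \<open>t\<close> still synchronises with probability at least \<open>\<epsilon>\<close>,
  whereas non-synchronisation is almost decided by \<open>F\<^sub>0\<^sup>t\<close> for large \<open>t\<close>.\<close>

lemma nonsync_visits:
  assumes xy: "x \<in> X" "y \<in> X" and K: "K1 \<in> sets BX" "K2 \<in> sets BX" and e: "0 < \<epsilon>"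
    and g: "\<And>a b. a \<in> K1 \<Longrightarrow> b \<in> K2 \<Longrightarrow> contracting_pair \<epsilon> a b" and j: "j \<in> Q"
  shows "(\<lambda>k. prob {\<omega> \<in> space M. \<not> sync \<omega> x y \<and> \<phi> (real k + j) \<omega> x \<in> K1 \<and> \<phi> (real k + j) \<omega> y \<in> K2}) \<longlonglongrightarrow> 0"
proof (rule LIMSEQ_I)
  fix r :: real assume r: "0 < r"
  let ?S = "{\<omega> \<in> space M. sync \<omega> x y}"
  let ?N = "space M - ?S"
  let ?H = "{p \<in> space ((BX \<Otimes>\<^sub>M BX) \<Otimes>\<^sub>M Fut). sync (snd p) (fst (fst p)) (snd (fst p))}"
  \<comment> \<open>Chosen so that \<open>\<delta> + \<delta> / \<epsilon> = r\<close>: one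
    \<open>\<delta>\<close> for approximating non-synchronisation by \<open>G\<close>, and
    \<open>\<delta> / \<epsilon>\<close> for the visits inside \<open>G\<close>.\<close>
  define \<delta> where "\<delta> = r / (1 + 1 / \<epsilon>)"
  have pos: "0 < 1 + 1 / \<epsilon>" using e by (intro add_pos_pos) auto
  then have "\<delta> * (1 + 1 / \<epsilon>) = r" by (simp add: \<delta>_def)
  then have d: "0 < \<delta>" "\<delta> + \<delta> / \<epsilon> = r" using r pos by (simp_all add: \<delta>_def distrib_left)
  have Ns: "?N \<in> sets Fut" using sync_section_sets[OF xy] sets.compl_sets[of ?S Fut] by simp
  then obtain n0 G where G: "G \<in> sets (Past (real n0))" and ap: "prob (?N - G) + prob (G - ?N) < \<delta>"
    using Fut_approx[OF Ns d(1)] by blast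
  have "prob {\<omega> \<in> space M. \<not> sync \<omega> x y \<and> \<phi> (real k + j) \<omega> x \<in> K1 \<and> \<phi> (real k + j) \<omega> y \<in> K2} < r"
    if k: "n0 \<le> k" for k
  proof -
    define t where "t = real k + j"
    have tQ: "t \<in> Q" using Q_add[OF Q_of_nat j] by (simp add: t_def)
    have tp: "t \<in> Tpos T" using Q_Tpos[OF tQ] .
    have "real n0 \<le> t" using k Q_nonneg[OF j] by (simp add: t_def)
    then have Gt: "G \<in> sets (Past t)" using G Past_mono[OF Q_Tpos[OF Q_of_nat] tp] by blast
    let ?P1 = "{\<omega> \<in> space M. \<phi> t \<omega> x \<in> K1}"
    let ?P2 = "{\<omega> \<in> space M. \<phi> t \<omega> y \<in> K2}"
    define G' where "G' = G \<inter> ?P1 \<inter> ?P2"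
    have P: "?P1 \<in> sets (Past t)" "?P2 \<in> sets (Past t)" using phi_set_Past[OF tp] xy K by auto
    have G't: "G' \<in> sets (Past t)" unfolding G'_def using Gt P by auto
    have PM: "sets (Past t) \<subseteq> sets M" using Past_subset_Fut[OF tp] Fut_subset by blast
    have GM: "G \<in> sets M" "G' \<in> sets M" "?P1 \<in> sets M" "?P2 \<in> sets M" "?N \<in> sets M"
      using Gt G't P PM Ns Fut_subset by blast+
    let ?Z = "\<lambda>\<omega>. (\<phi> t \<omega> x, \<phi> t \<omega> y)"
    have Z: "?Z \<in> Past t \<rightarrow>\<^sub>M BX \<Otimes>\<^sub>M BX" by (intro measurable_Pair phi_Past tp xy)
    \<comment> \<open>Pairs visiting \<open>K1 \<times> K2\<close> within \<open>G\<close>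
      synchronise with conditional probability at least \<open>\<epsilon>\<close>, yet
      \<open>G\<close> contains little synchronisation:
      \<open>\<epsilon> * prob G' \<le> prob (G - ?N) < \<delta>\<close>.\<close>
    have "\<epsilon> * prob G' = (\<integral>\<omega>. indicator G' \<omega> * \<epsilon> \<partial>M)" using GM by simp
    also have "\<dots> \<le> (\<integral>\<omega>. indicator G' \<omega> * prob (Pair (?Z \<omega>) -` ?H) \<partial>M)"
    proof (rule integral_mono)
      show "integrable M (\<lambda>\<omega>. indicator G' \<omega> * \<epsilon>)" using GM by (auto simp: emeasure_eq_measure)
      have "(\<lambda>\<omega>. prob (Pair (?Z \<omega>) -` ?H)) \<in> borel_measurable M"
        by (rule measurable_compose[OF Fut_to_M[OF Past_to_Fut[OF tp Z]] prob_section_measurable[OF sync_sets]])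
      then show "integrable M (\<lambda>\<omega>. indicator G' \<omega> * prob (Pair (?Z \<omega>) -` ?H))"
        using GM by (intro integrable_const_bound[of _ 1]) (auto simp: indicator_def)
      fix \<omega> assume w: "\<omega> \<in> space M"
      show "indicator G' \<omega> * \<epsilon> \<le> indicator G' \<omega> * prob (Pair (?Z \<omega>) -` ?H)"
      proof (cases "\<omega> \<in> G'")
        case True
        have in': "\<phi> t \<omega> x \<in> X" "\<phi> t \<omega> y \<in> X" using phi_in[OF tp w] xy by auto
        have "Pair (?Z \<omega>) -` ?H = {\<omega>' \<in> space M. sync \<omega>' (\<phi> t \<omega> x) (\<phi> t \<omega> y)}"
          using in' by (auto simp: space_pair_measure)
        then show ?thesis using contracting_pair_sync[OF in' g] True by (auto simp: G'_def)
      qed auto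
    qed
    also have "\<dots> = prob {\<omega> \<in> G'. (?Z \<omega>, \<theta> t \<omega>) \<in> ?H}"
      by (rule markov_prob[OF tp G't Z sync_sets, symmetric])
    also have "\<dots> \<le> prob (G - ?N)"
    proof (rule finite_measure_mono)
      show "{\<omega> \<in> G'. (?Z \<omega>, \<theta> t \<omega>) \<in> ?H} \<subseteq> G - ?N"
        using sync_shift[OF tQ _ xy] by (auto simp: G'_def)
    qed (use GM in auto)
    finally have "\<epsilon> * prob G' \<le> \<delta>" using ap measure_nonneg[of M "?N - G"] by linarith
    then have "prob G' \<le> \<delta> / \<epsilon>" using e by (simp add: field_simps)
    have "prob {\<omega> \<in> space M. \<not> sync \<omega> x y \<and> \<phi> t \<omega> x \<in> K1 \<and> \<phi> t \<omega> y \<in> K2} \<le> prob ((?N - G) \<union> G')"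
      by (rule finite_measure_mono) (use GM in \<open>auto simp: G'_def\<close>)
    also have "\<dots> \<le> prob (?N - G) + prob G'"
      by (rule measure_Un_le) (use GM in auto)
    also have "\<dots> < \<delta> + \<delta> / \<epsilon>" using ap \<open>prob G' \<le> \<delta> / \<epsilon>\<close> measure_nonneg[of M "G - ?N"] by linarith
    finally show ?thesis unfolding d(2) t_def .
  qed
  then show "\<exists>no. \<forall>k\<ge>no. norm (prob {\<omega> \<in> space M. \<not> sync \<omega> x y \<and> \<phi> (real k + j) \<omega> x \<in> K1 \<and> \<phi> (real k + j) \<omega> y \<in> K2} - 0) < r"
    by (intro exI[of _ n0]) auto
qed

end

section \<open>From contractibility to almost sure synchronisation of pairs\<close>

context rds_ergodic
begin

text \<open>Right-continuity moves the hit to a time in \<open>Q\<close>; countability then selects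
  one time and one square.\<close>

lemma hit_open_UN:
  assumes W: "openin (top_of_set (X \<times> X)) V" and V: "V \<subseteq> (\<Union>B\<in>I. B \<times> B)" and I: "I \<subseteq> BB"
    and xy: "x \<in> X" "y \<in> X"
    and p: "pos_prob M {\<omega> \<in> space M. \<exists>t\<in>Tpos T. (\<phi> t \<omega> x, \<phi> t \<omega> y) \<in> V}"
  shows "\<exists>t\<in>Q. \<exists>B\<in>I. 0 < prob {\<omega> \<in> space M. \<phi> t \<omega> x \<in> B \<and> \<phi> t \<omega> y \<in> B}"
proof -
  have "\<exists>i\<in>Q \<times> I. 0 < prob {\<omega> \<in> space M. \<phi> (fst i) \<omega> x \<in> snd i \<and> \<phi> (fst i) \<omega> y \<in> snd i}"
  proof (rule pos_prob_countable_UN[OF p])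
    show "countable (Q \<times> I)"
      using countable_Q countable_subset[OF I countable_BB] by (intro countable_SIGMA) auto
    show "{\<omega> \<in> space M. \<phi> (fst i) \<omega> x \<in> snd i \<and> \<phi> (fst i) \<omega> y \<in> snd i} \<in> sets M" if i: "i \<in> Q \<times> I" for i
    proof -
      have "fst i \<in> Tpos T" "snd i \<in> sets \<rho>" using i I Q_Tpos BB_sets by auto
      note phi_section_sets[OF this xy(1)] phi_section_sets[OF this xy(2)]
      moreover have "{\<omega> \<in> space M. \<phi> (fst i) \<omega> x \<in> snd i \<and> \<phi> (fst i) \<omega> y \<in> snd i}
          = {\<omega> \<in> space M. \<phi> (fst i) \<omega> x \<in> snd i} \<inter> {\<omega> \<in> space M. \<phi> (fst i) \<omega> y \<in> snd i}" by auto
      ultimately show ?thesis by auto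
    qed
    show "{\<omega> \<in> space M. \<exists>t\<in>Tpos T. (\<phi> t \<omega> x, \<phi> t \<omega> y) \<in> V}
        \<subseteq> (\<Union>i\<in>Q \<times> I. {\<omega> \<in> space M. \<phi> (fst i) \<omega> x \<in> snd i \<and> \<phi> (fst i) \<omega> y \<in> snd i})"
    proof
      fix \<omega> assume "\<omega> \<in> {\<omega> \<in> space M. \<exists>t\<in>Tpos T. (\<phi> t \<omega> x, \<phi> t \<omega> y) \<in> V}"
      then obtain q where q: "\<omega> \<in> space M" "q \<in> Q" "(\<phi> q \<omega> x, \<phi> q \<omega> y) \<in> V"
        using hit_open_Q[OF W _ _ xy] by blast
      then obtain B where "B \<in> I" "\<phi> q \<omega> x \<in> B" "\<phi> q \<omega> y \<in> B" using V by blast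
      then show "\<omega> \<in> (\<Union>i\<in>Q \<times> I. {\<omega> \<in> space M. \<phi> (fst i) \<omega> x \<in> snd i \<and> \<phi> (fst i) \<omega> y \<in> snd i})"
        using q by force
    qed
  qed
  then show ?thesis by auto
qed

text \<open>From \<open>a\<close> the contracting set of \<open>stable_basic\<close> is reached with
  positive probability, so \<open>visit_contracting_pair\<close> applies to the diagonal pair
  \<open>(a, a)\<close> and yields a ball around \<open>a\<close> that contracts with positive
  probability.\<close>

lemma transitive_contracts:
  assumes st: "stable_wrt T M X \<phi> \<rho>" and a: "a \<in> transitive_pts T M X \<phi> \<rho>"
  shows "\<exists>B\<in>BB. a \<in> B \<and> 0 < prob {\<omega> \<in> space M. contracts T \<phi> B \<omega>}"
proof -
  have aX: "a \<in> X" using a by (auto simp: transitive_pts_def supp_def)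
  obtain B0 where B0: "B0 \<in> BB" "0 < measure \<rho> B0" "0 < prob {\<omega> \<in> space M. contracts T \<phi> B0 \<omega>}"
    using stable_basic[OF st] by blast
  have "pos_prob M {\<omega> \<in> space M. \<exists>t\<in>Tpos T. \<phi> t \<omega> a \<in> B0}"
    using a B0 BB_open by (auto simp: transitive_pts_def)
  then have "pos_prob M {\<omega> \<in> space M. \<exists>t\<in>Tpos T. (\<phi> t \<omega> a, \<phi> t \<omega> a) \<in> B0 \<times> B0}" by simp
  from hit_open_UN[OF openin_Times[OF BB_open[OF B0(1)] BB_open[OF B0(1)]] _ _ aX aX this, of "{B0}"]
  obtain t where "t \<in> Q" "0 < prob {\<omega> \<in> space M. \<phi> t \<omega> a \<in> B0 \<and> \<phi> t \<omega> a \<in> B0}" using B0(1) by auto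
  from visit_contracting_pair[OF aX aX this(1) B0(1) this(2) B0(3)]
  obtain \<epsilon> where "0 < \<epsilon>" "contracting_pair \<epsilon> a a" by blast
  then obtain r E where r: "0 < r" "E \<in> sets M" "0 < prob E"
    and c: "\<And>\<omega>. \<omega> \<in> E \<Longrightarrow> contracts T \<phi> (ball a r \<inter> X) \<omega>"
    by (auto simp: contracting_pair_def)
  have "openin (top_of_set X) (ball a r \<inter> X)" by (subst Int_commute) (intro openin_open_Int open_ball)
  moreover have "a \<in> ball a r \<inter> X" using aX r by simp
  ultimately obtain B where B: "B \<in> BB" "a \<in> B" "B \<subseteq> ball a r \<inter> X" using BB_base by blast
  have "prob E \<le> prob {\<omega> \<in> space M. contracts T \<phi> B \<omega>}"
  proof (rule finite_measure_mono)
    show "E \<subseteq> {\<omega> \<in> space M. contracts T \<phi> B \<omega>}"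
      using c contracts_mono[OF _ B(3)] sets.sets_into_space[OF r(2)] by auto
  qed (use contracts_sets[OF BB_open[OF B(1)]] Fut_subset in auto)
  then show ?thesis using B r by auto
qed

text \<open>The squares of basic sets that contract with positive probability unite to an open
  neighbourhood of the diagonal over the transitive points. Testing contractibility against this one
  neighbourhood gives a joint visit to one such set.\<close>

lemma contractible_contracting_pair:
  assumes st: "stable_wrt T M X \<phi> \<rho>"
    and xy: "(x, y) \<in> contractible_set T M X \<phi> (transitive_pts T M X \<phi> \<rho>)"
  shows "\<exists>\<epsilon>>0. contracting_pair \<epsilon> x y"
proof -
  define I where "I = {B \<in> BB. 0 < prob {\<omega> \<in> space M. contracts T \<phi> B \<omega>}}"
  let ?V = "\<Union>B\<in>I. B \<times> B"
  have xyX: "x \<in> X" "y \<in> X" using xy by (auto simp: contractible_set_def)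
  have o: "openin (top_of_set (X \<times> X)) ?V"
    by (rule openin_Union) (auto simp: I_def intro!: openin_Times BB_open)
  have "{(a, a) |a. a \<in> transitive_pts T M X \<phi> \<rho>} \<subseteq> ?V"
    using transitive_contracts[OF st] by (fastforce simp: I_def)
  moreover have "pos_prob M {\<omega> \<in> space M. \<exists>t\<in>Tpos T. (\<phi> t \<omega> x, \<phi> t \<omega> y) \<in> V}"
    if "openin (top_of_set (X \<times> X)) V" "{(a, a) |a. a \<in> transitive_pts T M X \<phi> \<rho>} \<subseteq> V" for V
    using xy that unfolding contractible_set_def by blast
  ultimately have "pos_prob M {\<omega> \<in> space M. \<exists>t\<in>Tpos T. (\<phi> t \<omega> x, \<phi> t \<omega> y) \<in> ?V}"
    using o by blast
  then obtain t B where "t \<in> Q" "B \<in> I" "0 < prob {\<omega> \<in> space M. \<phi> t \<omega> x \<in> B \<and> \<phi> t \<omega> y \<in> B}"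
    using hit_open_UN[OF o order_refl _ xyX] by (auto simp: I_def)
  then show ?thesis using visit_contracting_pair[OF xyX] by (auto simp: I_def)
qed

lemma measure_X [simp]: "measure \<rho> X = 1"
  using rho.prob_space by simp

abbreviation RR :: "('m \<times> 'm) measure" where "RR \<equiv> \<rho> \<Otimes>\<^sub>M \<rho>"

lemma integral_RR:
  fixes g :: "'m \<Rightarrow> real"
  assumes g: "g \<in> borel_measurable \<rho>" and b: "\<And>x. 0 \<le> g x \<and> g x \<le> 1"
  shows "integrable RR (\<lambda>z. g (fst z))" "integrable RR (\<lambda>z. g (snd z))"
    and "(\<integral>z. g (fst z) \<partial>RR) = (\<integral>x. g x \<partial>\<rho>)" "(\<integral>z. g (snd z) \<partial>RR) = (\<integral>x. g x \<partial>\<rho>)"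
proof -
  interpret rr: pair_prob_space \<rho> \<rho> ..
  show i: "integrable RR (\<lambda>z. g (fst z))" "integrable RR (\<lambda>z. g (snd z))"
    by (rule rr.P.integrable_const_bound[of _ 1]; use g b in simp)+
  show "(\<integral>z. g (fst z) \<partial>RR) = (\<integral>x. g x \<partial>\<rho>)"
    using rr.integral_fst'[OF i(1)] by simp
  show "(\<integral>z. g (snd z) \<partial>RR) = (\<integral>x. g x \<partial>\<rho>)"
    using rr.integral_fst'[OF i(2)] by simp
qed

text \<open>If non-synchronisation had mass \<open>c > 0\<close>, then, uniformly in \<open>k\<close>, with mass at least \<open>c / 2\<close> it would
  occur together with a visit of the pair to \<open>K1 \<times> K2\<close> at one of the times \<open>k + q j\<close>, \<open>j < J\<close>: the number \<open>J\<close> is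
  determined by recurrence of the first coordinate to \<open>K1\<close> alone, and only then \<open>K2\<close> is chosen so large that
  stationarity of the second coordinate makes the exceptional mass small.\<close>

lemma AE_sync:
  assumes st: "stable_wrt T M X \<phi> \<rho>"
    and rect: "contains_full_rect \<rho> (contractible_set T M X \<phi> (transitive_pts T M X \<phi> \<rho>))"
  shows "AE z in RR. AE \<omega> in M. sync \<omega> (fst z) (snd z)"
proof -
  interpret rr: pair_prob_space \<rho> \<rho> ..
  have sets_RR: "sets RR = sets (BX \<Otimes>\<^sub>M BX)" by (rule sets_pair_measure_cong[OF sets_rho sets_rho])
  obtain A1 A2 where A: "A1 \<in> sets \<rho>" "A2 \<in> sets \<rho>" "0 < measure \<rho> A1" "measure \<rho> A2 = 1"
    and AC: "A1 \<times> A2 \<subseteq> contractible_set T M X \<phi> (transitive_pts T M X \<phi> \<rho>)"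
    using rect unfolding contains_full_rect_def by blast
  let ?H = "{p \<in> space ((BX \<Otimes>\<^sub>M BX) \<Otimes>\<^sub>M Fut). sync (snd p) (fst (fst p)) (snd (fst p))}"
  have SyM: "{\<omega> \<in> space M. sync \<omega> x y} \<in> sets M" if "x \<in> X" "y \<in> X" for x y
    using sync_section_sets[OF that] Fut_subset by blast
  define n where "n z = 1 - prob (Pair z -` ?H)" for z
  have n_m: "n \<in> borel_measurable RR"
    unfolding n_def using prob_section_measurable[OF sync_sets] by (simp cong: measurable_cong_sets add: sets_RR)
  have n_b: "0 \<le> n z" "n z \<le> 1" for z by (auto simp: n_def)
  have n_eq: "n (x, y) = prob {\<omega> \<in> space M. \<not> sync \<omega> x y}" if "x \<in> X" "y \<in> X" for x y
  proof -
    have "Pair (x, y) -` ?H = {\<omega> \<in> space M. sync \<omega> x y}"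
      using that by (auto simp: space_pair_measure)
    moreover have "{\<omega> \<in> space M. \<not> sync \<omega> x y} = space M - {\<omega> \<in> space M. sync \<omega> x y}" by auto
    ultimately show ?thesis using prob_compl[OF SyM[OF that]] by (simp add: n_def)
  qed
  define c where "c = (\<integral>z. n z \<partial>RR)"
  have n_i: "integrable RR n"
    by (rule rr.P.integrable_const_bound[of _ 1]) (use n_m n_b in auto)
  have "\<not> 0 < c"
  proof
    assume c: "0 < c"
    obtain K1 where K1: "compact K1" "K1 \<subseteq> A1" "measure \<rho> (A1 - K1) < measure \<rho> A1"
      using rho_regular(2)[OF A(1,3)] by blast
    have A1X: "A1 \<subseteq> X" "A2 \<subseteq> X" using A sets.sets_into_space by force+
    have K1s: "K1 \<in> sets \<rho>" by (rule compact_sets) (use K1 A1X in auto)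
    have "0 < measure \<rho> K1"
      using rho.finite_measure_Diff[OF A(1) K1s K1(2)] K1(3) by simp
    define q where "q = from_nat_into Q"
    have "Q \<noteq> {}" using Q_0 by blast
    then have q: "range q = Q" "q j \<in> Q" for j
      unfolding q_def by (rule range_from_nat_into[OF _ countable_Q], rule from_nat_into)
    \<comment> \<open>The visit to \<open>K1\<close> is sought among the first \<open>J\<close>
      elements of an enumeration of \<open>Q\<close>, which need not be the earliest times; by
      recurrence these events fill up as \<open>J\<close> grows.\<close>
    define BJ where "BJ J = (\<Union>j<J. {p \<in> space (BX \<Otimes>\<^sub>M Fut). \<phi> (q j) (snd p) (fst p) \<in> K1})" for J
    have BJ: "BJ J \<in> sets (BX \<Otimes>\<^sub>M Fut)" for J
      unfolding BJ_def
    proof (rule sets.finite_UN)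
      fix j assume "j \<in> {..<J}"
      show "{p \<in> space (BX \<Otimes>\<^sub>M Fut). \<phi> (q j) (snd p) (fst p) \<in> K1} \<in> sets (BX \<Otimes>\<^sub>M Fut)"
        using measurable_sets[OF phi_joint_Fut[OF Q_Tpos[OF q(2)]], of K1 j] K1s
        by (simp add: sets_rho vimage_def Int_def conj_commute case_prod_beta')
    qed simp
    define b where "b J x = prob (Pair x -` BJ J)" for J x
    have b_m: "b J \<in> borel_measurable BX" for J unfolding b_def by (rule prob_section_measurable[OF BJ])
    have b_b: "0 \<le> b J x" "b J x \<le> 1" for J x by (auto simp: b_def)
    have "AE x in \<rho>. (\<lambda>J. b J x) \<longlonglongrightarrow> 1"
      using recurrence[OF K1s \<open>0 < measure \<rho> K1\<close>, of 0] AE_space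
    proof eventually_elim
      case (elim x)
      have sec: "Pair x -` BJ J \<in> sets M" for J using sets_Pair1[OF BJ] Fut_subset by blast
      have "(\<lambda>J. b J x) \<longlonglongrightarrow> prob (\<Union>J. Pair x -` BJ J)"
        unfolding b_def
      proof (rule finite_Lim_measure_incseq)
        show "incseq (\<lambda>J. Pair x -` BJ J)"
          unfolding incseq_def BJ_def by (intro allI impI vimage_mono UN_mono) auto
      qed (use sec in auto)
      moreover have "AE \<omega> in M. \<omega> \<in> (\<Union>J. Pair x -` BJ J)"
        using elim(1) AE_space
      proof eventually_elim
        case (elim \<omega>)
        then obtain t where t: "t \<in> Q" "\<phi> t \<omega> x \<in> K1" by blast
        then obtain j where "t = q j" using q(1) by (metis rangeE)
        then have "(x, \<omega>) \<in> BJ (Suc j)"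
          using t elim(2) \<open>x \<in> space \<rho>\<close> by (auto simp: BJ_def space_pair_measure)
        then show ?case by blast
      qed
      ultimately show ?case using prob_eq_1[of "\<Union>J. Pair x -` BJ J"] sec by auto
    qed
    then have "(\<lambda>J. \<integral>x. b J x \<partial>\<rho>) \<longlonglongrightarrow> (\<integral>x. 1 \<partial>\<rho>)"
      by (intro integral_dominated_convergence[where w = "\<lambda>_. 1"])
        (use b_m b_b in \<open>auto cong: measurable_cong_sets simp: sets_rho\<close>)
    then have "(\<lambda>J. \<integral>x. b J x \<partial>\<rho>) \<longlonglongrightarrow> 1" by simp
    then have "\<forall>\<^sub>F J in sequentially. 1 - c / 4 < (\<integral>x. b J x \<partial>\<rho>)"
      by (rule order_tendstoD) (use c in auto)
    then obtain J where J: "1 - c / 4 < (\<integral>x. b J x \<partial>\<rho>)" by (auto simp: eventually_sequentially)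
    \<comment> \<open>The second coordinate has to be in \<open>K2\<close> at \<open>J\<close>
      times, failing at each with the stationary probability \<open>measure \<rho> (X - K2)\<close>.
      Full measure of \<open>A2\<close> lets \<open>K2\<close> miss as little as required.\<close>
    have "0 < c / (4 * real (Suc J))" using c by simp
    then obtain K2 where K2: "compact K2" "K2 \<subseteq> A2" "measure \<rho> (A2 - K2) < c / (4 * real (Suc J))"
      using rho_regular(2)[OF A(2)] by blast
    have K2s: "K2 \<in> sets \<rho>" by (rule compact_sets) (use K2 A1X in auto)
    have K2c: "X - K2 \<in> sets \<rho>" using sets.compl_sets[OF K2s] by simp
    have "measure \<rho> (X - K2) < c / (4 * real (Suc J))"
      using rho.finite_measure_Diff[OF A(2) K2s K2(2)] rho.prob_compl[OF K2s] K2(3) A(4) by simp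
    then have "real J * measure \<rho> (X - K2) \<le> real J * (c / (4 * real (Suc J)))"
      by (intro mult_left_mono) auto
    also have "\<dots> \<le> c / 4" using c by (simp add: field_simps)
    finally have K2m: "real J * measure \<rho> (X - K2) \<le> c / 4" .
    obtain \<epsilon> where e: "0 < \<epsilon>" "\<And>a b. a \<in> K1 \<Longrightarrow> b \<in> K2 \<Longrightarrow> contracting_pair \<epsilon> a b"
      using contracting_pair_on_compact[OF K1(1) K2(1)] contractible_contracting_pair[OF st] AC K1(2) K2(2) by blast
    define FS where "FS k j = {p \<in> space ((BX \<Otimes>\<^sub>M BX) \<Otimes>\<^sub>M Fut). \<not> sync (snd p) (fst (fst p)) (snd (fst p))
        \<and> \<phi> (real k + q j) (snd p) (fst (fst p)) \<in> K1 \<and> \<phi> (real k + q j) (snd p) (snd (fst p)) \<in> K2}" for k j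
    have kq: "real k + q j \<in> Tpos T" for k j using Q_Tpos[OF Q_add[OF Q_of_nat q(2)]] .
    have FS: "FS k j \<in> sets ((BX \<Otimes>\<^sub>M BX) \<Otimes>\<^sub>M Fut)" for k j
    proof -
      let ?S = "(BX \<Otimes>\<^sub>M BX) \<Otimes>\<^sub>M Fut"
      have m: "(\<lambda>p. \<phi> (real k + q j) (snd p) (f (fst p))) \<in> ?S \<rightarrow>\<^sub>M BX"
        if "f \<in> BX \<Otimes>\<^sub>M BX \<rightarrow>\<^sub>M BX" for f
        using measurable_compose[OF measurable_Pair[OF measurable_compose[OF measurable_fst that] measurable_snd]
          phi_joint_Fut[OF kq]] by simp
      have "FS k j = (space ?S - ?H)
          \<inter> ((\<lambda>p. \<phi> (real k + q j) (snd p) (fst (fst p))) -` K1 \<inter> space ?S)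
          \<inter> ((\<lambda>p. \<phi> (real k + q j) (snd p) (snd (fst p))) -` K2 \<inter> space ?S)"
        unfolding FS_def by auto
      also have "\<dots> \<in> sets ?S"
        by (rule sets.Int[OF sets.Int[OF sets.compl_sets[OF sync_sets]
            measurable_sets[OF m[OF measurable_fst] K1s[unfolded sets_rho]]]
            measurable_sets[OF m[OF measurable_snd] K2s[unfolded sets_rho]]])
      finally show ?thesis .
    qed
    define f where "f k j z = prob (Pair z -` FS k j)" for k j z
    have f_m: "f k j \<in> borel_measurable RR" for k j
      unfolding f_def using prob_section_measurable[OF FS] by (simp cong: measurable_cong_sets add: sets_RR)
    have f_b: "0 \<le> f k j z" "f k j z \<le> 1" for k j z by (auto simp: f_def)
    have f_i: "integrable RR (f k j)" for k j
      by (rule rr.P.integrable_const_bound[of _ 1]) (use f_m f_b in auto)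
    have f_eq: "f k j (x, y) = prob {\<omega> \<in> space M. \<not> sync \<omega> x y \<and> \<phi> (real k + q j) \<omega> x \<in> K1 \<and> \<phi> (real k + q j) \<omega> y \<in> K2}"
      if "x \<in> X" "y \<in> X" for k j x y
      unfolding f_def FS_def using that by (auto simp: space_pair_measure intro!: arg_cong[where f = prob])
    have f_lim: "(\<lambda>k. \<integral>z. f k j z \<partial>RR) \<longlonglongrightarrow> 0" for j
    proof -
      have "(\<lambda>k. \<integral>z. f k j z \<partial>RR) \<longlonglongrightarrow> (\<integral>z. 0 \<partial>RR)"
      proof (rule integral_dominated_convergence[where w = "\<lambda>_. 1"])
        show "AE z in RR. (\<lambda>k. f k j z) \<longlonglongrightarrow> 0"
        proof (rule AE_I2)
          fix z assume "z \<in> space RR"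
          then obtain x y where z: "z = (x, y)" "x \<in> X" "y \<in> X" by (auto simp: space_pair_measure)
          show "(\<lambda>k. f k j z) \<longlonglongrightarrow> 0"
            unfolding z(1) f_eq[OF z(2,3)]
            by (rule nonsync_visits[OF z(2,3) _ _ e q(2)]) (use K1s K2s sets_rho in auto)
        qed
      qed (use f_m f_b in auto)
      then show ?thesis by simp
    qed
    define h where "h k x = (\<integral>\<omega>. b J (\<phi> (real k) \<omega> x) \<partial>M)" for k x
    define l where "l k j x = trans_prob M \<phi> (real k + q j) x (X - K2)" for k j x
    have h_m: "h k \<in> borel_measurable \<rho>" for k
      unfolding h_def
    proof (rule borel_measurable_lebesgue_integral)
      have "(\<lambda>p. b J (\<phi> (real k) (snd p) (fst p))) \<in> borel_measurable W"
        by (rule measurable_compose[OF phi_W[OF Q_Tpos[OF Q_of_nat]]])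
          (use b_m in \<open>simp cong: measurable_cong_sets add: sets_rho\<close>)
      then show "(\<lambda>(x, \<omega>). b J (\<phi> (real k) \<omega> x)) \<in> borel_measurable W" by (simp add: case_prod_beta')
    qed
    have h_eq: "h k x = prob {\<omega> \<in> space M. (\<phi> (real k) \<omega> x, \<theta> (real k) \<omega>) \<in> BJ J}" if "x \<in> X" for k x
    proof -
      note k = Q_Tpos[OF Q_of_nat, of k]
      have sp: "space M \<in> sets (Past (real k))" using sets.top[of "Past (real k)"] by simp
      have "prob {\<omega> \<in> space M. (\<phi> (real k) \<omega> x, \<theta> (real k) \<omega>) \<in> BJ J}
          = (\<integral>\<omega>. indicator (space M) \<omega> * prob (Pair (\<phi> (real k) \<omega> x) -` BJ J) \<partial>M)"
        by (rule markov_prob[OF k sp phi_Past[OF k that] BJ])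
      also have "\<dots> = h k x" unfolding h_def b_def by (rule Bochner_Integration.integral_cong) auto
      finally show ?thesis by simp
    qed
    have l_m: "l k j \<in> borel_measurable \<rho>" for k j
      unfolding l_def by (rule trans_prob_measurable[OF kq K2c])
    have l_b: "0 \<le> l k j x \<and> l k j x \<le> 1" for k j x unfolding l_def using trans_prob_bounds by blast
    have l_int: "(\<integral>x. l k j x \<partial>\<rho>) = measure \<rho> (X - K2)" for k j
      unfolding l_def by (rule stationary_rho[OF kq K2c, symmetric])
    have h_b: "0 \<le> h k x \<and> h k x \<le> 1" for k x
    proof
      show "0 \<le> h k x" unfolding h_def using b_b by simp
      show "h k x \<le> 1"
      proof (cases "integrable M (\<lambda>\<omega>. b J (\<phi> (real k) \<omega> x))")
        case True
        then show ?thesis unfolding h_def by (rule integral_le_const) (use b_b in auto)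
      next
        case False
        then show ?thesis unfolding h_def by (simp add: not_integrable_integral_eq)
      qed
    qed
    \<comment> \<open>By stationarity the mean of \<open>h k\<close> does not depend on
      \<open>k\<close>, so the same \<open>J\<close> serves all starting times.\<close>
    have h_int: "(\<integral>x. h k x \<partial>\<rho>) = (\<integral>x. b J x \<partial>\<rho>)" for k
      unfolding h_def by (rule integral_phi[OF Q_Tpos[OF Q_of_nat] b_m]) (use b_b in auto)
    \<comment> \<open>Without synchronisation, either the first point misses \<open>K1\<close> at
      all \<open>J\<close> times, or at one of them the second is outside \<open>K2\<close>, or at
      one of them both are in place and \<open>f\<close> counts the pair.\<close>
    have pw: "n z \<le> (1 - h k (fst z)) + ((\<Sum>j<J. l k j (snd z)) + (\<Sum>j<J. f k j z))" if "z \<in> space RR" for k z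
    proof -
      obtain x y where z: "z = (x, y)" "x \<in> X" "y \<in> X" using \<open>z \<in> space RR\<close> by (auto simp: space_pair_measure)
      let ?hit = "{\<omega> \<in> space M. (\<phi> (real k) \<omega> x, \<theta> (real k) \<omega>) \<in> BJ J}"
      let ?out = "\<lambda>j. {\<omega> \<in> space M. \<phi> (real k + q j) \<omega> y \<in> X - K2}"
      let ?bad = "\<lambda>j. {\<omega> \<in> space M. \<not> sync \<omega> x y \<and> \<phi> (real k + q j) \<omega> x \<in> K1 \<and> \<phi> (real k + q j) \<omega> y \<in> K2}"
      note k = Q_Tpos[OF Q_of_nat, of k]
      have hit: "?hit \<in> sets M" by (rule markov_sets[OF k phi_Past[OF k z(2)] BJ])
      have out: "?out j \<in> sets M" for j by (rule phi_section_sets[OF kq K2c z(3)])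
      have bad: "?bad j \<in> sets M" for j
      proof -
        have "?bad j = Pair (x, y) -` FS k j" using z by (auto simp: FS_def space_pair_measure)
        then show ?thesis using sets_Pair1[OF FS, of "(x, y)" k j] Fut_subset by auto
      qed
      have "{\<omega> \<in> space M. \<not> sync \<omega> x y} \<subseteq> (space M - ?hit) \<union> ((\<Union>j<J. ?out j) \<union> (\<Union>j<J. ?bad j))"
      proof
        fix \<omega> assume w: "\<omega> \<in> {\<omega> \<in> space M. \<not> sync \<omega> x y}"
        show "\<omega> \<in> (space M - ?hit) \<union> ((\<Union>j<J. ?out j) \<union> (\<Union>j<J. ?bad j))"
        proof (cases "\<omega> \<in> ?hit")
          case True
          then obtain j where j: "j < J" "\<phi> (q j) (\<theta> (real k) \<omega>) (\<phi> (real k) \<omega> x) \<in> K1"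
            by (auto simp: BJ_def)
          then have "\<phi> (real k + q j) \<omega> x \<in> K1"
            using cocycle[OF k Q_Tpos[OF q(2)], of \<omega> x j] w z by auto
          then have "\<omega> \<in> ?out j \<or> \<omega> \<in> ?bad j" using w phi_in[OF kq _ z(3)] by auto
          then show ?thesis using j(1) by blast
        qed (use w in auto)
      qed
      then have "n z \<le> prob ((space M - ?hit) \<union> ((\<Union>j<J. ?out j) \<union> (\<Union>j<J. ?bad j)))"
        unfolding z(1) n_eq[OF z(2,3)] by (rule finite_measure_mono) (use hit out bad in auto)
      also have "\<dots> \<le> prob (space M - ?hit) + prob ((\<Union>j<J. ?out j) \<union> (\<Union>j<J. ?bad j))"
        by (rule measure_Un_le) (use hit out bad in auto)
      also have "prob ((\<Union>j<J. ?out j) \<union> (\<Union>j<J. ?bad j)) \<le> prob (\<Union>j<J. ?out j) + prob (\<Union>j<J. ?bad j)"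
        by (rule measure_Un_le) (use out bad in auto)
      also have "prob (\<Union>j<J. ?out j) \<le> (\<Sum>j<J. prob (?out j))"
        by (rule finite_measure_subadditive_finite) (use out in auto)
      also have "prob (\<Union>j<J. ?bad j) \<le> (\<Sum>j<J. prob (?bad j))"
        by (rule finite_measure_subadditive_finite) (use bad in auto)
      also have "prob (space M - ?hit) = 1 - h k x" using prob_compl[OF hit] h_eq[OF z(2)] by simp
      finally show ?thesis unfolding z(1) f_eq[OF z(2,3)] l_def trans_prob_def by simp
    qed
    have "c \<le> c / 2 + (\<Sum>j<J. \<integral>z. f k j z \<partial>RR)" for k
    proof -
      note H = integral_RR[OF h_m h_b] and L = integral_RR[OF l_m l_b]
      have i: "integrable RR (\<lambda>z. \<Sum>j<J. l k j (snd z))" "integrable RR (\<lambda>z. \<Sum>j<J. f k j z)"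
        "integrable RR (\<lambda>z. 1 - h k (fst z))"
        using L(2) f_i H(1) by auto
      have "c \<le> (\<integral>z. (1 - h k (fst z)) + ((\<Sum>j<J. l k j (snd z)) + (\<Sum>j<J. f k j z)) \<partial>RR)"
        unfolding c_def by (rule integral_mono[OF n_i _ pw]) (use i in auto)
      also have "\<dots> = (1 - (\<integral>x. b J x \<partial>\<rho>)) + ((\<Sum>j<J. measure \<rho> (X - K2)) + (\<Sum>j<J. \<integral>z. f k j z \<partial>RR))"
        using i H(1) L(2) f_i by (simp add: H(3) L(4) l_int h_int rr.P.prob_space)
      \<comment> \<open>Missing \<open>K1\<close> costs less than \<open>c/4\<close> by the choice
        of \<open>J\<close>, being outside \<open>K2\<close> at most \<open>c/4\<close> by that of
        \<open>K2\<close>. The remaining sum has \<open>J\<close> terms, each tending to 0 with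
        \<open>k\<close>.\<close>
      also have "\<dots> \<le> c / 2 + (\<Sum>j<J. \<integral>z. f k j z \<partial>RR)" using J K2m by simp
      finally show ?thesis .
    qed
    moreover have "(\<lambda>k. c / 2 + (\<Sum>j<J. \<integral>z. f k j z \<partial>RR)) \<longlonglongrightarrow> c / 2 + (\<Sum>j<J. 0)"
      by (intro tendsto_intros f_lim)
    ultimately have "c \<le> c / 2 + (\<Sum>j<J. 0)" by (intro LIMSEQ_le_const) auto
    then show False using c by simp
  qed
  moreover have "0 \<le> c" unfolding c_def using n_b by simp
  ultimately have "(\<integral>z. n z \<partial>RR) = 0" unfolding c_def by linarith
  then have "AE z in RR. n z = 0"
    using integral_nonneg_eq_0_iff_AE[OF n_i] n_b by auto
  then show ?thesis using AE_space
  proof eventually_elim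
    case (elim z)
    then obtain x y where z: "z = (x, y)" "x \<in> X" "y \<in> X" by (auto simp: space_pair_measure)
    have "prob {\<omega> \<in> space M. sync \<omega> x y} = 1"
    proof -
      have "Pair (x, y) -` ?H = {\<omega> \<in> space M. sync \<omega> x y}" using z by (auto simp: space_pair_measure)
      then show ?thesis using elim(1) z(1) by (simp add: n_def)
    qed
    then show ?case using prob_eq_1[OF SyM[OF z(2,3)]] z(1) by auto
  qed
qed

text \<open>Joint measurability of \<open>sync\<close> in the noise and both points allows Fubini
  twice: between the pair and the noise, and within the pair.\<close>

lemma sync_commute:
  "(AE z in RR. AE \<omega> in M. sync \<omega> (fst z) (snd z)) \<longleftrightarrow> (AE \<omega> in M. AE x in \<rho>. AE y in \<rho>. sync \<omega> x y)"
proof -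
  interpret rr: pair_prob_space \<rho> \<rho> ..
  interpret ww: pair_prob_space RR M ..
  have RRBX: "sets RR = sets (BX \<Otimes>\<^sub>M BX)" by (rule sets_pair_measure_cong[OF sets_rho sets_rho])
  have S: "{p \<in> space (RR \<Otimes>\<^sub>M M). sync (snd p) (fst (fst p)) (snd (fst p))} \<in> sets (RR \<Otimes>\<^sub>M M)"
    using pair_sets_Fut[OF sync_sets] unfolding sets_pair_measure_cong[OF RRBX refl, of M]
    by (simp add: space_pair_measure)
  have "(AE z in RR. AE \<omega> in M. sync \<omega> (fst z) (snd z)) \<longleftrightarrow> (AE \<omega> in M. AE z in RR. sync \<omega> (fst z) (snd z))"
    by (rule ww.AE_commute[where P = "\<lambda>z \<omega>. sync \<omega> (fst z) (snd z)"]) (rule S)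
  also have "\<dots> \<longleftrightarrow> (AE \<omega> in M. AE x in \<rho>. AE y in \<rho>. sync \<omega> x y)"
  proof (rule AE_cong)
    fix \<omega> assume w: "\<omega> \<in> space M"
    have "{z \<in> space RR. sync \<omega> (fst z) (snd z)}
        = (\<lambda>z. (z, \<omega>)) -` {p \<in> space (RR \<Otimes>\<^sub>M M). sync (snd p) (fst (fst p)) (snd (fst p))}"
      using w by (auto simp: space_pair_measure)
    then have "{z \<in> space RR. sync \<omega> (fst z) (snd z)} \<in> sets RR" using sets_Pair2[OF S] by simp
    from rr.AE_pair_iff[OF this]
    show "(AE z in RR. sync \<omega> (fst z) (snd z)) \<longleftrightarrow> (AE x in \<rho>. AE y in \<rho>. sync \<omega> x y)" by simp
  qed
  finally show ?thesis .
qed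

section \<open>Global synchronisation, joint visits and the way back to contractibility\<close>

lemma AE_nonempty: "AE x in \<rho>. P x \<Longrightarrow> \<exists>x\<in>X. P x"
  using rho.AE_contr AE_space
  by (metis (mono_tags, lifting) AE_E2 eventually_mono rho.AE_prob_1 space_rho)

text \<open>For fixed \<open>\<omega>\<close>, a reference point \<open>x0\<close> that synchronises
  with almost every point links the contracting basic sets, so that finitely many of them merge by
  \<open>contracts_Un\<close>. Almost every point both synchronises with \<open>x0\<close> and has a
  contracting basic neighbourhood, so the sets collected in \<open>I\<close> cover a set of full
  measure.\<close>

lemma synchronising_of_rect:
  assumes st: "stable_wrt T M X \<phi> \<rho>"
    and rect: "contains_full_rect \<rho> (contractible_set T M X \<phi> (transitive_pts T M X \<phi> \<rho>))"
  shows "ae_stably_synchronising T M X \<phi> \<rho>"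
proof -
  have sy: "AE \<omega> in M. AE x in \<rho>. AE y in \<rho>. sync \<omega> x y"
    using AE_sync[OF assms] unfolding sync_commute .
  let ?S = "{p \<in> space W. \<exists>B\<in>BB. fst p \<in> B \<and> contracts T \<phi> B (snd p)}"
  have "?S = (\<Union>B\<in>BB. B \<times> {\<omega> \<in> space M. contracts T \<phi> B \<omega>})"
    using sets.sets_into_space[OF BB_sets] by (auto simp: space_pair_measure)
  also have "\<dots> \<in> sets W"
  proof (rule sets.countable_UN''[OF countable_BB])
    fix B assume B: "B \<in> BB"
    have "{\<omega> \<in> space M. contracts T \<phi> B \<omega>} \<in> sets M" using contracts_sets[OF BB_open[OF B]] Fut_subset by blast
    then show "B \<times> {\<omega> \<in> space M. contracts T \<phi> B \<omega>} \<in> sets W" by (intro pair_measureI BB_sets B)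
  qed
  finally have "AE \<omega> in M. AE x in \<rho>. \<exists>B\<in>BB. x \<in> B \<and> contracts T \<phi> B \<omega>"
    using pair.AE_commute[where P = "\<lambda>x \<omega>. \<exists>B\<in>BB. x \<in> B \<and> contracts T \<phi> B \<omega>"] AE_stable[OF st] by blast
  with sy show ?thesis
    unfolding ae_stably_synchronising_def using AE_space
  proof eventually_elim
    case (elim \<omega>)
    note w = \<open>\<omega> \<in> space M\<close>
    obtain x0 where x0: "AE y in \<rho>. sync \<omega> x0 y" using AE_nonempty[OF elim(1)] by blast
    define I where "I = {B \<in> BB. contracts T \<phi> B \<omega> \<and> (\<exists>y\<in>B. sync \<omega> x0 y)}"
    have IX: "B \<subseteq> X" "openin (top_of_set X) B" if "B \<in> I" for B
      using that BB_open[of B] openin_imp_subset[OF BB_open[of B]] by (auto simp: I_def)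
    have cov: "AE y in \<rho>. y \<in> \<Union>I"
      using x0 elim(2) by eventually_elim (auto simp: I_def)
    have "I \<noteq> {}" using AE_nonempty[OF cov] by auto
    define e where "e = from_nat_into I"
    have cI: "countable I" using countable_subset[OF _ countable_BB] by (auto simp: I_def)
    have re: "range e = I" unfolding e_def by (rule range_from_nat_into[OF \<open>I \<noteq> {}\<close> cI])
    have eI: "e i \<in> I" for i using re by auto
    define V where "V i = (\<Union>j\<le>i. e j)" for i
    have VX: "V i \<subseteq> X" and Vo: "openin (top_of_set X) (V i)" for i
      unfolding V_def using IX eI by (blast, intro openin_Union) auto
    obtain a where a: "a \<in> e 0" "sync \<omega> x0 a" using eI[of 0] by (auto simp: I_def)
    have Vc: "contracts T \<phi> (V i) \<omega>" for i
    proof (induction i)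
      case 0
      then show ?case using eI[of 0] by (simp add: V_def I_def)
    next
      case (Suc i)
      obtain y where y: "y \<in> e (Suc i)" "sync \<omega> x0 y" using eI[of "Suc i"] by (auto simp: I_def)
      have "contracts T \<phi> (V i \<union> e (Suc i)) \<omega>"
      proof (rule contracts_Un[OF w VX IX(1)[OF eI] Suc.IH])
        show "contracts T \<phi> (e (Suc i)) \<omega>" using eI[of "Suc i"] by (simp add: I_def)
        show "a \<in> V i" using a by (auto simp: V_def)
        show "sync \<omega> a y" by (rule sync_trans[OF sync_sym[OF a(2)] y(2)])
      qed (rule y)
      moreover have "V (Suc i) = V i \<union> e (Suc i)" by (auto simp: V_def atMost_Suc)
      ultimately show ?case by simp
    qed
    have U: "\<Union>I = (\<Union>i. V i)" unfolding V_def re[symmetric] by auto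
    have Uo: "openin (top_of_set X) (\<Union>I)" by (rule openin_Union) (use IX in auto)
    have "\<Union>I \<in> sets \<rho>" using openin_sets[OF Uo] sets_rho by simp
    then have "measure \<rho> (\<Union>I) = 1" using rho.prob_eq_1 cov by blast
    moreover have "sigma_contracting T X \<phi> (\<Union>I) \<omega>"
      unfolding sigma_contracting_def
    proof (intro conjI exI[of _ V] allI)
      show "incseq V" unfolding incseq_def V_def by (intro allI impI UN_mono) auto
    qed (use Uo Vo Vc U in auto)
    ultimately show ?case using Uo by blast
  qed
qed

definition visits_jointly :: "'m set \<Rightarrow> bool" where
  "visits_jointly A \<longleftrightarrow> (\<forall>x\<in>A. \<forall>y\<in>A. AE \<omega> in M. \<forall>U. openin (top_of_set X) U \<and> 0 < measure \<rho> U \<longrightarrow>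
     (\<exists>t\<in>Tpos T. \<phi> t \<omega> x \<in> U \<and> \<phi> t \<omega> y \<in> U))"

text \<open>Synchronisation of almost all pairs does not by itself give a square of good pairs.
  Comparison with one fixed \<open>x0\<close> does, since two points that both synchronise with
  \<open>x0\<close> synchronise with each other. The countable base makes one null set of noises
  serve all \<open>U\<close>.\<close>

lemma visits_of_synchronising:
  assumes "ae_stably_synchronising T M X \<phi> \<rho>"
  shows "\<exists>A\<in>sets \<rho>. A \<subseteq> supp X \<rho> \<and> measure \<rho> A = 1 \<and> visits_jointly A"
proof -
  interpret rr: pair_prob_space \<rho> \<rho> ..
  have "AE \<omega> in M. AE x in \<rho>. AE y in \<rho>. sync \<omega> x y"
    using assms[unfolded ae_stably_synchronising_def] AE_space
  proof eventually_elim
    case (elim \<omega>)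
    note w = \<open>\<omega> \<in> space M\<close>
    obtain U Ui where U: "openin (top_of_set X) U" "measure \<rho> U = 1"
      and Ui: "incseq Ui" "\<And>i::nat. openin (top_of_set X) (Ui i)" "\<And>i. contracts T \<phi> (Ui i) \<omega>" "U = (\<Union>i. Ui i)"
      using elim(1) unfolding sigma_contracting_def by blast
    have s: "sync \<omega> x y" if xy: "x \<in> U" "y \<in> U" for x y
    proof -
      obtain i j where "x \<in> Ui i" "y \<in> Ui j" using xy Ui(4) by blast
      then have "x \<in> Ui (max i j)" "y \<in> Ui (max i j)"
        using Ui(1) by (meson incseqD max.cobounded1 max.cobounded2 subsetD)+
      then show ?thesis using contracts_sync[OF w openin_imp_subset[OF Ui(2)] Ui(3)] by blast
    qed
    have "U \<in> sets \<rho>" using openin_sets[OF U(1)] sets_rho by simp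
    then have ae: "AE x in \<rho>. x \<in> U" using rho.prob_eq_1 U(2) by blast
    show "AE x in \<rho>. AE y in \<rho>. sync \<omega> x y"
      using ae
    proof eventually_elim
      case (elim x)
      show ?case using ae by eventually_elim (rule s[OF elim])
    qed
  qed
  then have "AE z in RR. AE \<omega> in M. sync \<omega> (fst z) (snd z)" unfolding sync_commute .
  then have "AE x in \<rho>. AE y in \<rho>. AE \<omega> in M. sync \<omega> x y"
    using rr.AE_pair[of "\<lambda>z. AE \<omega> in M. sync \<omega> (fst z) (snd z)"] by simp
  then obtain x0 where x0: "AE y in \<rho>. AE \<omega> in M. sync \<omega> x0 y" using AE_nonempty by blast
  define G where "G y \<longleftrightarrow> (AE \<omega> in M. sync \<omega> x0 y) \<and> y \<in> supp X \<rho> \<and>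
    (AE \<omega> in M. \<forall>B\<in>BB. 0 < measure \<rho> B \<longrightarrow> (\<forall>n::nat. \<exists>t\<in>Q. real n \<le> t \<and> \<phi> t \<omega> y \<in> B))" for y
  have "AE y in \<rho>. G y"
    unfolding G_def using x0 AE_supp recurrence_BB by eventually_elim blast
  \<comment> \<open>The set of points satisfying \<open>G\<close> is not known to be measurable, so
    \<open>A\<close> is the complement of a measurable null set containing the exceptions.\<close>
  then obtain N where N: "{x \<in> space \<rho>. \<not> G x} \<subseteq> N" "emeasure \<rho> N = 0" "N \<in> sets \<rho>" by (rule AE_E)
  define A where "A = space \<rho> - N"
  have A: "A \<in> sets \<rho>" "measure \<rho> A = 1" "\<And>x. x \<in> A \<Longrightarrow> G x \<and> x \<in> X"
    using N rho.prob_compl[OF N(3)] sets.compl_sets[OF N(3)] by (auto simp: A_def rho.emeasure_eq_measure)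
  have "visits_jointly A"
    unfolding visits_jointly_def
  proof (intro ballI)
    fix x y assume xy: "x \<in> A" "y \<in> A"
    have "AE \<omega> in M. sync \<omega> x0 x" "AE \<omega> in M. sync \<omega> x0 y"
      and "AE \<omega> in M. \<forall>B\<in>BB. 0 < measure \<rho> B \<longrightarrow> (\<forall>n::nat. \<exists>t\<in>Q. real n \<le> t \<and> \<phi> t \<omega> x \<in> B)"
      using A(3) xy by (auto simp: G_def)
    then show "AE \<omega> in M. \<forall>U. openin (top_of_set X) U \<and> 0 < measure \<rho> U \<longrightarrow>
        (\<exists>t\<in>Tpos T. \<phi> t \<omega> x \<in> U \<and> \<phi> t \<omega> y \<in> U)"
      using AE_space
    proof (eventually_elim, intro allI impI)
      fix \<omega> U
      assume s: "sync \<omega> x0 x" "sync \<omega> x0 y"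
        and r: "\<forall>B\<in>BB. 0 < measure \<rho> B \<longrightarrow> (\<forall>n::nat. \<exists>t\<in>Q. real n \<le> t \<and> \<phi> t \<omega> x \<in> B)"
        and w: "\<omega> \<in> space M" and U: "openin (top_of_set X) U \<and> 0 < measure \<rho> U"
      have sxy: "sync \<omega> x y" by (rule sync_trans[OF sync_sym[OF s(1)] s(2)])
      from pos_measure_BB[OF conjunct1[OF U] conjunct2[OF U]]
      obtain B \<delta> where B: "B \<in> BB" "B \<subseteq> U" "0 < measure \<rho> B" "0 < \<delta>" "\<forall>z\<in>B. ball z \<delta> \<inter> X \<subseteq> U"
        by (elim bexE conjE exE)
      obtain k where k: "1 / real (Suc k) < \<delta>" using nat_approx_posE[OF B(4)] by blast
      obtain m :: nat where m: "\<And>t. t \<in> Q \<Longrightarrow> real m \<le> t \<Longrightarrow> dist (\<phi> t \<omega> x) (\<phi> t \<omega> y) \<le> 1 / real (Suc k)"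
        using sxy unfolding sync_def by blast
      \<comment> \<open>The visit of the first trajectory is taken so late that the second is
        already within the margin \<open>\<delta>\<close>.\<close>
      obtain t where t: "t \<in> Q" "real m \<le> t" "\<phi> t \<omega> x \<in> B" using r B by blast
      have "\<phi> t \<omega> y \<in> ball (\<phi> t \<omega> x) \<delta> \<inter> X"
        using m[OF t(1,2)] k phi_in[OF Q_Tpos[OF t(1)] w] A(3)[OF xy(2)] by auto
      then have "\<phi> t \<omega> x \<in> U" "\<phi> t \<omega> y \<in> U" using B t by blast+
      then show "\<exists>t\<in>Tpos T. \<phi> t \<omega> x \<in> U \<and> \<phi> t \<omega> y \<in> U" using Q_Tpos[OF t(1)] by blast
    qed
  qed
  then show ?thesis using A by (auto simp: G_def)
qed

text \<open>Balls around \<open>p\<close> have positive measure because \<open>p\<close> is in the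
  support, so joint visits to them occur almost surely. The square \<open>A \<times> A\<close>
  serves every \<open>p \<in> A\<close>.\<close>

lemma rects_of_visits:
  assumes A: "A \<in> sets \<rho>" "A \<subseteq> supp X \<rho>" "measure \<rho> A = 1" and v: "visits_jointly A" and p: "p \<in> A"
  shows "contains_full_rect \<rho> (contractible_pt T M X \<phi> p)"
proof -
  have AX: "A \<subseteq> X" using A(2) by (auto simp: supp_def)
  have "A \<times> A \<subseteq> contractible_pt T M X \<phi> p"
  proof safe
    fix x y assume xy: "x \<in> A" "y \<in> A"
    have "pos_prob M {\<omega> \<in> space M. \<exists>t\<in>Tpos T. \<phi> t \<omega> x \<in> ball p \<epsilon> \<and> \<phi> t \<omega> y \<in> ball p \<epsilon>}"
      if e: "0 < \<epsilon>" for \<epsilon>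
    proof -
      have U: "openin (top_of_set X) (X \<inter> ball p \<epsilon>)" by (intro openin_open_Int open_ball)
      moreover have "p \<in> X \<inter> ball p \<epsilon>" using p AX e by auto
      ultimately have "0 < measure \<rho> (X \<inter> ball p \<epsilon>)" using p A(2) unfolding supp_def by blast
      with U show ?thesis
        by (intro AE_pos_prob[OF v[unfolded visits_jointly_def, rule_format, OF xy]]) blast
    qed
    then show "(x, y) \<in> contractible_pt T M X \<phi> p" using xy AX by (auto simp: contractible_pt_def)
  qed
  then show ?thesis unfolding contains_full_rect_def using A by (intro exI[of _ A]) auto
qed

lemma contractible_pt_subset:
  assumes "p \<in> S" "p \<in> X"
  shows "contractible_pt T M X \<phi> p \<subseteq> contractible_set T M X \<phi> S"
proof safe
  fix x y assume xy: "(x, y) \<in> contractible_pt T M X \<phi> p"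
  have "pos_prob M {\<omega> \<in> space M. \<exists>t\<in>Tpos T. (\<phi> t \<omega> x, \<phi> t \<omega> y) \<in> V}"
    if W: "openin (top_of_set (X \<times> X)) W'" "{(a, a) |a. a \<in> S} \<subseteq> W'" "W' \<subseteq> V" for V W'
  proof -
    obtain O' where O': "open O'" "W' = (X \<times> X) \<inter> O'" using W(1) by (auto simp: openin_open)
    then have "(p, p) \<in> O'" using W(2) assms by auto
    then obtain P1 P2 where P: "open P1" "open P2" "p \<in> P1" "p \<in> P2" "P1 \<times> P2 \<subseteq> O'"
      using O'(1) by (auto elim!: open_prod_elim)
    then obtain e where e: "0 < e" "ball p e \<subseteq> P1 \<inter> P2"
      using open_contains_ball[of "P1 \<inter> P2"] by (meson IntI open_Int)
    have "pos_prob M {\<omega> \<in> space M. \<exists>t\<in>Tpos T. \<phi> t \<omega> x \<in> ball p e \<and> \<phi> t \<omega> y \<in> ball p e}"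
      and xyX: "x \<in> X" "y \<in> X"
      using xy e(1) by (auto simp: contractible_pt_def)
    then obtain E where E: "E \<in> sets M" "0 < prob E"
        "E \<subseteq> {\<omega> \<in> space M. \<exists>t\<in>Tpos T. \<phi> t \<omega> x \<in> ball p e \<and> \<phi> t \<omega> y \<in> ball p e}"
      by (auto simp: pos_prob_def)
    have "E \<subseteq> {\<omega> \<in> space M. \<exists>t\<in>Tpos T. (\<phi> t \<omega> x, \<phi> t \<omega> y) \<in> V}"
    proof
      fix \<omega> assume "\<omega> \<in> E"
      then obtain t where t: "\<omega> \<in> space M" "t \<in> Tpos T" "\<phi> t \<omega> x \<in> ball p e" "\<phi> t \<omega> y \<in> ball p e"
        using E(3) by blast
      then have "(\<phi> t \<omega> x, \<phi> t \<omega> y) \<in> (X \<times> X) \<inter> O'"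
        using e(2) P(5) phi_in[OF t(2,1)] xyX by blast
      then show "\<omega> \<in> {\<omega> \<in> space M. \<exists>t\<in>Tpos T. (\<phi> t \<omega> x, \<phi> t \<omega> y) \<in> V}" using t W(3) O'(2) by blast
    qed
    then show ?thesis using E unfolding pos_prob_def by blast
  qed
  then show "(x, y) \<in> contractible_set T M X \<phi> S"
    using xy unfolding contractible_set_def contractible_pt_def by blast
qed

text \<open>One transitive point of \<open>R\<close> is enough, since contractibility towards a
  point gives contractibility towards any set containing it. It exists because almost every point is
  transitive and \<open>R\<close> is not null.\<close>

lemma rect_transitive_of_rects:
  assumes R: "R \<in> sets \<rho>" "0 < measure \<rho> R"
    and rect: "\<And>p. p \<in> R \<Longrightarrow> contains_full_rect \<rho> (contractible_pt T M X \<phi> p)"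
  shows "contains_full_rect \<rho> (contractible_set T M X \<phi> (transitive_pts T M X \<phi> \<rho>))"
proof -
  have "\<exists>p\<in>R. p \<in> transitive_pts T M X \<phi> \<rho>"
  proof (rule ccontr)
    assume "\<not> ?thesis"
    then have "AE x in \<rho>. x \<notin> R" using AE_transitive by (auto elim!: eventually_mono)
    then show False using rho.prob_eq_0[OF R(1)] R(2) by simp
  qed
  then obtain p where p: "p \<in> R" "p \<in> transitive_pts T M X \<phi> \<rho>" by blast
  then have "p \<in> X" by (auto simp: transitive_pts_def supp_def)
  from contractible_pt_subset[OF p(2) this] rect[OF p(1)] show ?thesis
    unfolding contains_full_rect_def by (meson order_trans)
qed

end

theorem theorem2p11:
  fixes T :: "real set" and M :: "'w measure" and F :: "real \<Rightarrow> real \<Rightarrow> 'w set set"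
    and \<theta> :: "real \<Rightarrow> 'w \<Rightarrow> 'w" and X :: "'m::complete_space set"
    and \<phi> :: "real \<Rightarrow> 'w \<Rightarrow> 'm \<Rightarrow> 'm" and \<rho> :: "'m measure"
  assumes rds: "memoryless_RDS T M F \<theta> X \<phi>"
    and erg: "ergodic T M X \<phi> \<rho>"
    and stab: "stable_wrt T M X \<phi> \<rho>"
  shows
    "((\<exists>R\<in>sets \<rho>. 0 < measure \<rho> R \<and> (\<forall>p\<in>R. contains_full_rect \<rho> (contractible_pt T M X \<phi> p)))
        \<longleftrightarrow> contains_full_rect \<rho> (contractible_set T M X \<phi> (transitive_pts T M X \<phi> \<rho>)))
   \<and> (contains_full_rect \<rho> (contractible_set T M X \<phi> (transitive_pts T M X \<phi> \<rho>))
        \<longleftrightarrow> ae_stably_synchronising T M X \<phi> \<rho>)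
   \<and> (ae_stably_synchronising T M X \<phi> \<rho>
        \<longleftrightarrow> (\<exists>A\<in>sets \<rho>. A \<subseteq> supp X \<rho> \<and> measure \<rho> A = 1 \<and>
              (\<forall>x\<in>A. \<forall>y\<in>A. AE \<omega> in M. \<forall>U. openin (top_of_set X) U \<and> 0 < measure \<rho> U \<longrightarrow>
                 (\<exists>t\<in>Tpos T. \<phi> t \<omega> x \<in> U \<and> \<phi> t \<omega> y \<in> U))))"
    (is "(?i \<longleftrightarrow> ?ii) \<and> (?ii \<longleftrightarrow> ?iii) \<and> (?iii \<longleftrightarrow> ?iv)")
proof -
  interpret rds_ergodic T M F \<theta> X \<phi> \<rho>
    by unfold_locales (use rds erg in auto)
  have 12: "?ii" if "?i" using that rect_transitive_of_rects by blast
  have 23: "?iii" if "?ii" using synchronising_of_rect[OF stab that] .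
  have 34: "?iv" if "?iii" using visits_of_synchronising[OF that] unfolding visits_jointly_def .
  have 41: "?i" if "?iv"
  proof -
    from that obtain A where A: "A \<in> sets \<rho>" "A \<subseteq> supp X \<rho>" "measure \<rho> A = 1" "visits_jointly A"
      unfolding visits_jointly_def[symmetric] by blast
    then show ?thesis using rects_of_visits by (intro bexI[of _ A]) auto
  qed
  show ?thesis using 12 23 34 41 by argo
qed

end
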